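(* Let $0<q<p<\infty$ and let $g,\psi$ be nonconstant entire functions on $\mathbb{C}$. Define $$M_{(g,\psi)}(z)=\frac{|g'(z)|}{1+|z|}e^{\frac12(|\psi(z)|^2-|z|^2)},\qquad \widetilde M_{(g,\psi)}(z)=\frac{|g(z)|(1+|\psi(z)|)}{1+|z|}e^{\frac12(|\psi(z)|^2-|z|^2)}.$$ Then: (1) the following are equivalent: (a) $V_{(g,\psi)}:\mathcal{F}_p\to\mathcal{F}_q$ is bounded; (b) $V_{(g,\psi)}:\mathcal{F}_p\to\mathcal{F}_q$ is compact; (c) $M_{(g,\psi)}\in L^{\frac{pq}{p-q}}(\mathbb{C},dA)$. (2) the following are equivalent: (a) $J_{(g,\psi)}:\mathcal{F}_p\to\mathcal{F}_q$ is bounded; (b) $J_{(g,\psi)}:\mathcal{F}_p\to\mathcal{F}_q$ is compact; (c) $\widetilde M_{(g,\psi)}\in L^{\frac{pq}{p-q}}(\mathbb{C},dA)$.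
   Context: $dA$ is Lebesgue area measure on $\mathbb{C}$. For $0<p<\infty$, the Fock space $\mathcal{F}_p$ is the space of entire functions $f$ with $\|f\|_p^p=\frac{p}{2\pi}\int_{\mathbb{C}}|f(z)|^pe^{-\frac p2|z|^2}\,dA(z)<\infty$. For entire $g,\psi$, $V_{(g,\psi)}f(z)=\int_0^z f(\psi(w))g'(w)\,dw$ and $J_{(g,\psi)}f(z)=\int_0^z f'(\psi(w))g(w)\,dw$. *)

theory Defs
  imports "HOL-Complex_Analysis.Complex_Analysis"
begin

definition fock_integral :: "real \<Rightarrow> (complex \<Rightarrow> complex) \<Rightarrow> ennreal" where
  "fock_integral p f =
     (\<integral>\<^sup>+ z. ennreal (norm (f z) powr p * exp (- (p / 2) * (norm z)\<^sup>2)) \<partial>lborel)"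

definition fock_space :: "real \<Rightarrow> (complex \<Rightarrow> complex) set" where
  "fock_space p = {f. f holomorphic_on UNIV \<and> fock_integral p f < \<infinity>}"

definition fock_norm :: "real \<Rightarrow> (complex \<Rightarrow> complex) \<Rightarrow> real" where
  "fock_norm p f = (p / (2 * pi) * enn2real (fock_integral p f)) powr (1 / p)"

definition V_op :: "(complex \<Rightarrow> complex) \<Rightarrow> (complex \<Rightarrow> complex) \<Rightarrow> (complex \<Rightarrow> complex) \<Rightarrow> complex \<Rightarrow> complex" where
  "V_op g \<psi> f z = contour_integral (linepath 0 z) (\<lambda>w. f (\<psi> w) * deriv g w)"

definition J_op :: "(complex \<Rightarrow> complex) \<Rightarrow> (complex \<Rightarrow> complex) \<Rightarrow> (complex \<Rightarrow> complex) \<Rightarrow> complex \<Rightarrow> complex" where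
  "J_op g \<psi> f z = contour_integral (linepath 0 z) (\<lambda>w. deriv f (\<psi> w) * g w)"

definition fock_bounded_op :: "real \<Rightarrow> real \<Rightarrow> ((complex \<Rightarrow> complex) \<Rightarrow> (complex \<Rightarrow> complex)) \<Rightarrow> bool" where
  "fock_bounded_op p q T \<longleftrightarrow>
     (\<forall>f\<in>fock_space p. T f \<in> fock_space q) \<and>
     (\<exists>C. \<forall>f\<in>fock_space p. fock_norm q (T f) \<le> C * fock_norm p f)"

text \<open>T : F_p -> F_q is compact: maps F_p into F_q and the image of every bounded
  sequence has a subsequence converging in F_q (F_q being a complete quasi-normed space).\<close>
definition fock_compact_op :: "real \<Rightarrow> real \<Rightarrow> ((complex \<Rightarrow> complex) \<Rightarrow> (complex \<Rightarrow> complex)) \<Rightarrow> bool" where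
  "fock_compact_op p q T \<longleftrightarrow>
     (\<forall>f\<in>fock_space p. T f \<in> fock_space q) \<and>
     (\<forall>fs :: nat \<Rightarrow> complex \<Rightarrow> complex.
        (\<forall>n. fs n \<in> fock_space p) \<longrightarrow> (\<exists>B. \<forall>n. fock_norm p (fs n) \<le> B) \<longrightarrow>
        (\<exists>r h. strict_mono r \<and> h \<in> fock_space q \<and>
               (\<lambda>n. fock_norm q (\<lambda>z. T (fs (r n)) z - h z)) \<longlonglongrightarrow> 0))"

definition in_Lp :: "real \<Rightarrow> (complex \<Rightarrow> real) \<Rightarrow> bool" where
  "in_Lp s M \<longleftrightarrow> M \<in> borel_measurable lborel \<and>
     (\<integral>\<^sup>+ z. ennreal (\<bar>M z\<bar> powr s) \<partial>lborel) < \<infinity>"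

definition M_fun :: "(complex \<Rightarrow> complex) \<Rightarrow> (complex \<Rightarrow> complex) \<Rightarrow> complex \<Rightarrow> real" where
  "M_fun g \<psi> z = norm (deriv g z) / (1 + norm z) *
      exp (((norm (\<psi> z))\<^sup>2 - (norm z)\<^sup>2) / 2)"

definition M_tilde :: "(complex \<Rightarrow> complex) \<Rightarrow> (complex \<Rightarrow> complex) \<Rightarrow> complex \<Rightarrow> real" where
  "M_tilde g \<psi> z = norm (g z) * (1 + norm (\<psi> z)) / (1 + norm z) *
      exp (((norm (\<psi> z))\<^sup>2 - (norm z)\<^sup>2) / 2)"

end

theory Submission
  imports Defs
begin

text \<open>
  Everything rests on two facts. First, \<open>\<integral> |f|\<^sup>q exp (- q|z|\<^sup>2/2)\<close> is comparable, for entire \<open>f\<close> with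
  \<open>f 0 = 0\<close>, to the same integral of \<open>|f'| / (1 + |z|)\<close>, for every \<open>q > 0\<close>; this turns boundedness of
  \<open>V\<close> and \<open>J\<close> into a Carleson inequality for the measure \<open>M\<^sup>q dA\<close> transported by \<open>\<psi>\<close>. Second, each of
  the conditions makes \<open>|h| exp ((|\<psi>|\<^sup>2 - |z|\<^sup>2)/2) / (1 + |z|)\<close> bounded, where \<open>h\<close> is \<open>g'\<close> or \<open>g\<close>,
  and a maximum principle argument then forces \<open>\<psi>\<close> to be affine. For affine nonconstant \<open>\<psi>\<close>,
  integrability of \<open>M\<close> gives compactness by Young's inequality, Montel's theorem and dominated
  convergence. Conversely, testing the Carleson inequality on random sums of reproducing kernels
  centred at lattice points bounds the local masses of \<open>M\<^sup>q\<close> in \<open>\<ell>\<^bsup>p/(p-q)\<^esup>\<close>, and the mean value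
  inequality passes from local masses to \<open>M\<close> itself.
\<close>

section \<open>Lebesgue measure on the complex plane\<close>

text \<open>No exponent is assumed to be at least 1, so the triangle inequality and duality of
  Lebesgue spaces are not at hand. The substitute is subharmonicity: powers of moduli of entire
  functions, multiplied by a Gaussian weight, are still bounded by their means over unit balls,
  uniformly in the function and the centre.

  The exponent pq/(p-q) is q times p/(p-q), the conjugate of p/q: |f|^q in L^(p/q) is paired with
  M^q. Affinity of \<psi> makes this usable, since transport by \<psi> is then a change of variables
  with constant Jacobian. It is forced by growth: |h| exp (|\<psi>|^2/2) may grow at most like a
  Gaussian times a linear factor, while a nonzero second Taylor coefficient of \<psi> where h is
  nonzero would force the exponential of a multiple of r^4.

  Random signs serve only to isolate single terms; the decay of the kernels supplies the summability
  over the lattice that a square function would otherwise give.\<close>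

lemma ennreal_finiteE:
  fixes x :: ennreal
  assumes "x \<noteq> top"
  obtains r where "x = ennreal r" "0 \<le> r"
  using assms by (cases x) auto

text \<open>Tonelli's theorem in real coordinates needs area measure as the image of a product
  measure. By \<open>lborel_eqI\<close> it is enough to compare the measures of open boxes.\<close>

lemma lborel_complex_eq_distr:
  "(lborel :: complex measure) = distr (lborel \<Otimes>\<^sub>M lborel) borel (\<lambda>(x, y). Complex x y)"
proof (rule lborel_eqI)
  fix l u :: complex
  assume lu: "\<And>b. b \<in> Basis \<Longrightarrow> l \<bullet> b \<le> u \<bullet> b"
  have le: "Re l \<le> Re u" "Im l \<le> Im u"
    using lu[of 1] lu[of \<i>] by (auto simp: Basis_complex_def)
  have meas: "(\<lambda>(x, y). Complex x y) \<in> borel_measurable (lborel \<Otimes>\<^sub>M lborel)"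
    by (auto simp: borel_measurable_complex_iff split_beta)
  have "(\<lambda>(x, y). Complex x y) -` box l u \<inter> space (lborel \<Otimes>\<^sub>M lborel)
      = {Re l<..<Re u} \<times> {Im l<..<Im u}"
    by (auto simp: in_box_complex_iff space_pair_measure)
  then show "emeasure (distr (lborel \<Otimes>\<^sub>M lborel) borel (\<lambda>(x, y). Complex x y)) (box l u)
      = (\<Prod>b\<in>Basis. (u - l) \<bullet> b)"
    using le meas
    by (simp add: emeasure_distr lborel.emeasure_pair_measure_Times Basis_complex_def
        ennreal_mult'[symmetric])
qed (rule refl | simp)+

lemma nn_integral_lborel_complex:
  assumes [measurable]: "f \<in> borel_measurable borel"
  shows "(\<integral>\<^sup>+ z. f z \<partial>(lborel :: complex measure)) = (\<integral>\<^sup>+ x. \<integral>\<^sup>+ y. f (Complex x y) \<partial>lborel \<partial>lborel)"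
proof -
  have [measurable]: "(\<lambda>(x, y). Complex x y) \<in> borel_measurable (lborel \<Otimes>\<^sub>M lborel)"
    by (auto simp: borel_measurable_complex_iff split_beta)
  have "(\<integral>\<^sup>+ z. f z \<partial>lborel) = (\<integral>\<^sup>+ z. f (case z of (x, y) \<Rightarrow> Complex x y) \<partial>(lborel \<Otimes>\<^sub>M lborel))"
    by (subst lborel_complex_eq_distr, subst nn_integral_distr) auto
  also have "\<dots> = (\<integral>\<^sup>+ x. \<integral>\<^sup>+ y. f (Complex x y) \<partial>lborel \<partial>lborel)"
    by (subst lborel.nn_integral_fst[symmetric]) (auto)
  finally show ?thesis .
qed

lemma measurable_Complex [measurable (raw)]:
  assumes [measurable]: "f \<in> borel_measurable M" "g \<in> borel_measurable M"
  shows "(\<lambda>x. Complex (f x) (g x)) \<in> borel_measurable M"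
  by (simp add: borel_measurable_complex_iff assms)

text \<open>Multiplication by \<open>a\<close> is a real linear map of determinant |a|^2. The
  substitution is carried out one real coordinate at a time, by one-dimensional affine changes of
  variable and Tonelli's theorem. This elimination divides by \<open>Re a\<close>, hence the
  separate case of a purely imaginary factor.\<close>

lemma nn_integral_lborel_complex_scale:
  fixes a :: complex
  assumes a: "a \<noteq> 0" and [measurable]: "f \<in> borel_measurable borel"
  shows "(\<integral>\<^sup>+ z. f (a * z) \<partial>lborel) = ennreal (1 / (norm a)\<^sup>2) * (\<integral>\<^sup>+ z. f z \<partial>lborel)"
proof -
  let ?\<alpha> = "Re a" and ?\<beta> = "Im a"
  have na: "(norm a)\<^sup>2 = ?\<alpha>\<^sup>2 + ?\<beta>\<^sup>2" by (simp add: cmod_power2)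
  have pos: "?\<alpha>\<^sup>2 + ?\<beta>\<^sup>2 > 0" using a na by (metis zero_less_norm_iff zero_less_power)
  have eq: "a * Complex x y = Complex (?\<alpha> * x - ?\<beta> * y) (?\<alpha> * y + ?\<beta> * x)" for x y
    by (simp add: complex_eq_iff)
  have "(\<integral>\<^sup>+ z. f (a * z) \<partial>lborel)
      = (\<integral>\<^sup>+ x. \<integral>\<^sup>+ y. f (Complex (?\<alpha> * x - ?\<beta> * y) (?\<alpha> * y + ?\<beta> * x)) \<partial>lborel \<partial>lborel)"
    by (subst nn_integral_lborel_complex) (auto simp: eq)
  also have "\<dots> = ennreal (1 / (norm a)\<^sup>2) * (\<integral>\<^sup>+ x. \<integral>\<^sup>+ y. f (Complex x y) \<partial>lborel \<partial>lborel)"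
  proof (cases "?\<alpha> = 0")
    case True
    then have b: "?\<beta> \<noteq> 0" using pos by auto
    have 1: "(\<integral>\<^sup>+ v. f (Complex u v) \<partial>lborel) = ennreal \<bar>?\<beta>\<bar> * (\<integral>\<^sup>+ x. f (Complex u (?\<beta> * x)) \<partial>lborel)" for u
      by (subst nn_integral_real_affine[where c="?\<beta>" and t=0]) (use b in auto)
    have "(\<integral>\<^sup>+ x. \<integral>\<^sup>+ y. f (Complex x y) \<partial>lborel \<partial>lborel)
       = ennreal \<bar>?\<beta>\<bar> * (\<integral>\<^sup>+ u. \<integral>\<^sup>+ x. f (Complex u (?\<beta> * x)) \<partial>lborel \<partial>lborel)"
      by (simp add: 1 nn_integral_cmult)
    also have "\<dots> = ennreal \<bar>?\<beta>\<bar> * (ennreal \<bar>-?\<beta>\<bar> * (\<integral>\<^sup>+ y. \<integral>\<^sup>+ x. f (Complex (0 + (-?\<beta>) * y) (?\<beta> * x)) \<partial>lborel \<partial>lborel))"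
      by (subst nn_integral_real_affine[where c="-?\<beta>" and t=0]) (use b in auto)
    also have "\<dots> = ennreal (?\<beta>\<^sup>2) * (\<integral>\<^sup>+ y. \<integral>\<^sup>+ x. f (Complex (- ?\<beta> * y) (?\<beta> * x)) \<partial>lborel \<partial>lborel)"
      by (simp add: mult.assoc[symmetric] ennreal_mult'[symmetric] power2_eq_square abs_mult_self_eq)
    also have "(\<integral>\<^sup>+ y. \<integral>\<^sup>+ x. f (Complex (- ?\<beta> * y) (?\<beta> * x)) \<partial>lborel \<partial>lborel)
        = (\<integral>\<^sup>+ x. \<integral>\<^sup>+ y. f (Complex (- ?\<beta> * y) (?\<beta> * x)) \<partial>lborel \<partial>lborel)"
      by (rule lborel_pair.Fubini') measurable
    finally show ?thesis using b True
      by (simp add: na mult.assoc[symmetric] ennreal_mult'[symmetric])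
  next
    case False
    \<comment> \<open>Eliminating x from u = \<alpha> x - \<beta> y and v = \<alpha> y + \<beta> x
      gives v = \<beta> u / \<alpha> + \<gamma> y. So y first replaces v at fixed u, then x replaces
      u at fixed y, with Jacobians \<gamma> and \<alpha>.\<close>
    define \<gamma> where "\<gamma> = (?\<alpha>\<^sup>2 + ?\<beta>\<^sup>2) / ?\<alpha>"
    have g0: "\<gamma> \<noteq> 0" using False pos by (simp add: \<gamma>_def)
    have 1: "(\<integral>\<^sup>+ v. f (Complex u v) \<partial>lborel)
        = ennreal \<bar>\<gamma>\<bar> * (\<integral>\<^sup>+ y. f (Complex u (?\<beta> * u / ?\<alpha> + \<gamma> * y)) \<partial>lborel)" for u
      by (subst nn_integral_real_affine[where c="\<gamma>" and t="?\<beta> * u / ?\<alpha>"]) (use g0 in auto)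
    have 2: "(\<integral>\<^sup>+ u. f (Complex u (?\<beta> * u / ?\<alpha> + \<gamma> * y)) \<partial>lborel)
        = ennreal \<bar>?\<alpha>\<bar> * (\<integral>\<^sup>+ x. f (Complex (?\<alpha> * x - ?\<beta> * y) (?\<alpha> * y + ?\<beta> * x)) \<partial>lborel)" for y
    proof -
      have e: "?\<beta> * (- ?\<beta> * y + ?\<alpha> * x) / ?\<alpha> + \<gamma> * y = ?\<alpha> * y + ?\<beta> * x" for x
        using False by (simp add: \<gamma>_def field_simps power2_eq_square)
      have "(\<integral>\<^sup>+ u. f (Complex u (?\<beta> * u / ?\<alpha> + \<gamma> * y)) \<partial>lborel) = ennreal \<bar>?\<alpha>\<bar> *
         (\<integral>\<^sup>+ x. f (Complex (- ?\<beta> * y + ?\<alpha> * x) (?\<beta> * (- ?\<beta> * y + ?\<alpha> * x) / ?\<alpha> + \<gamma> * y)) \<partial>lborel)"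
        by (subst nn_integral_real_affine[where c="?\<alpha>" and t="- ?\<beta> * y"]) (use False in auto)
      then show ?thesis unfolding e by simp
    qed
    have "(\<integral>\<^sup>+ x. \<integral>\<^sup>+ y. f (Complex x y) \<partial>lborel \<partial>lborel)
       = ennreal \<bar>\<gamma>\<bar> * (\<integral>\<^sup>+ u. \<integral>\<^sup>+ y. f (Complex u (?\<beta> * u / ?\<alpha> + \<gamma> * y)) \<partial>lborel \<partial>lborel)"
      by (simp add: 1 nn_integral_cmult)
    also have "(\<integral>\<^sup>+ u. \<integral>\<^sup>+ y. f (Complex u (?\<beta> * u / ?\<alpha> + \<gamma> * y)) \<partial>lborel \<partial>lborel)
      = (\<integral>\<^sup>+ y. \<integral>\<^sup>+ u. f (Complex u (?\<beta> * u / ?\<alpha> + \<gamma> * y)) \<partial>lborel \<partial>lborel)"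
      by (rule lborel_pair.Fubini') measurable
    also have "\<dots> = ennreal \<bar>?\<alpha>\<bar> * (\<integral>\<^sup>+ y. \<integral>\<^sup>+ x. f (Complex (?\<alpha> * x - ?\<beta> * y) (?\<alpha> * y + ?\<beta> * x)) \<partial>lborel \<partial>lborel)"
      by (simp add: 2 nn_integral_cmult)
    also have "(\<integral>\<^sup>+ y. \<integral>\<^sup>+ x. f (Complex (?\<alpha> * x - ?\<beta> * y) (?\<alpha> * y + ?\<beta> * x)) \<partial>lborel \<partial>lborel)
      = (\<integral>\<^sup>+ x. \<integral>\<^sup>+ y. f (Complex (?\<alpha> * x - ?\<beta> * y) (?\<alpha> * y + ?\<beta> * x)) \<partial>lborel \<partial>lborel)"
      by (rule lborel_pair.Fubini') measurable
    finally have 3: "(\<integral>\<^sup>+ x. \<integral>\<^sup>+ y. f (Complex x y) \<partial>lborel \<partial>lborel) = ennreal \<bar>\<gamma>\<bar> * (ennreal \<bar>?\<alpha>\<bar> *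
       (\<integral>\<^sup>+ x. \<integral>\<^sup>+ y. f (Complex (?\<alpha> * x - ?\<beta> * y) (?\<alpha> * y + ?\<beta> * x)) \<partial>lborel \<partial>lborel))" .
    have "\<bar>\<gamma>\<bar> * \<bar>?\<alpha>\<bar> = ?\<alpha>\<^sup>2 + ?\<beta>\<^sup>2"
      using False pos by (simp add: \<gamma>_def abs_mult[symmetric])
    then have "1 / (?\<alpha>\<^sup>2 + ?\<beta>\<^sup>2) * \<bar>\<gamma>\<bar> * \<bar>?\<alpha>\<bar> = 1"
      using pos by (metis less_numeral_extra(3) mult.assoc nonzero_eq_divide_eq)
    then show ?thesis
      unfolding 3 na by (simp add: mult.assoc[symmetric] ennreal_mult'[symmetric] del: times_divide_eq_left)
  qed
  also have "(\<integral>\<^sup>+ x. \<integral>\<^sup>+ y. f (Complex x y) \<partial>lborel \<partial>lborel) = (\<integral>\<^sup>+ z. f z \<partial>lborel)"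
    by (simp add: nn_integral_lborel_complex)
  finally show ?thesis .
qed

lemma nn_integral_lborel_translate:
  fixes b :: "'a :: euclidean_space"
  assumes [measurable]: "f \<in> borel_measurable borel"
  shows "(\<integral>\<^sup>+ z. f (b + z) \<partial>lborel) = (\<integral>\<^sup>+ z. f z \<partial>lborel)"
proof -
  have "(\<integral>\<^sup>+ z. f z \<partial>lborel) = (\<integral>\<^sup>+ z. f z \<partial>(distr lborel borel ((+) b)))"
    by (simp add: lborel_distr_plus)
  then show ?thesis by (simp add: nn_integral_distr)
qed

lemma nn_integral_lborel_complex_affine:
  fixes a b :: complex
  assumes "a \<noteq> 0" and [measurable]: "f \<in> borel_measurable borel"
  shows "(\<integral>\<^sup>+ z. f (a * z + b) \<partial>lborel) = ennreal (1 / (norm a)\<^sup>2) * (\<integral>\<^sup>+ z. f z \<partial>lborel)"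
  using nn_integral_lborel_complex_scale[OF assms(1), of "\<lambda>z. f (b + z)"]
    nn_integral_lborel_translate[OF assms(2), of b]
  by (simp add: add.commute)

lemma nn_integral_exp_norm_sq_finite:
  fixes c :: real
  assumes c: "c > 0"
  shows "(\<integral>\<^sup>+ z. ennreal (exp (- c * (norm (z::complex))\<^sup>2)) \<partial>lborel) < \<infinity>"
proof -
  have half: "(\<integral>\<^sup>+ x. ennreal (exp (- x)) * indicator {0..} x \<partial>lborel) = 1"
  proof -
    have "((\<lambda>x. - exp (- x)) \<longlongrightarrow> 0) (at_top :: real filter)"
      using tendsto_minus[OF filterlim_compose[OF exp_at_bot filterlim_uminus_at_bot_at_top]] by simp
    then have "(\<integral>\<^sup>+ x. ennreal (exp (- x)) * indicator {0..} x \<partial>lborel) = ennreal (0 - (- exp (- 0)))"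
      by (intro nn_integral_FTC_atLeast) (auto intro!: derivative_eq_intros)
    then show ?thesis by simp
  qed
  have half': "(\<integral>\<^sup>+ x. ennreal (exp x) * indicator {..0} x \<partial>lborel) = 1"
    using half by (subst nn_integral_real_affine[where c="-1" and t=0]) (auto simp: indicator_def atLeast_def)
  have I: "(\<integral>\<^sup>+ x. ennreal (exp (- c * x\<^sup>2)) \<partial>lborel) < \<infinity>"
  proof -
    \<comment> \<open>Completing the square trades the Gaussian for exp (-|x|), whose integral is
      elementary.\<close>
    have bd: "exp (- c * x\<^sup>2) \<le> exp (1 / (4 * c)) * exp (- \<bar>x\<bar>)" for x :: real
    proof -
      have "0 \<le> c * (\<bar>x\<bar> - 1 / (2 * c))\<^sup>2" using c by simp
      also have "\<dots> = c * x\<^sup>2 - \<bar>x\<bar> + 1 / (4 * c)"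
        using c by (simp add: power2_diff field_simps power2_eq_square)
      finally show ?thesis by (simp add: exp_add[symmetric])
    qed
    have "(\<integral>\<^sup>+ x. ennreal (exp (- c * x\<^sup>2)) \<partial>lborel)
       \<le> (\<integral>\<^sup>+ x. ennreal (exp (1 / (4 * c))) * (ennreal (exp (- x)) * indicator {0..} x + ennreal (exp x) * indicator {..0} x) \<partial>lborel)"
    proof (rule nn_integral_mono)
      fix x :: real
      have "ennreal (exp (- c * x\<^sup>2)) \<le> ennreal (exp (1 / (4 * c))) * ennreal (exp (- \<bar>x\<bar>))"
        using bd[of x] by (simp add: ennreal_mult'[symmetric])
      also have "ennreal (exp (- \<bar>x\<bar>)) \<le> ennreal (exp (- x)) * indicator {0..} x + ennreal (exp x) * indicator {..0} x"
        by (cases "x \<ge> 0") (auto simp: indicator_def)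
      finally show "ennreal (exp (- c * x\<^sup>2)) \<le> ennreal (exp (1 / (4 * c))) * (ennreal (exp (- x)) * indicator {0..} x + ennreal (exp x) * indicator {..0} x)"
        by (simp add: mult_left_mono)
    qed
    also have "\<dots> = ennreal (exp (1 / (4 * c))) * 2"
      by (simp add: nn_integral_cmult nn_integral_add half half')
    also have "\<dots> < \<infinity>" by (simp add: ennreal_mult_less_top)
    finally show ?thesis .
  qed
  have "(\<integral>\<^sup>+ z. ennreal (exp (- c * (norm (z::complex))\<^sup>2)) \<partial>lborel)
     = (\<integral>\<^sup>+ x. \<integral>\<^sup>+ y. ennreal (exp (- c * x\<^sup>2)) * ennreal (exp (- c * y\<^sup>2)) \<partial>lborel \<partial>lborel)"
    by (subst nn_integral_lborel_complex)
      (auto simp: cmod_power2 ennreal_mult'[symmetric] exp_add[symmetric] algebra_simps)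
  also have "\<dots> = (\<integral>\<^sup>+ x. ennreal (exp (- c * x\<^sup>2)) \<partial>lborel) * (\<integral>\<^sup>+ x. ennreal (exp (- c * x\<^sup>2)) \<partial>lborel)"
    by (simp add: nn_integral_cmult nn_integral_multc)
  also have "\<dots> < \<infinity>" using I by (simp add: ennreal_mult_less_top)
  finally show ?thesis .
qed

section \<open>Mean value inequalities\<close>

lemma pred_mem_ball [measurable (raw)]:
  fixes f g :: "'a \<Rightarrow> 'b :: euclidean_space"
  assumes [measurable]: "f \<in> borel_measurable M" "g \<in> borel_measurable M"
  shows "Measurable.pred M (\<lambda>x. f x \<in> ball (g x) r)"
  unfolding mem_ball by measurable

lemma entire_borel_measurable [measurable_dest]:
  "F holomorphic_on UNIV \<Longrightarrow> F \<in> borel_measurable borel"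
  by (intro borel_measurable_continuous_onI holomorphic_on_imp_continuous_on)

lemma entire_compose:
  fixes f g :: "complex \<Rightarrow> complex"
  assumes "f holomorphic_on UNIV" "g holomorphic_on UNIV"
  shows "(\<lambda>z. f (g z)) holomorphic_on UNIV"
  using holomorphic_on_compose_gen[OF assms(2,1)] by (simp add: o_def)

text \<open>Cauchy's formula on the unit circle for the function u -> F (u z). The radius sits in
  \<open>z\<close>, so moving along the circle is multiplication by a number of modulus 1, under
  which area measure is invariant.\<close>

lemma entire_norm_le_circle_mean:
  assumes F: "F holomorphic_on UNIV"
  shows "ennreal (norm (F 0)) \<le> (\<integral>\<^sup>+ t\<in>{0..1}. ennreal (norm (F (exp (2 * of_real pi * \<i> * of_real t) * z))) \<partial>lborel)"
proof -
  let ?e = "\<lambda>t::real. exp (2 * of_real pi * \<i> * of_real t)"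
  let ?G = "\<lambda>u. F (u * z)"
  have G: "?G holomorphic_on A" for A
    by (rule holomorphic_on_subset[OF entire_compose[OF F]]) (auto intro!: holomorphic_intros)
  have "((\<lambda>u. ?G u / (u - 0)) has_contour_integral (2 * of_real pi * \<i> * ?G 0)) (circlepath 0 1)"
    by (rule Cauchy_integral_circlepath) (auto intro!: G holomorphic_on_imp_continuous_on)
  then have "((\<lambda>x. 2 * of_real pi * \<i> * F (?e x * z)) has_integral (2 * of_real pi * \<i> * F 0)) {0..1}"
    unfolding has_contour_integral_def mult_zero_left
    by (rule has_integral_eq[rotated]) (subst vector_derivative_circlepath01, auto simp: circlepath)
  then have "((\<lambda>x. (1 / (2 * of_real pi * \<i>)) * (2 * of_real pi * \<i> * F (?e x * z))) has_integral
      ((1 / (2 * of_real pi * \<i>)) * (2 * of_real pi * \<i> * F 0))) {0..1}"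
    by (rule has_integral_mult_right)
  then have hi: "((\<lambda>x. F (?e x * z)) has_integral F 0) {0..1}"
    by simp
  have cont: "continuous_on {0..1} (\<lambda>x. F (?e x * z))"
    by (rule continuous_on_compose2[OF holomorphic_on_imp_continuous_on[OF F]])
      (auto intro!: continuous_intros)
  have si: "set_integrable lborel {0..1} (\<lambda>x. F (?e x * z))"
    by (rule borel_integrable_atLeastAtMost'[OF cont])
  have "F 0 = (LINT x:{0..1}|lborel. F (?e x * z))"
    using set_borel_integral_eq_integral(2)[OF si] integral_unique[OF hi] by simp
  then have "ennreal (norm (F 0)) \<le> (\<integral>\<^sup>+ t. norm (indicator {0..1} t *\<^sub>R F (?e t * z)) \<partial>lborel)"
    using integral_norm_bound_ennreal si unfolding set_integrable_def set_lebesgue_integral_def by metis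
  also have "\<dots> = (\<integral>\<^sup>+ t\<in>{0..1}. ennreal (norm (F (?e t * z))) \<partial>lborel)"
    by (intro nn_integral_cong) (auto simp: indicator_def)
  finally show ?thesis .
qed

text \<open>Integrating the circle inequality over \<open>z\<close> in the disc and exchanging the
  integrals gives the area mean by rotation invariance, without polar coordinates.\<close>

lemma entire_norm_le_disc_mean:
  assumes F: "F holomorphic_on UNIV" and r: "r > 0"
  shows "ennreal (pi * r\<^sup>2) * ennreal (norm (F z0)) \<le> (\<integral>\<^sup>+ w\<in>ball z0 r. ennreal (norm (F w)) \<partial>lborel)"
proof -
  let ?e = "\<lambda>t::real. exp (2 * of_real pi * \<i> * of_real t) :: complex"
  define H where "H z = F (z0 + z)" for z
  have H: "H holomorphic_on UNIV" unfolding H_def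
    by (rule entire_compose[OF F]) (auto intro!: holomorphic_intros)
  note [measurable] = entire_borel_measurable[OF H] entire_borel_measurable[OF F]
  have [simp]: "norm (?e t) = 1" for t by simp
  have em: "emeasure lborel (ball (0::complex) r) = ennreal (pi * r\<^sup>2)"
    using r by (subst emeasure_ball) (auto simp: unit_ball_vol_2)
  have "ennreal (pi * r\<^sup>2) * ennreal (norm (F z0)) = (\<integral>\<^sup>+ z\<in>ball (0::complex) r. ennreal (norm (H 0)) \<partial>lborel)"
    by (subst nn_integral_cmult_indicator) (simp_all add: em H_def mult.commute)
  also have "\<dots> \<le> (\<integral>\<^sup>+ z. (\<integral>\<^sup>+ t\<in>{0..1}. ennreal (norm (H (?e t * z))) \<partial>lborel) * indicator (ball 0 r) z \<partial>lborel)"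
    by (intro nn_integral_mono mult_right_mono entire_norm_le_circle_mean H) auto
  also have "\<dots> = (\<integral>\<^sup>+ z. (\<integral>\<^sup>+ t. ennreal (norm (H (?e t * z))) * indicator (ball 0 r) (?e t * z) * indicator {0..1} t \<partial>lborel) \<partial>lborel)"
    by (intro nn_integral_cong, subst nn_integral_multc[symmetric])
       (auto intro!: nn_integral_cong simp: indicator_def norm_mult)
  also have "\<dots> = (\<integral>\<^sup>+ t. (\<integral>\<^sup>+ z. ennreal (norm (H (?e t * z))) * indicator (ball 0 r) (?e t * z) * indicator {0..1} t \<partial>lborel) \<partial>lborel)"
    by (rule lborel_pair.Fubini') measurable
  also have "\<dots> = (\<integral>\<^sup>+ t. (\<integral>\<^sup>+ z. ennreal (norm (H (?e t * z))) * indicator (ball 0 r) (?e t * z) \<partial>lborel) * indicator {0..1} t \<partial>lborel)"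
    by (intro nn_integral_cong nn_integral_multc) measurable
  also have "\<dots> = (\<integral>\<^sup>+ t. (\<integral>\<^sup>+ z. ennreal (norm (H z)) * indicator (ball 0 r) z \<partial>lborel) * indicator {0..1} (t::real) \<partial>lborel)"
  proof (intro nn_integral_cong)
    fix t :: real
    have "(\<integral>\<^sup>+ z. ennreal (norm (H (?e t * z))) * indicator (ball 0 r) (?e t * z) \<partial>lborel)
      = (\<integral>\<^sup>+ z. ennreal (norm (H z)) * indicator (ball 0 r) z \<partial>lborel)"
      using nn_integral_lborel_complex_scale[of "?e t" "\<lambda>z. ennreal (norm (H z)) * indicator (ball 0 r) z"]
      by simp
    then show "(\<integral>\<^sup>+ z. ennreal (norm (H (?e t * z))) * indicator (ball 0 r) (?e t * z) \<partial>lborel) * indicator {0..1} t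
      = (\<integral>\<^sup>+ z. ennreal (norm (H z)) * indicator (ball 0 r) z \<partial>lborel) * indicator {0..1} t"
      by simp
  qed
  also have "\<dots> = (\<integral>\<^sup>+ z. ennreal (norm (H z)) * indicator (ball 0 r) z \<partial>lborel)"
    by (subst nn_integral_cmult_indicator) simp_all
  also have "\<dots> = (\<integral>\<^sup>+ z. ennreal (norm (F (z0 + z))) * indicator (ball z0 r) (z0 + z) \<partial>lborel)"
    by (intro nn_integral_cong) (auto simp: H_def indicator_def dist_norm)
  also have "\<dots> = (\<integral>\<^sup>+ z. ennreal (norm (F z)) * indicator (ball z0 r) z \<partial>lborel)"
    by (rule nn_integral_lborel_translate) measurable
  finally show ?thesis .
qed

text \<open>For exponents below one, the mean value inequality is improved by the Hardy--Littlewood device of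
  maximising \<open>(1 - |z|) powr (2/s) * |F z|\<close> over the disc.\<close>

lemma entire_powr_submean_le_1:
  assumes F: "F holomorphic_on UNIV" and s: "0 < s" "s \<le> 1"
  shows "ennreal (norm (F 0) powr s)
    \<le> ennreal (2 powr (2 / s) / pi) * (\<integral>\<^sup>+ w\<in>ball 0 1. ennreal (norm (F w) powr s) \<partial>lborel)"
proof (cases "(\<integral>\<^sup>+ w\<in>ball 0 1. ennreal (norm (F w) powr s) \<partial>lborel) = \<infinity> \<or> F 0 = 0")
  case True
  then show ?thesis
  proof
    assume inf: "(\<integral>\<^sup>+ w\<in>ball 0 1. ennreal (norm (F w) powr s) \<partial>lborel) = \<infinity>"
    have "0 < 2 powr (2 / s) / pi" by simp
    then show ?thesis unfolding inf by (simp add: ennreal_mult_top)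
  qed simp
next
  case False
  then obtain i where i: "(\<integral>\<^sup>+ w\<in>ball 0 1. ennreal (norm (F w) powr s) \<partial>lborel) = ennreal i" "i \<ge> 0"
    by (auto elim: ennreal_finiteE)
  note [measurable] = entire_borel_measurable[OF F]
  define \<phi> where "\<phi> w = (1 - norm w) powr (2 / s) * norm (F w)" for w
  have "continuous_on (cball 0 1) \<phi>"
    unfolding \<phi>_def
    by (intro continuous_intros continuous_on_powr' holomorphic_on_imp_continuous_on[OF holomorphic_on_subset[OF F]])
      (use s in auto)
  then obtain z where z: "z \<in> cball 0 1" and max: "\<And>w. w \<in> cball 0 1 \<Longrightarrow> \<phi> w \<le> \<phi> z"
    using continuous_attains_sup[of "cball (0::complex) 1" \<phi>] by auto
  have ph0: "norm (F 0) \<le> \<phi> z" using max[of 0] by (simp add: \<phi>_def)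
  then have ph: "\<phi> z > 0" using False by (smt (verit) zero_less_norm_iff)
  \<comment> \<open>Half the distance from the maximum point to the unit circle: every point of the
    ball of radius \<rho> about \<open>z\<close> still keeps distance at least \<rho> from the
    circle, so maximality of \<phi> bounds |F| there by \<open>?b\<close>.\<close>
  define \<rho> where "\<rho> = (1 - norm z) / 2"
  have nz: "norm z \<noteq> 1" using ph s by (auto simp: \<phi>_def)
  then have rho: "\<rho> > 0" using z by (simp add: \<rho>_def dist_norm)
  let ?b = "\<phi> z * \<rho> powr (- (2 / s))"
  have b: "?b > 0" using ph rho by simp
  have sub: "norm w + \<rho> \<le> 1" if "w \<in> ball z \<rho>" for w
    using norm_triangle_ineq[of z "w - z"] that by (simp add: \<rho>_def dist_norm norm_minus_commute field_simps)
  have Fb: "norm (F w) \<le> ?b" if w: "w \<in> ball z \<rho>" for w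
  proof -
    have "\<rho> powr (2 / s) * norm (F w) \<le> \<phi> w"
      unfolding \<phi>_def using sub[OF w] rho s by (intro mult_right_mono powr_mono2) auto
    also have "\<dots> \<le> \<phi> z" using sub[OF w] rho by (intro max) auto
    finally show ?thesis using rho by (simp add: powr_minus field_simps)
  qed
  have "ennreal (pi * \<rho>\<^sup>2) * ennreal (norm (F z)) \<le> (\<integral>\<^sup>+ w\<in>ball z \<rho>. ennreal (norm (F w)) \<partial>lborel)"
    by (rule entire_norm_le_disc_mean[OF F rho])
  \<comment> \<open>Of the first power of |F|, the part 1 - s goes to the bound \<open>?b\<close>,
    which leaves the power s under the integral. This is where s \<le> 1 enters.\<close>
  also have "\<dots> \<le> (\<integral>\<^sup>+ w. ennreal (?b powr (1 - s)) * (ennreal (norm (F w) powr s) * indicator (ball 0 1) w) \<partial>lborel)"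
  proof (intro nn_integral_mono)
    fix w
    show "ennreal (norm (F w)) * indicator (ball z \<rho>) w
      \<le> ennreal (?b powr (1 - s)) * (ennreal (norm (F w) powr s) * indicator (ball 0 1) w)"
    proof (cases "w \<in> ball z \<rho>")
      case True
      then have in1: "w \<in> ball 0 1" using sub[OF True] rho by auto
      have "norm (F w) = norm (F w) powr (1 - s) * norm (F w) powr s"
        by (simp flip: powr_add)
      also have "\<dots> \<le> ?b powr (1 - s) * norm (F w) powr s"
        using Fb[OF True] s by (intro mult_right_mono powr_mono2) auto
      finally show ?thesis using True in1 by (simp add: ennreal_mult'[symmetric])
    qed simp
  qed
  also have "\<dots> = ennreal (?b powr (1 - s)) * ennreal i"
    by (simp add: nn_integral_cmult i)
  finally have "pi * \<rho>\<^sup>2 * norm (F z) \<le> ?b powr (1 - s) * i"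
    using i(2) by (simp add: ennreal_mult'[symmetric])
  moreover have "norm (F z) = \<phi> z * (2 * \<rho>) powr (- (2 / s))"
  proof -
    have "2 * \<rho> = 1 - norm z" by (simp add: \<rho>_def)
    then show ?thesis using rho by (simp add: \<phi>_def powr_minus)
  qed
  ultimately have "pi * \<rho>\<^sup>2 * (\<phi> z * (2 * \<rho>) powr (- (2 / s))) \<le> ?b powr (1 - s) * i" by simp
  then have "pi * \<rho> powr 2 * (\<phi> z * (2 powr (- (2 / s)) * \<rho> powr (- (2 / s))))
      \<le> \<phi> z powr (1 - s) * \<rho> powr (- (2 / s) * (1 - s)) * i"
    using rho ph by (simp add: powr_mult powr_powr powr_numeral)
  \<comment> \<open>The exponent 2/s in \<phi> is chosen for this identity: the powers of \<rho> on
    the two sides agree and cancel, whatever the position of the maximum point.\<close>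
  moreover have "\<rho> powr (- (2 / s) * (1 - s)) = \<rho> powr 2 * \<rho> powr (- (2 / s))"
    unfolding powr_add[symmetric] using s by (intro arg_cong[where f="(powr) \<rho>"]) (simp add: field_simps)
  ultimately have "(\<rho> powr 2 * \<rho> powr (- (2 / s))) * (pi * \<phi> z * 2 powr (- (2 / s)))
     \<le> (\<rho> powr 2 * \<rho> powr (- (2 / s))) * (\<phi> z powr (1 - s) * i)"
    by (simp add: mult_ac)
  then have "pi * \<phi> z * 2 powr (- (2 / s)) \<le> \<phi> z powr (1 - s) * i"
    using rho by (subst (asm) mult_le_cancel_left_pos) auto
  moreover have "\<phi> z = \<phi> z powr (1 - s) * \<phi> z powr s" using ph by (simp flip: powr_add)
  ultimately have "\<phi> z powr (1 - s) * (pi * \<phi> z powr s * 2 powr (- (2 / s))) \<le> \<phi> z powr (1 - s) * i"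
    by (metis (no_types, opaque_lifting) mult.assoc mult.left_commute)
  then have "pi * \<phi> z powr s * 2 powr (- (2 / s)) \<le> i"
    using ph by (subst (asm) mult_le_cancel_left_pos) auto
  then have "\<phi> z powr s \<le> 2 powr (2 / s) / pi * i"
    by (simp add: powr_minus field_simps)
  moreover have "norm (F 0) powr s \<le> \<phi> z powr s" using ph0 s by (intro powr_mono2) auto
  ultimately show ?thesis unfolding i(1) using i(2) by (subst ennreal_mult[symmetric]) auto
qed

text \<open>For s > 1 the case of small exponents is applied to the entire function F^n with
  exponent s/n \<le> 1.\<close>

lemma entire_powr_submean:
  assumes s: "0 < s"
  obtains K where "K > 0" "\<And>F z0. F holomorphic_on UNIV \<Longrightarrow> ennreal (norm (F z0) powr s)
    \<le> ennreal K * (\<integral>\<^sup>+ w\<in>ball z0 1. ennreal (norm (F w) powr s) \<partial>lborel)"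
proof -
  define n where "n = nat \<lceil>s\<rceil>"
  have n: "real n \<ge> s" "n > 0" using s by (auto simp: n_def)
  define \<sigma> where "\<sigma> = s / real n"
  have \<sigma>: "0 < \<sigma>" "\<sigma> \<le> 1" using n s by (auto simp: \<sigma>_def)
  have "ennreal (norm (F z0) powr s)
    \<le> ennreal (2 powr (2 / \<sigma>) / pi) * (\<integral>\<^sup>+ w\<in>ball z0 1. ennreal (norm (F w) powr s) \<partial>lborel)"
    if F: "F holomorphic_on UNIV" for F z0
  proof -
    note [measurable] = entire_borel_measurable[OF F]
    have eq: "norm (x ^ n) powr \<sigma> = norm x powr s" for x :: complex
      using n by (cases "x = 0") (simp_all add: norm_power \<sigma>_def powr_powr flip: powr_realpow)
    have "(\<lambda>w. F (z0 + w) ^ n) holomorphic_on UNIV"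
      by (intro holomorphic_on_power entire_compose[OF F] holomorphic_intros)
    from entire_powr_submean_le_1[OF this \<sigma>]
    have "ennreal (norm (F z0) powr s) \<le> ennreal (2 powr (2 / \<sigma>) / pi) *
      (\<integral>\<^sup>+ w\<in>ball 0 1. ennreal (norm (F (z0 + w)) powr s) \<partial>lborel)"
      unfolding eq by simp
    also have "(\<integral>\<^sup>+ w\<in>ball 0 1. ennreal (norm (F (z0 + w)) powr s) \<partial>lborel)
      = (\<integral>\<^sup>+ w. ennreal (norm (F (z0 + w)) powr s) * indicator (ball z0 1) (z0 + w) \<partial>lborel)"
      by (intro nn_integral_cong) (auto simp: indicator_def dist_norm)
    also have "\<dots> = (\<integral>\<^sup>+ w\<in>ball z0 1. ennreal (norm (F w) powr s) \<partial>lborel)"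
      by (rule nn_integral_lborel_translate) measurable
    finally show ?thesis .
  qed
  moreover have "2 powr (2 / \<sigma>) / pi > 0" by simp
  ultimately show ?thesis using that by blast
qed

section \<open>Sub-mean value property with Gaussian weights\<close>

lemma Re_mult_cnj_eq: "Re (a * cnj b) = ((norm a)\<^sup>2 + (norm b)\<^sup>2 - (norm (a - b))\<^sup>2) / 2"
  unfolding cmod_power2 by (simp add: power2_eq_square algebra_simps)

abbreviation Lint :: "real \<Rightarrow> (complex \<Rightarrow> real) \<Rightarrow> ennreal" where
  "Lint s u \<equiv> \<integral>\<^sup>+ z. ennreal (u z powr s) \<partial>lborel"

abbreviation Lint_ball :: "complex \<Rightarrow> real \<Rightarrow> real \<Rightarrow> (complex \<Rightarrow> real) \<Rightarrow> ennreal" where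
  "Lint_ball a r s u \<equiv> \<integral>\<^sup>+ w\<in>ball a r. ennreal (u w powr s) \<partial>lborel"

abbreviation symbol_weight :: "(complex \<Rightarrow> complex) \<Rightarrow> (complex \<Rightarrow> complex) \<Rightarrow> complex \<Rightarrow> real" where
  "symbol_weight h \<psi> z \<equiv> norm (h z) * exp (((norm (\<psi> z))\<^sup>2 - (norm z)\<^sup>2) / 2)"

text \<open>The weight is locally the modulus of an exponential: \<open>|\<psi>|\<^sup>2\<close> is linearised at \<open>\<psi> z0\<close>
  and \<open>|w|\<^sup>2\<close> at \<open>z0\<close>.\<close>

lemma weighted_submean:
  assumes s: "0 < s"
  obtains K where "K > 0" "\<And>h \<psi> z0. h holomorphic_on UNIV \<Longrightarrow> \<psi> holomorphic_on UNIV \<Longrightarrow>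
    ennreal (symbol_weight h \<psi> z0 powr s)
    \<le> ennreal K * Lint_ball z0 1 s (symbol_weight h \<psi>)"
proof -
  obtain K where K: "K > 0" "\<And>F z0. F holomorphic_on UNIV \<Longrightarrow> ennreal (norm (F z0) powr s)
    \<le> ennreal K * (\<integral>\<^sup>+ w\<in>ball z0 1. ennreal (norm (F w) powr s) \<partial>lborel)"
    using entire_powr_submean[OF s] by blast
  have "ennreal (symbol_weight h \<psi> z0 powr s)
    \<le> ennreal (K * exp (1/2) powr s) * Lint_ball z0 1 s (symbol_weight h \<psi>)"
    if h: "h holomorphic_on UNIV" and \<psi>: "\<psi> holomorphic_on UNIV" for h \<psi> z0
  proof -
    note [measurable] = entire_borel_measurable[OF h] entire_borel_measurable[OF \<psi>]
    define c where "c = \<psi> z0"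
    define F where "F w = h w * exp (\<psi> w * cnj c - of_real ((norm c)\<^sup>2 / 2) - w * cnj z0 + of_real ((norm z0)\<^sup>2 / 2))" for w
    let ?\<Phi> = "\<lambda>w. symbol_weight h \<psi> w"
    have F: "F holomorphic_on UNIV" unfolding F_def
      by (intro holomorphic_intros h \<psi>)
    \<comment> \<open>Polarization gives the exact error of both linearisations. The error from
      \<psi> only makes |F| smaller and is dropped; the one from w is at most exp (1/2) on the unit
      ball. Both vanish at \<open>z0\<close>, where |F| equals the weight.\<close>
    have nF: "norm (F w) = norm (h w) * exp (((norm (\<psi> w))\<^sup>2 - (norm (\<psi> w - c))\<^sup>2 - (norm w)\<^sup>2 + (norm (w - z0))\<^sup>2) / 2)" for w
    proof -
      have "Re (\<psi> w * cnj c - of_real ((norm c)\<^sup>2 / 2) - w * cnj z0 + of_real ((norm z0)\<^sup>2 / 2))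
        = ((norm (\<psi> w))\<^sup>2 - (norm (\<psi> w - c))\<^sup>2 - (norm w)\<^sup>2 + (norm (w - z0))\<^sup>2) / 2"
        unfolding minus_complex.sel plus_complex.sel Re_mult_cnj_eq Re_complex_of_real by (simp add: field_simps)
      then show ?thesis by (simp add: F_def norm_mult)
    qed
    have "ennreal (?\<Phi> z0 powr s) = ennreal (norm (F z0) powr s)"
      by (simp add: nF c_def)
    also have "\<dots> \<le> ennreal K * (\<integral>\<^sup>+ w\<in>ball z0 1. ennreal (norm (F w) powr s) \<partial>lborel)"
      by (rule K(2)[OF F])
    also have "\<dots> \<le> ennreal K * (\<integral>\<^sup>+ w. ennreal (exp (1/2) powr s) * (ennreal (?\<Phi> w powr s) * indicator (ball z0 1) w) \<partial>lborel)"
    proof (intro mult_left_mono nn_integral_mono)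
      fix w
      show "ennreal (norm (F w) powr s) * indicator (ball z0 1) w
        \<le> ennreal (exp (1/2) powr s) * (ennreal (?\<Phi> w powr s) * indicator (ball z0 1) w)"
      proof (cases "w \<in> ball z0 1")
        case True
        then have "(norm (w - z0))\<^sup>2 \<le> 1"
          by (simp add: dist_norm norm_minus_commute power_le_one)
        then have "norm (F w) \<le> norm (h w) * exp (1/2 + ((norm (\<psi> w))\<^sup>2 - (norm w)\<^sup>2) / 2)"
          unfolding nF by (intro mult_left_mono) (auto simp: field_simps intro: add_increasing2)
        then have "norm (F w) powr s \<le> (exp (1/2) * ?\<Phi> w) powr s"
          using s by (intro powr_mono2) (auto simp: exp_add mult_ac)
        also have "\<dots> = exp (1/2) powr s * ?\<Phi> w powr s" by (simp add: powr_mult)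
        finally show ?thesis using True by (simp add: ennreal_mult'[symmetric])
      qed simp
    qed simp
    also have "\<dots> = ennreal (K * exp (1/2) powr s) * (\<integral>\<^sup>+ w\<in>ball z0 1. ennreal (?\<Phi> w powr s) \<partial>lborel)"
      using K(1) by (subst nn_integral_cmult) (auto simp: ennreal_mult mult.assoc)
    finally show ?thesis .
  qed
  moreover have "K * exp (1/2) powr s > 0" using K by simp
  ultimately show ?thesis using that by blast
qed

section \<open>Integral means of the derivative\<close>

definition fock_weight :: "(complex \<Rightarrow> complex) \<Rightarrow> complex \<Rightarrow> real" where
  "fock_weight f z = norm (f z) * exp (- (norm z)\<^sup>2 / 2)"

text \<open>Against the Gaussian weight, differentiation costs a factor of order |z|; division by 1
  + |z| restores comparability with \<open>fock_weight\<close>.\<close>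

definition fock_dweight :: "(complex \<Rightarrow> complex) \<Rightarrow> complex \<Rightarrow> real" where
  "fock_dweight f z = norm (deriv f z) / (1 + norm z) * exp (- (norm z)\<^sup>2 / 2)"

lemma fock_weight_nonneg [simp]: "0 \<le> fock_weight f z"
  and fock_dweight_nonneg [simp]: "0 \<le> fock_dweight f z"
  by (simp_all add: fock_weight_def fock_dweight_def)

lemma fock_weight_measurable [measurable (raw)]:
  assumes "f \<in> borel_measurable borel" shows "fock_weight f \<in> borel_measurable borel"
  using assms unfolding fock_weight_def by measurable

lemma fock_dweight_measurable:
  assumes "f holomorphic_on UNIV" shows "fock_dweight f \<in> borel_measurable borel"
proof -
  have "deriv f holomorphic_on UNIV" using assms by (intro holomorphic_deriv) auto
  note [measurable] = entire_borel_measurable[OF this]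
  show ?thesis unfolding fock_dweight_def by measurable
qed

lemma fock_integral_eq_weight: "fock_integral p f = Lint p (fock_weight f)"
  unfolding fock_integral_def fock_weight_def
  by (intro nn_integral_cong) (simp add: powr_mult exp_powr_real mult.commute)

lemma fock_weight_submean:
  assumes s: "0 < s"
  obtains K where "K > 0" "\<And>f z. f holomorphic_on UNIV \<Longrightarrow>
    ennreal (fock_weight f z powr s) \<le> ennreal K * Lint_ball z 1 s (fock_weight f)"
proof -
  obtain K where K: "K > 0" "\<And>h \<psi> z0. h holomorphic_on UNIV \<Longrightarrow> \<psi> holomorphic_on UNIV \<Longrightarrow>
    ennreal (symbol_weight h \<psi> z0 powr s)
    \<le> ennreal K * Lint_ball z0 1 s (symbol_weight h \<psi>)"
    using weighted_submean[OF s] by blast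
  show ?thesis
    using K(2)[of _ "\<lambda>_. 0"] K(1) that by (simp add: fock_weight_def)
qed

lemma set_nn_integral_ball_mono:
  fixes u :: "complex \<Rightarrow> ennreal"
  assumes "ball a r \<subseteq> ball b t"
  shows "(\<integral>\<^sup>+ w\<in>ball a r. u w \<partial>lborel) \<le> (\<integral>\<^sup>+ w\<in>ball b t. u w \<partial>lborel)"
  using assms by (intro nn_integral_mono mult_left_mono) (auto simp: indicator_def)

lemma powr_le_cancel_base:
  fixes x :: real
  assumes "x powr s \<le> y" "0 \<le> x" "0 < s"
  shows "x \<le> y powr (1 / s)"
proof -
  have "x = (x powr s) powr (1 / s)" using assms by (simp add: powr_powr)
  also have "\<dots> \<le> y powr (1 / s)" using assms by (intro powr_mono2) auto
  finally show ?thesis .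
qed

text \<open>Cauchy's estimate is applied to f times an exponential that makes its modulus comparable
  to \<open>fock_weight f\<close> near z. The derivative of that product also contains f z times
  \<open>cnj z\<close>, and this term is the source of the factor 1 + |z|. Radius 2 is the unit
  circle of Cauchy's estimate enlarged by the unit ball of the mean value inequality.\<close>

lemma fock_dweight_submean:
  assumes s: "0 < s"
  obtains K where "K > 0" "\<And>f z. f holomorphic_on UNIV \<Longrightarrow>
    ennreal (fock_dweight f z powr s) \<le> ennreal K * Lint_ball z 2 s (fock_weight f)"
proof -
  obtain K where K: "K > 0" "\<And>f z. f holomorphic_on UNIV \<Longrightarrow>
    ennreal (fock_weight f z powr s) \<le> ennreal K * Lint_ball z 1 s (fock_weight f)"
    using fock_weight_submean[OF s] by blast
  have "ennreal (fock_dweight f z powr s)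
      \<le> ennreal (exp (1/2) powr s * K) * Lint_ball z 2 s (fock_weight f)"
    if f: "f holomorphic_on UNIV" for f z
  proof (cases "Lint_ball z 2 s (fock_weight f) = \<infinity>")
    case True
    then show ?thesis using K(1) by (simp add: ennreal_mult_top)
  next
    case False
    then obtain i where i: "Lint_ball z 2 s (fock_weight f) = ennreal i" "i \<ge> 0"
      by (auto elim: ennreal_finiteE)
    define B where "B = (K * i) powr (1 / s)"
    have wB: "fock_weight f w \<le> B" if "dist w z \<le> 1" for w
    proof -
      have "ball w 1 \<subseteq> ball z 2"
      proof
        fix x assume "x \<in> ball w 1"
        then show "x \<in> ball z 2" using that dist_triangle[of z x w] by (simp add: dist_commute)
      qed
      then have "ennreal (fock_weight f w powr s) \<le> ennreal K * ennreal i"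
        using K(2)[OF f, of w] set_nn_integral_ball_mono[of w 1 z 2 "\<lambda>w. ennreal (fock_weight f w powr s)"]
        unfolding i(1) by (meson mult_left_mono order_trans zero_le)
      then have "fock_weight f w powr s \<le> K * i"
        using K(1) i(2) by (simp add: ennreal_mult'[symmetric])
      then show ?thesis unfolding B_def using s by (intro powr_le_cancel_base) auto
    qed
    have B0: "B \<ge> 0" by (simp add: B_def)
    define e where "e w = f w * exp (- w * cnj z + of_real ((norm z)\<^sup>2 / 2))" for w
    have e: "e holomorphic_on A" for A unfolding e_def
      by (intro holomorphic_intros holomorphic_on_subset[OF f]) auto
    have ne: "norm (e w) = fock_weight f w * exp ((norm (w - z))\<^sup>2 / 2)" for w
    proof -
      have "Re (- w * cnj z + of_real ((norm z)\<^sup>2 / 2)) = - (norm w)\<^sup>2 / 2 + (norm (w - z))\<^sup>2 / 2"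
        unfolding plus_complex.sel mult_minus_left uminus_complex.sel Re_mult_cnj_eq Re_complex_of_real
        by (simp add: field_simps)
      then show ?thesis by (simp add: e_def norm_mult fock_weight_def mult_exp_exp)
    qed
    have "norm ((deriv ^^ 1) e z) \<le> fact 1 * (B * exp (1/2)) / 1 ^ 1"
    proof (rule Cauchy_inequality)
      show "norm (e w) \<le> B * exp (1/2)" if "norm (z - w) = 1" for w
        using wB[of w] that by (simp add: ne dist_norm norm_minus_commute)
    qed (auto intro!: e holomorphic_on_imp_continuous_on)
    then have de: "norm (deriv e z) \<le> B * exp (1/2)" by simp
    have dd: "deriv e z = (deriv f z - f z * cnj z) * exp (of_real (- (norm z)\<^sup>2 / 2))"
    proof -
      have "(f has_field_derivative deriv f z) (at z)"
        using f by (simp add: holomorphic_derivI)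
      then have "(e has_field_derivative deriv f z * exp (- z * cnj z + of_real ((norm z)\<^sup>2 / 2))
         + f z * (exp (- z * cnj z + of_real ((norm z)\<^sup>2 / 2)) * (- cnj z))) (at z)"
        unfolding e_def by (auto intro!: derivative_eq_intros)
      moreover have "- z * cnj z + of_real ((norm z)\<^sup>2 / 2) = of_real (- (norm z)\<^sup>2 / 2)"
        unfolding mult_minus_left complex_norm_square[symmetric] by simp
      ultimately show ?thesis by (simp add: DERIV_imp_deriv algebra_simps)
    qed
    have "norm (deriv f z) * exp (- (norm z)\<^sup>2 / 2) = norm (deriv e z + f z * cnj z * exp (of_real (- (norm z)\<^sup>2 / 2)))"
      unfolding dd by (simp add: algebra_simps flip: norm_mult)
         (simp add: norm_mult)
    also have "\<dots> \<le> norm (deriv e z) + norm z * fock_weight f z"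
      by (rule order_trans[OF norm_triangle_ineq]) (simp add: norm_mult fock_weight_def)
    also have "\<dots> \<le> B * exp (1/2) + norm z * B"
      using de wB[of z] by (intro add_mono mult_left_mono) auto
    also have "\<dots> \<le> (1 + norm z) * (exp (1/2) * B)"
    proof -
      have "norm z * B * 1 \<le> norm z * B * exp (1/2)" using B0 by (intro mult_left_mono) auto
      then show ?thesis by (simp add: algebra_simps)
    qed
    finally have "fock_dweight f z \<le> exp (1/2) * B"
      by (simp add: fock_dweight_def field_simps add_pos_nonneg)
    then have "fock_dweight f z powr s \<le> (exp (1/2) * B) powr s"
      using s by (intro powr_mono2) auto
    also have "\<dots> = exp (1/2) powr s * K * i"
      using s K(1) i(2) B0 by (simp add: powr_mult B_def powr_powr)
    finally show ?thesis unfolding i(1) using K(1) i(2)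
      by (subst ennreal_mult[symmetric]) auto
  qed
  moreover have "exp (1/2) powr s * K > 0" using K by simp
  ultimately show ?thesis using that by blast
qed

lemma nn_integral_ball_integral:
  fixes u :: "complex \<Rightarrow> ennreal"
  assumes [measurable]: "u \<in> borel_measurable borel" and R: "R > 0"
  shows "(\<integral>\<^sup>+ z. (\<integral>\<^sup>+ w\<in>ball z R. u w \<partial>lborel) \<partial>lborel) = ennreal (pi * R\<^sup>2) * (\<integral>\<^sup>+ w. u w \<partial>lborel)"
proof -
  have "(\<integral>\<^sup>+ z. (\<integral>\<^sup>+ w\<in>ball z R. u w \<partial>lborel) \<partial>lborel) = (\<integral>\<^sup>+ w. (\<integral>\<^sup>+ z. u w * indicator (ball z R) w \<partial>lborel) \<partial>lborel)"
    by (rule lborel_pair.Fubini') measurable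
  also have "\<dots> = (\<integral>\<^sup>+ w. (\<integral>\<^sup>+ z. u w * indicator (ball w R) z \<partial>lborel) \<partial>lborel)"
    by (intro nn_integral_cong) (auto simp: indicator_def dist_commute)
  also have "\<dots> = (\<integral>\<^sup>+ w. ennreal (pi * R\<^sup>2) * u w \<partial>lborel)"
    using R by (subst nn_integral_cmult_indicator) (simp_all add: emeasure_ball unit_ball_vol_2 mult.commute)
  finally show ?thesis by (simp add: nn_integral_cmult)
qed

text \<open>One half of the comparison between a function and its derivative, by integrating the
  local bound; it needs no normalisation at 0, unlike the converse
  \<open>fock_integral_le_deriv_weight\<close>.\<close>

lemma nn_integral_fock_dweight_le:
  assumes s: "0 < s"
  obtains C where "C > 0" "\<And>f. f holomorphic_on UNIV \<Longrightarrow>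
    Lint s (fock_dweight f) \<le> ennreal C * fock_integral s f"
proof -
  obtain K where K: "K > 0" "\<And>f z. f holomorphic_on UNIV \<Longrightarrow>
    ennreal (fock_dweight f z powr s) \<le> ennreal K * Lint_ball z 2 s (fock_weight f)"
    using fock_dweight_submean[OF s] by blast
  have "Lint s (fock_dweight f) \<le> ennreal (K * (pi * 2\<^sup>2)) * fock_integral s f"
    if f: "f holomorphic_on UNIV" for f
  proof -
    note [measurable] = entire_borel_measurable[OF f]
    have "Lint s (fock_dweight f)
      \<le> (\<integral>\<^sup>+ z. ennreal K * Lint_ball z 2 s (fock_weight f) \<partial>lborel)"
      by (intro nn_integral_mono K f)
    also have "\<dots> = ennreal K * (\<integral>\<^sup>+ z. (Lint_ball z 2 s (fock_weight f)) \<partial>lborel)"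
      by (rule nn_integral_cmult) measurable
    also have "(\<integral>\<^sup>+ z. (Lint_ball z 2 s (fock_weight f)) \<partial>lborel) = ennreal (pi * 2\<^sup>2) * fock_integral s f"
      unfolding fock_integral_eq_weight by (rule nn_integral_ball_integral) auto
    finally show ?thesis using K(1) by (simp add: ennreal_mult mult.assoc)
  qed
  moreover have "K * (pi * 2\<^sup>2) > 0" using K by simp
  ultimately show ?thesis using that by blast
qed

text \<open>With \<open>h = deriv g\<close> this is \<open>M_fun g \<psi>\<close>;
  \<open>M_tilde g \<psi>\<close> is the case \<open>h = g\<close> times 1 + |\<psi> z|. With \<psi>
  = 0 and h = f' it is \<open>fock_dweight f\<close>, so one mean value inequality serves all of
  them.\<close>

definition volterra_weight :: "(complex \<Rightarrow> complex) \<Rightarrow> (complex \<Rightarrow> complex) \<Rightarrow> complex \<Rightarrow> real" where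
  "volterra_weight h \<psi> z = norm (h z) / (1 + norm z) * exp (((norm (\<psi> z))\<^sup>2 - (norm z)\<^sup>2) / 2)"

lemma volterra_weight_nonneg [simp]: "0 \<le> volterra_weight h \<psi> z"
  by (simp add: volterra_weight_def)

lemma volterra_weight_measurable [measurable (raw)]:
  assumes [measurable]: "h \<in> borel_measurable borel" "\<psi> \<in> borel_measurable borel"
  shows "volterra_weight h \<psi> \<in> borel_measurable borel"
  unfolding volterra_weight_def by measurable

lemma volterra_weight_mult:
  "(1 + norm z) * volterra_weight h \<psi> z = symbol_weight h \<psi> z"
proof -
  have "1 + norm z \<noteq> 0" using norm_ge_zero[of z] by linarith
  then show ?thesis by (simp add: volterra_weight_def)
qed

lemma fock_dweight_eq: "fock_dweight f = volterra_weight (deriv f) (\<lambda>_. 0)"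
  by (simp add: fun_eq_iff fock_dweight_def volterra_weight_def)

text \<open>The numerator is covered by \<open>weighted_submean\<close>; the denominator 1 + |w|
  exceeds its value at the centre by at most a factor 2 on a unit ball.\<close>

lemma volterra_weight_submean:
  assumes s: "0 < s"
  obtains K where "K > 0" "\<And>h \<psi> z0. h holomorphic_on UNIV \<Longrightarrow> \<psi> holomorphic_on UNIV \<Longrightarrow>
    ennreal (volterra_weight h \<psi> z0 powr s)
    \<le> ennreal K * Lint_ball z0 1 s (volterra_weight h \<psi>)"
proof -
  obtain K where K: "K > 0" "\<And>h \<psi> z0. h holomorphic_on UNIV \<Longrightarrow> \<psi> holomorphic_on UNIV \<Longrightarrow>
    ennreal (symbol_weight h \<psi> z0 powr s)
    \<le> ennreal K * Lint_ball z0 1 s (symbol_weight h \<psi>)"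
    using weighted_submean[OF s] by blast
  have "ennreal (volterra_weight h \<psi> z0 powr s)
    \<le> ennreal (K * 2 powr s) * Lint_ball z0 1 s (volterra_weight h \<psi>)"
    if h: "h holomorphic_on UNIV" and \<psi>: "\<psi> holomorphic_on UNIV" for h \<psi> z0
  proof -
    note [measurable] = entire_borel_measurable[OF h] entire_borel_measurable[OF \<psi>]
    let ?N = "volterra_weight h \<psi>"
    define m where "m = 1 + norm z0"
    have m: "m > 0" using norm_ge_zero[of z0] unfolding m_def by linarith
    have "ennreal (m powr s) * ennreal (?N z0 powr s) = ennreal ((m * ?N z0) powr s)"
      using m by (simp add: powr_mult ennreal_mult')
    also have "\<dots> \<le> ennreal K * (\<integral>\<^sup>+ w\<in>ball z0 1. ennreal (((1 + norm w) * ?N w) powr s) \<partial>lborel)"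
      unfolding m_def volterra_weight_mult by (rule K(2)[OF h \<psi>])
    also have "\<dots> \<le> ennreal K * (\<integral>\<^sup>+ w. ennreal ((2 * m) powr s) * (ennreal (?N w powr s) * indicator (ball z0 1) w) \<partial>lborel)"
    proof (intro mult_left_mono nn_integral_mono)
      fix w
      show "ennreal (((1 + norm w) * ?N w) powr s) * indicator (ball z0 1) w
        \<le> ennreal ((2 * m) powr s) * (ennreal (?N w powr s) * indicator (ball z0 1) w)"
      proof (cases "w \<in> ball z0 1")
        case True
        have "norm w \<le> norm z0 + norm (w - z0)" using norm_triangle_ineq[of z0 "w - z0"] by simp
        moreover have "norm (w - z0) < 1" using True by (simp add: dist_norm norm_minus_commute)
        ultimately have "1 + norm w \<le> 2 * m"
          using norm_ge_zero[of z0] unfolding m_def distrib_left mult_2 by linarith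
        then have "((1 + norm w) * ?N w) powr s \<le> (2 * m * ?N w) powr s"
          using s by (intro powr_mono2 mult_right_mono) auto
        also have "\<dots> = (2 * m) powr s * ?N w powr s" using m by (simp add: powr_mult)
        finally show ?thesis using True by (simp add: ennreal_mult'[symmetric])
      qed simp
    qed simp
    also have "\<dots> = ennreal K * (ennreal ((2 * m) powr s) * (\<integral>\<^sup>+ w\<in>ball z0 1. ennreal (?N w powr s) \<partial>lborel))"
      by (subst nn_integral_cmult) auto
    also have "\<dots> = ennreal (m powr s) * (ennreal (K * 2 powr s) * (\<integral>\<^sup>+ w\<in>ball z0 1. ennreal (?N w powr s) \<partial>lborel))"
      using m K(1) by (simp add: powr_mult ennreal_mult mult_ac)
    finally show ?thesis
      using m by (subst (asm) ennreal_mult_le_mult_iff) auto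
  qed
  moreover have "K * 2 powr s > 0" using K by simp
  ultimately show ?thesis using that by blast
qed

text \<open>The derivative is bounded along the segment from z to z'. Since |z'| \<le> |z|, the
  segment stays in the disc of radius |z|, where the Gaussian factor is at least the one at z, and
  the unit ball about each of its points lies in \<open>ball z (R + 1)\<close>.\<close>

lemma fock_increment_le:
  assumes s: "0 < s" and R: "0 \<le> R"
  obtains K where "K > 0" "\<And>f z z'. f holomorphic_on UNIV \<Longrightarrow> norm z' \<le> norm z \<Longrightarrow> norm (z - z') \<le> R \<Longrightarrow>
    ennreal ((norm (f z - f z') * exp (- (norm z)\<^sup>2 / 2)) powr s)
    \<le> ennreal (K * (norm (z - z') * (1 + norm z)) powr s) * Lint_ball z (R + 1) s (fock_dweight f)"
proof -
  obtain K where K: "K > 0" "\<And>h \<psi> z0. h holomorphic_on UNIV \<Longrightarrow> \<psi> holomorphic_on UNIV \<Longrightarrow>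
    ennreal (volterra_weight h \<psi> z0 powr s)
    \<le> ennreal K * Lint_ball z0 1 s (volterra_weight h \<psi>)"
    using volterra_weight_submean[OF s] by blast
  have "ennreal ((norm (f z - f z') * exp (- (norm z)\<^sup>2 / 2)) powr s)
    \<le> ennreal (K * (norm (z - z') * (1 + norm z)) powr s) * Lint_ball z (R + 1) s (fock_dweight f)"
    if f: "f holomorphic_on UNIV" and le: "norm z' \<le> norm z" and d: "norm (z - z') \<le> R" for f z z'
  proof (cases "z = z' \<or> (Lint_ball z (R + 1) s (fock_dweight f)) = \<infinity>")
    case True
    then show ?thesis
    proof
      assume inf: "Lint_ball z (R + 1) s (fock_dweight f) = \<infinity>"
      have "z \<noteq> z' \<Longrightarrow> 0 < K * (norm (z - z') * (1 + norm z)) powr s"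
        using K(1) add_pos_nonneg[OF zero_less_one norm_ge_zero[of z]] by simp
      then show ?thesis unfolding inf by (cases "z = z'") (auto simp: ennreal_mult_top)
    qed simp
  next
    case False
    then obtain i where i: "Lint_ball z (R + 1) s (fock_dweight f) = ennreal i" "i \<ge> 0"
      by (auto elim: ennreal_finiteE)
    define B where "B = (1 + norm z) * (K * i) powr (1 / s)"
    have bd: "norm (deriv f x) * exp (- (norm z)\<^sup>2 / 2) \<le> B" if x: "x \<in> closed_segment z z'" for x
    proof -
      have "closed_segment z z' \<subseteq> cball 0 (norm z)"
        by (rule closed_segment_subset) (use le in \<open>auto\<close>)
      then have nx: "norm x \<le> norm z" using x by auto
      have dx: "dist z x \<le> R"
        using x d dist_in_closed_segment[of x z z'] by (simp add: dist_norm norm_minus_commute)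
      have sub: "ball x 1 \<subseteq> ball z (R + 1)"
      proof
        fix w assume "w \<in> ball x 1"
        then show "w \<in> ball z (R + 1)" using dx dist_triangle[of z w x] by simp
      qed
      have "ennreal (fock_dweight f x powr s)
         \<le> ennreal K * Lint_ball x 1 s (fock_dweight f)"
        unfolding fock_dweight_eq using f by (intro K(2) holomorphic_deriv) auto
      also have "\<dots> \<le> ennreal K * ennreal i"
        unfolding i(1)[symmetric] by (intro mult_left_mono set_nn_integral_ball_mono sub) auto
      finally have "fock_dweight f x powr s \<le> K * i"
        using K(1) i(2) by (simp add: ennreal_mult'[symmetric])
      then have "fock_dweight f x \<le> (K * i) powr (1 / s)"
        using s by (intro powr_le_cancel_base) auto
      then have "(1 + norm x) * fock_dweight f x \<le> B"
        unfolding B_def using nx by (intro mult_mono) auto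
      then have "fock_weight (deriv f) x \<le> B"
        using volterra_weight_mult[of x "deriv f" "\<lambda>_. 0"]
        by (simp add: fock_weight_def fock_dweight_eq)
      moreover have "exp (- (norm z)\<^sup>2 / 2) \<le> exp (- (norm x)\<^sup>2 / 2)"
        using nx by (simp add: power_mono)
      ultimately show ?thesis unfolding fock_weight_def
        by (meson mult_left_mono norm_ge_zero order_trans)
    qed
    have "norm (f z - f z') \<le> (B * exp ((norm z)\<^sup>2 / 2)) * norm (z - z')"
    proof (rule field_differentiable_bound[where S="closed_segment z z'"])
      show "(f has_field_derivative deriv f x) (at x within closed_segment z z')" for x
        using f by (auto intro: DERIV_subset holomorphic_derivI)
      show "norm (deriv f x) \<le> B * exp ((norm z)\<^sup>2 / 2)" if "x \<in> closed_segment z z'" for x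
        using bd[OF that] by (simp add: exp_minus field_simps)
    qed auto
    then have "norm (f z - f z') * exp (- (norm z)\<^sup>2 / 2) \<le> norm (z - z') * B"
      by (simp add: exp_minus field_simps)
    then have "(norm (f z - f z') * exp (- (norm z)\<^sup>2 / 2)) powr s \<le> (norm (z - z') * B) powr s"
      using s by (intro powr_mono2) auto
    also have "\<dots> = K * (norm (z - z') * (1 + norm z)) powr s * i"
      using s K(1) i(2) by (simp add: powr_mult B_def powr_powr)
    finally show ?thesis unfolding i(1) using K(1) i(2) by (subst ennreal_mult[symmetric]) auto
  qed
  then show ?thesis using that K(1) by blast
qed

text \<open>The factor of the first term can be taken arbitrarily close to 1. The cruder constant 2
  powr s would destroy the gain exp (- s/2) of the contraction in the shell argument.\<close>

lemma powr_add_le_eps: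
  fixes s \<epsilon> :: real
  assumes s: "0 < s" and \<epsilon>: "1 < \<epsilon>"
  obtains C where "C > 0" "\<And>a b. 0 \<le> a \<Longrightarrow> 0 \<le> b \<Longrightarrow> (a + b) powr s \<le> \<epsilon> * a powr s + C * b powr s"
proof -
  \<comment> \<open>By this choice \<open>(1 + \<delta>) powr s = \<epsilon>\<close>. Either b is
    small against a and is absorbed, or a is at most b / \<delta>.\<close>
  define \<delta> where "\<delta> = \<epsilon> powr (1 / s) - 1"
  have d: "\<delta> > 0" unfolding \<delta>_def using \<epsilon> s by (simp)
  have "(a + b) powr s \<le> \<epsilon> * a powr s + (1 + 1 / \<delta>) powr s * b powr s" if ab: "0 \<le> a" "0 \<le> b" for a b
  proof (cases "b \<le> \<delta> * a")
    case True
    then have "(a + b) powr s \<le> ((1 + \<delta>) * a) powr s"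
      using ab s by (intro powr_mono2) (auto simp: algebra_simps)
    also have "\<dots> = \<epsilon> * a powr s"
      using ab s d \<epsilon> by (simp add: powr_mult \<delta>_def powr_powr)
    finally show ?thesis by (simp add: add_increasing2)
  next
    case False
    then have "a \<le> b / \<delta>" using d by (simp add: field_simps)
    then have "(a + b) powr s \<le> ((1 + 1 / \<delta>) * b) powr s"
      using ab s by (intro powr_mono2) (auto simp: algebra_simps)
    also have "\<dots> = (1 + 1 / \<delta>) powr s * b powr s" using ab d by (simp add: powr_mult)
    finally show ?thesis using \<epsilon> by (simp add: add_increasing)
  qed
  moreover have "(1 + 1 / \<delta>) powr s > 0" using d add_pos_pos[of 1 "1 / \<delta>"] by simp
  ultimately show ?thesis using that by blast
qed

lemma ennreal_le_suminf:
  fixes g :: "nat \<Rightarrow> ennreal"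
  shows "g m \<le> (\<Sum>k. g k)"
  using sum_le_suminf[OF summableI, of "{m}" g] by simp

lemma sum_indicator_disjoint_le:
  fixes f :: "'a \<Rightarrow> ennreal"
  assumes "finite A" "disjoint_family_on S A"
  shows "(\<Sum>j\<in>A. f x * indicator (S j) x) \<le> f x"
proof -
  have "(\<Sum>j\<in>A. f x * indicator (S j) x) = f x * indicator (\<Union>j\<in>A. S j) x"
    using assms by (subst indicator_UN_disjoint) (auto simp: sum_distrib_left)
  also have "\<dots> \<le> f x" by (simp add: indicator_def)
  finally show ?thesis .
qed

text \<open>Divide the plane into the shells \<open>A\<^sub>n = {n \<le> |z|\<^sup>2 < n + 1}\<close>. The contraction by \<open>sqrt (1 - 1/n)\<close> maps
  \<open>A\<^sub>n\<close> into \<open>A\<^sub>n\<^sub>-\<^sub>1\<close>, moves points by \<open>O(1/|z|)\<close> and gains a factor \<open>exp (- s/2)\<close> in the weight, so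
  the mass of \<open>f\<close> on \<open>A\<^sub>n\<close> is a fixed fraction of that on \<open>A\<^sub>n\<^sub>-\<^sub>1\<close> up to a term in \<open>f'\<close>.\<close>

lemma fock_integral_le_deriv_weight:
  assumes s: "0 < s"
  obtains C where "C > 0" "\<And>f. f holomorphic_on UNIV \<Longrightarrow> f 0 = 0 \<Longrightarrow>
    fock_integral s f \<le> ennreal C * Lint s (fock_dweight f)"
proof -
  \<comment> \<open>From \<open>n0\<close> on, the Jacobian factor 1 / (1 - 1/n) = 1 + 1/(n-1) of
    the contraction is at most exp (s/8).\<close>
  define n0 where "n0 = nat \<lceil>2 + 8 / s\<rceil>"
  have n0: "real n0 \<ge> 2 + 8 / s" using s unfolding n0_def by linarith
  have "8 / s > 0" using s by simp
  then have n02: "n0 \<ge> 2" using n0 by linarith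
  obtain K1 where K1: "K1 > 0" "\<And>f z z'. f holomorphic_on UNIV \<Longrightarrow> norm z' \<le> norm z \<Longrightarrow> norm (z - z') \<le> real n0 \<Longrightarrow>
    ennreal ((norm (f z - f z') * exp (- (norm z)\<^sup>2 / 2)) powr s)
    \<le> ennreal (K1 * (norm (z - z') * (1 + norm z)) powr s) * Lint_ball z (real n0 + 1) s (fock_dweight f)"
    using fock_increment_le[OF s of_nat_0_le_iff[of n0]] by blast
  obtain K2 where K2_: "K2 > 0" "\<And>f z z'. f holomorphic_on UNIV \<Longrightarrow> norm z' \<le> norm z \<Longrightarrow> norm (z - z') \<le> 2 \<Longrightarrow>
    ennreal ((norm (f z - f z') * exp (- (norm z)\<^sup>2 / 2)) powr s)
    \<le> ennreal (K2 * (norm (z - z') * (1 + norm z)) powr s) * Lint_ball z (2 + 1) s (fock_dweight f)"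
    using fock_increment_le[OF s zero_le_numeral[of "num.Bit0 num.One"]] by blast
  have "(2::real) + 1 = 3" by simp
  note K2 = K2_[unfolded this]
  obtain C\<epsilon> where C\<epsilon>: "C\<epsilon> > 0"
    "\<And>a b. 0 \<le> a \<Longrightarrow> 0 \<le> b \<Longrightarrow> (a + b) powr s \<le> exp (s / 4) * a powr s + C\<epsilon> * b powr s"
    using powr_add_le_eps[OF s, of "exp (s / 4)"] s by auto
  \<comment> \<open>Budget of exponents: the contraction gains exp (- s/2), splitting the power of a
    sum costs exp (s/4), the Jacobian costs at most exp (s/8), and exp (- s/8) remains.\<close>
  define \<kappa> where "\<kappa> = exp (- s / 8)"
  have \<kappa>: "0 < \<kappa>" "\<kappa> < 1" using s by (auto simp: \<kappa>_def)
  define c where "c = C\<epsilon> * (K2 * 4 powr s)"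
  have c: "c > 0" using C\<epsilon> K2 by (simp add: c_def)
  define W where "W = K1 * (real n0 * (1 + real n0)) powr s * (pi * (real n0)\<^sup>2)"
  have W: "W \<ge> 0" using K1 by (simp add: W_def)
  \<comment> \<open>Obtained by solving x \<le> \<kappa> (W u + x) + 9 pi c u for the total x of the
    outer shells and adding the bound W u of the central disc.\<close>
  define C where "C = W + (\<kappa> * W + c * (pi * 3\<^sup>2)) / (1 - \<kappa>)"
  have Cpos: "C > 0" unfolding C_def using W \<kappa> c
    by (intro add_nonneg_pos divide_pos_pos) auto
  have "fock_integral s f \<le> ennreal C * Lint s (fock_dweight f)"
    if f: "f holomorphic_on UNIV" and f0: "f 0 = 0" for f
  proof (cases "Lint s (fock_dweight f) = \<infinity>")
    case True
    then show ?thesis using Cpos by (simp add: ennreal_mult_top)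
  next
    case False
    then obtain u where u: "Lint s (fock_dweight f) = ennreal u" "u \<ge> 0"
      by (auto elim: ennreal_finiteE)
    note [measurable] = entire_borel_measurable[OF f] fock_dweight_measurable[OF f]
    let ?F = "\<lambda>z. ennreal (fock_weight f z powr s)"
    let ?A = "\<lambda>n::nat. {z::complex. real n \<le> (norm z)\<^sup>2 \<and> (norm z)\<^sup>2 < real n + 1}"
    define X where "X n = (\<integral>\<^sup>+ z\<in>?A n. ?F z \<partial>lborel)" for n
    \<comment> \<open>Radius 3 is the displacement by the contraction, at most 2, plus the unit ball
      of the mean value inequality.\<close>
    define J where "J z = Lint_ball z 3 s (fock_dweight f)" for z
    have Jm[measurable]: "J \<in> borel_measurable borel" unfolding J_def by measurable
    \<comment> \<open>On the central disc \<open>f 0 = 0\<close> lets f be compared with its value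
      at the origin in a single increment.\<close>
    have disc: "(\<integral>\<^sup>+ z\<in>ball 0 (real n0). ?F z \<partial>lborel) \<le> ennreal (W * u)"
    proof -
      have "(\<integral>\<^sup>+ z\<in>ball 0 (real n0). ?F z \<partial>lborel)
        \<le> (\<integral>\<^sup>+ z\<in>ball (0::complex) (real n0). ennreal (K1 * (real n0 * (1 + real n0)) powr s) * ennreal u \<partial>lborel)"
      proof (intro nn_integral_mono)
        fix z :: complex
        show "?F z * indicator (ball 0 (real n0)) z \<le>
          ennreal (K1 * (real n0 * (1 + real n0)) powr s) * ennreal u * indicator (ball 0 (real n0)) z"
        proof (cases "z \<in> ball 0 (real n0)")
          case True
          then have nz: "norm z \<le> real n0" by simp
          have "?F z \<le> ennreal (K1 * (norm z * (1 + norm z)) powr s) * Lint_ball z (real n0 + 1) s (fock_dweight f)"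
            using K1(2)[OF f, of 0 z] nz f0 by (simp add: fock_weight_def)
          also have "\<dots> \<le> ennreal (K1 * (real n0 * (1 + real n0)) powr s) * Lint s (fock_dweight f)"
            using nz K1(1) s
            by (intro mult_mono ennreal_leI mult_left_mono powr_mono2 nn_integral_mono)
              (auto simp: indicator_def)
          finally show ?thesis using True by (simp add: u)
        qed simp
      qed
      also have "\<dots> = ennreal (K1 * (real n0 * (1 + real n0)) powr s) * ennreal u * emeasure lborel (ball (0::complex) (real n0))"
        by (rule nn_integral_cmult_indicator) simp
      also have "\<dots> = ennreal (W * u)"
        using u(2) K1(1) by (simp add: emeasure_ball unit_ball_vol_2 W_def ennreal_mult'[symmetric] mult_ac)
      finally show ?thesis .
    qed
    have JV: "(\<integral>\<^sup>+ z. J z \<partial>lborel) = ennreal (pi * 3\<^sup>2 * u)"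
    proof -
      have "(\<integral>\<^sup>+ z. J z \<partial>lborel) = ennreal (pi * 3\<^sup>2) * ennreal u"
        unfolding J_def u(1)[symmetric] by (rule nn_integral_ball_integral) auto
      then show ?thesis using u(2) by (simp add: ennreal_mult'[symmetric])
    qed
    have step: "X n \<le> ennreal \<kappa> * X (n - 1) + ennreal c * (\<integral>\<^sup>+ z\<in>?A n. J z \<partial>lborel)" if n: "n \<ge> n0" for n
    proof -
      have n2: "n \<ge> 2" using n n02 by simp
      \<comment> \<open>\<open>lam\<close> lowers |z|^2 by |z|^2/n, which lies between 1 and 2 on
        the shell: at least 1, so that the shell index drops, and at most 2, so that the
        displacement times 1 + |z| stays bounded.\<close>
      define lam where "lam = sqrt (1 - 1 / real n)"
      have l2: "lam\<^sup>2 = 1 - 1 / real n" unfolding lam_def using n2 by simp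
      have l: "0 < lam" "lam < 1" unfolding lam_def using n2 by auto
      have pw: "?F z * indicator (?A n) z \<le> ennreal (exp (- s / 4)) * (?F (of_real lam * z) * indicator (?A (n - 1)) (of_real lam * z))
          + ennreal c * (J z * indicator (?A n) z)" for z
      proof (cases "z \<in> ?A n")
        case True
        then have zn: "real n \<le> (norm z)\<^sup>2" "(norm z)\<^sup>2 < real n + 1" by auto
        have z1: "norm z \<ge> 1"
        proof (rule ccontr)
          assume "\<not> 1 \<le> norm z"
          then have "(norm z)\<^sup>2 \<le> 1" by (simp add: power_le_one)
          then show False using zn n2 by simp
        qed
        have z2: "norm z \<le> (norm z)\<^sup>2" using mult_right_mono[OF z1, of "norm z"] by (simp add: power2_eq_square)
        let ?z' = "of_real lam * z"
        have nz': "norm ?z' = lam * norm z" using l by (simp add: norm_mult)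
        have nz'2: "(norm ?z')\<^sup>2 = (norm z)\<^sup>2 - (norm z)\<^sup>2 / real n"
          unfolding nz' power_mult_distrib l2 by (simp add: algebra_simps)
        have ge1: "(norm z)\<^sup>2 / real n \<ge> 1" using zn n2 by (simp add: field_simps)
        have le2: "(norm z)\<^sup>2 / real n \<le> 2"
        proof -
          have "(norm z)\<^sup>2 \<le> 2 * real n" using zn n2 by linarith
          then show ?thesis using n2 by (simp add: field_simps)
        qed
        have inA: "?z' \<in> ?A (n - 1)"
        proof -
          have "(norm ?z')\<^sup>2 = (norm z)\<^sup>2 * (1 - 1 / real n)" unfolding nz'2 by (simp add: algebra_simps)
          moreover have "real n * (1 - 1 / real n) \<le> (norm z)\<^sup>2 * (1 - 1 / real n)"
            using zn n2 by (intro mult_right_mono) auto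
          moreover have "real n * (1 - 1 / real n) = real n - 1" using n2 by (simp add: field_simps)
          ultimately have "real n - 1 \<le> (norm ?z')\<^sup>2" by simp
          moreover have "(norm ?z')\<^sup>2 < real n" using nz'2 ge1 zn by linarith
          ultimately show ?thesis using n2 by (simp add: of_nat_diff)
        qed
        have diff: "norm (z - ?z') = (1 - lam) * norm z"
        proof -
          have "z - ?z' = of_real (1 - lam) * z" by (simp add: algebra_simps)
          then show ?thesis using l by (simp add: norm_mult flip: of_real_diff)
        qed
        have "1 - lam \<le> 1 - lam\<^sup>2" using l by (simp add: power2_eq_square)
        then have "1 - lam \<le> 1 / real n" using l2 by simp
        then have dl: "norm (z - ?z') \<le> norm z / real n"
          unfolding diff using mult_right_mono[of "1 - lam" "1 / real n" "norm z"] by simp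
        have "norm z / real n \<le> (norm z)\<^sup>2 / real n" using z2 by (intro divide_right_mono) auto
        then have d2: "norm (z - ?z') \<le> 2" using dl le2 by linarith
        have "norm (z - ?z') * (1 + norm z) \<le> norm z / real n * (2 * norm z)"
          using dl z1 by (intro mult_mono) auto
        also have "\<dots> = 2 * ((norm z)\<^sup>2 / real n)" by (simp add: power2_eq_square)
        also have "\<dots> \<le> 4" using le2 by simp
        finally have d4: "norm (z - ?z') * (1 + norm z) \<le> 4" .
        define D where "D = norm (f z - f ?z') * exp (- (norm z)\<^sup>2 / 2)"
        have D0: "D \<ge> 0" by (simp add: D_def)
        have "ennreal (D powr s) \<le> ennreal (K2 * (norm (z - ?z') * (1 + norm z)) powr s) * J z"
          unfolding D_def J_def using l
          by (intro K2(2)[OF f _ d2]) (simp add: nz' mult_left_le_one_le)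
        also have "\<dots> \<le> ennreal (K2 * 4 powr s) * J z"
          using d4 K2(1) s by (intro mult_right_mono ennreal_leI mult_left_mono powr_mono2) auto
        finally have DJ: "ennreal (D powr s) \<le> ennreal (K2 * 4 powr s) * J z" .
        have "fock_weight f z \<le> norm (f ?z') * exp (- (norm z)\<^sup>2 / 2) + D"
        proof -
          have "norm (f z) \<le> norm (f ?z') + norm (f z - f ?z')"
            using norm_triangle_ineq[of "f ?z'" "f z - f ?z'"] by simp
          then show ?thesis unfolding fock_weight_def D_def distrib_right[symmetric]
            by (intro mult_right_mono) auto
        qed
        also have "norm (f ?z') * exp (- (norm z)\<^sup>2 / 2) \<le> exp (- 1/2) * fock_weight f ?z'"
        proof -
          have "exp (- (norm z)\<^sup>2 / 2) \<le> exp (- 1/2) * exp (- (norm ?z')\<^sup>2 / 2)"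
          proof -
            have "- (norm z)\<^sup>2 / 2 \<le> - 1/2 + - (norm ?z')\<^sup>2 / 2" using ge1 nz'2 by linarith
            then show ?thesis unfolding mult_exp_exp exp_le_cancel_iff .
          qed
          then have "norm (f ?z') * exp (- (norm z)\<^sup>2 / 2) \<le> norm (f ?z') * (exp (- 1/2) * exp (- (norm ?z')\<^sup>2 / 2))"
            by (intro mult_left_mono) auto
          then show ?thesis by (simp add: fock_weight_def mult_ac)
        qed
        finally have "fock_weight f z powr s \<le> (exp (- 1/2) * fock_weight f ?z' + D) powr s"
          using s by (intro powr_mono2) auto
        also have "\<dots> \<le> exp (s / 4) * (exp (- 1/2) * fock_weight f ?z') powr s + C\<epsilon> * D powr s"
          by (intro C\<epsilon>(2)) (auto simp: D0)
        also have "exp (s / 4) * (exp (- 1/2) * fock_weight f ?z') powr s = exp (- s / 4) * fock_weight f ?z' powr s"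
          by (simp add: powr_mult exp_powr_real mult.assoc[symmetric] mult_exp_exp)
        finally have "?F z \<le> ennreal (exp (- s / 4) * fock_weight f ?z' powr s + C\<epsilon> * D powr s)"
          by (rule ennreal_leI)
        also have "\<dots> = ennreal (exp (- s / 4)) * ?F ?z' + ennreal C\<epsilon> * ennreal (D powr s)"
          using C\<epsilon>(1) by (simp add: ennreal_plus ennreal_mult)
        also have "\<dots> \<le> ennreal (exp (- s / 4)) * ?F ?z' + ennreal C\<epsilon> * (ennreal (K2 * 4 powr s) * J z)"
          by (intro add_left_mono mult_left_mono DJ) auto
        also have "ennreal C\<epsilon> * (ennreal (K2 * 4 powr s) * J z) = ennreal c * J z"
          using C\<epsilon>(1) K2(1) by (simp add: c_def ennreal_mult mult.assoc)
        finally show ?thesis using True inA by simp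
      qed simp
      have "X n \<le> (\<integral>\<^sup>+ z. ennreal (exp (- s / 4)) * (?F (of_real lam * z) * indicator (?A (n - 1)) (of_real lam * z))
          + ennreal c * (J z * indicator (?A n) z) \<partial>lborel)"
        unfolding X_def by (intro nn_integral_mono pw)
      also have "\<dots> = ennreal (exp (- s / 4)) * (\<integral>\<^sup>+ z. ?F (of_real lam * z) * indicator (?A (n - 1)) (of_real lam * z) \<partial>lborel)
          + ennreal c * (\<integral>\<^sup>+ z\<in>?A n. J z \<partial>lborel)"
        by (subst nn_integral_add) (auto simp: nn_integral_cmult)
      also have "(\<integral>\<^sup>+ z. ?F (of_real lam * z) * indicator (?A (n - 1)) (of_real lam * z) \<partial>lborel) = ennreal (1 / lam\<^sup>2) * X (n - 1)"
        unfolding X_def using l nn_integral_lborel_complex_scale[of "of_real lam" "\<lambda>z. ?F z * indicator (?A (n - 1)) z"]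
        by simp
      also have "ennreal (exp (- s / 4)) * (ennreal (1 / lam\<^sup>2) * X (n - 1)) \<le> ennreal \<kappa> * X (n - 1)"
      proof -
        have "1 / lam\<^sup>2 \<le> exp (s / 8)"
        proof -
          have "8 / s \<le> real n - 1" using n n0 by simp
          then have "1 / (real n - 1) \<le> s / 8" using s n2 by (simp add: field_simps)
          moreover have "1 / lam\<^sup>2 = 1 + 1 / (real n - 1)" unfolding l2 using n2 by (simp add: field_simps)
          moreover have "1 + s / 8 \<le> exp (s / 8)" by (rule exp_ge_add_one_self)
          ultimately show ?thesis by linarith
        qed
        then have "exp (- s / 4) * (1 / lam\<^sup>2) \<le> exp (- s / 4) * exp (s / 8)" by (intro mult_left_mono) auto
        also have "\<dots> = \<kappa>" by (simp add: \<kappa>_def mult_exp_exp)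
        finally have "ennreal (exp (- s / 4)) * ennreal (1 / lam\<^sup>2) \<le> ennreal \<kappa>"
          by (subst ennreal_mult'[symmetric]) (auto intro!: ennreal_leI)
        then show ?thesis unfolding mult.assoc[symmetric]
          by (rule mult_right_mono) simp
      qed
      finally show ?thesis by (simp add: add_right_mono)
    qed
    have Xn0: "X (n0 - 1) \<le> ennreal (W * u)"
    proof -
      have "?A (n0 - 1) \<subseteq> ball 0 (real n0)"
      proof
        fix z assume "z \<in> ?A (n0 - 1)"
        then have "(norm z)\<^sup>2 < real n0" using n02 by (simp add: of_nat_diff)
        also have "real n0 \<le> (real n0)\<^sup>2" using n02 by (simp add: power2_eq_square)
        finally show "z \<in> ball 0 (real n0)" by (simp add: power2_less_imp_less)
      qed
      then have "X (n0 - 1) \<le> (\<integral>\<^sup>+ z\<in>ball 0 (real n0). ?F z \<partial>lborel)"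
        unfolding X_def by (intro nn_integral_mono mult_left_mono) (auto simp: indicator_def)
      then show ?thesis using disc by simp
    qed
    have Jle: "(\<integral>\<^sup>+ z\<in>?A n. J z \<partial>lborel) \<le> ennreal (pi * 3\<^sup>2 * u)" for n
      unfolding JV[symmetric] by (intro nn_integral_mono) (auto simp: indicator_def)
    \<comment> \<open>Absorbing \<kappa> times the sum into the left side is legitimate only for
      finite sums. Finiteness is inherited shell by shell from the central disc, since f is not
      assumed to lie in the Fock space.\<close>
    have fin: "X (n0 + k - 1) < \<infinity>" for k
    proof (induction k)
      case 0
      show ?case using Xn0 by (simp add: le_less_trans)
    next
      case (Suc k)
      have "X (n0 + k) \<le> ennreal \<kappa> * X (n0 + k - 1) + ennreal c * (\<integral>\<^sup>+ z\<in>?A (n0 + k). J z \<partial>lborel)"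
        by (rule step) simp
      also have "\<dots> \<le> ennreal \<kappa> * X (n0 + k - 1) + ennreal c * ennreal (pi * 3\<^sup>2 * u)"
        by (intro add_left_mono mult_left_mono Jle) auto
      also have "\<dots> < \<infinity>" using Suc by (auto simp: ennreal_mult_less_top)
      finally show ?case by simp
    qed
    define S where "S N = (\<Sum>k<N. X (n0 + k))" for N
    have SN: "S N \<le> ennreal ((\<kappa> * W + c * (pi * 3\<^sup>2)) / (1 - \<kappa>) * u)" for N
    proof -
      have sJ: "(\<Sum>k<N. (\<integral>\<^sup>+ z\<in>?A (n0 + k). J z \<partial>lborel)) \<le> ennreal (pi * 3\<^sup>2 * u)"
      proof -
        have "(\<Sum>k<N. (\<integral>\<^sup>+ z\<in>?A (n0 + k). J z \<partial>lborel)) = (\<integral>\<^sup>+ z. (\<Sum>k<N. J z * indicator (?A (n0 + k)) z) \<partial>lborel)"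
          by (subst nn_integral_sum) auto
        also have "\<dots> \<le> (\<integral>\<^sup>+ z. J z \<partial>lborel)"
          by (intro nn_integral_mono sum_indicator_disjoint_le) (auto simp: disjoint_family_on_def)
        finally show ?thesis by (simp add: JV)
      qed
      have shift: "(\<Sum>k<N. X (n0 + k - 1)) \<le> X (n0 - 1) + S N"
      proof (cases N)
        case (Suc M)
        have "(\<Sum>k<N. X (n0 + k - 1)) = X (n0 - 1) + (\<Sum>k<M. X (n0 + k))"
          unfolding Suc by (subst sum.lessThan_Suc_shift) simp
        also have "\<dots> \<le> X (n0 - 1) + S N"
          unfolding S_def Suc by (intro add_left_mono) simp
        finally show ?thesis .
      qed simp
      have "S N \<le> (\<Sum>k<N. ennreal \<kappa> * X (n0 + k - 1) + ennreal c * (\<integral>\<^sup>+ z\<in>?A (n0 + k). J z \<partial>lborel))"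
        unfolding S_def by (intro sum_mono step) simp
      also have "\<dots> = ennreal \<kappa> * (\<Sum>k<N. X (n0 + k - 1)) + ennreal c * (\<Sum>k<N. (\<integral>\<^sup>+ z\<in>?A (n0 + k). J z \<partial>lborel))"
        by (simp add: sum.distrib sum_distrib_left)
      also have "\<dots> \<le> ennreal \<kappa> * (ennreal (W * u) + S N) + ennreal c * ennreal (pi * 3\<^sup>2 * u)"
        by (intro add_mono mult_left_mono sJ order_trans[OF shift] Xn0 order_refl) auto
      finally have main: "S N \<le> ennreal \<kappa> * (ennreal (W * u) + S N) + ennreal c * ennreal (pi * 3\<^sup>2 * u)" .
      have "S N < \<infinity>" unfolding S_def using fin[of "Suc k" for k] by (auto simp: ennreal_sum_less_top)
      then have "S N \<noteq> top" by simp
      then obtain x where x: "S N = ennreal x" "x \<ge> 0" by (auto elim: ennreal_finiteE)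
      have "x \<le> \<kappa> * (W * u + x) + c * (pi * 3\<^sup>2 * u)"
        using main \<kappa> W u(2) c x(2) unfolding x(1)
        by (simp add: ennreal_mult'[symmetric] ennreal_plus[symmetric] del: ennreal_plus)
      then have "x * (1 - \<kappa>) \<le> (\<kappa> * W + c * (pi * 3\<^sup>2)) * u" by (simp add: algebra_simps)
      then have "x \<le> (\<kappa> * W + c * (pi * 3\<^sup>2)) * u / (1 - \<kappa>)" using \<kappa> by (simp add: pos_le_divide_eq)
      then show ?thesis unfolding x(1) by (intro ennreal_leI) simp
    qed
    have "fock_integral s f \<le> (\<integral>\<^sup>+ z. ?F z * indicator (ball 0 (real n0)) z + (\<Sum>k. ?F z * indicator (?A (n0 + k)) z) \<partial>lborel)"
      unfolding fock_integral_eq_weight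
    proof (intro nn_integral_mono)
      fix z
      show "?F z \<le> ?F z * indicator (ball 0 (real n0)) z + (\<Sum>k. ?F z * indicator (?A (n0 + k)) z)"
      proof (cases "z \<in> ball 0 (real n0)")
        case False
        define m where "m = nat \<lfloor>(norm z)\<^sup>2\<rfloor>"
        have m: "real m \<le> (norm z)\<^sup>2" "(norm z)\<^sup>2 < real m + 1" unfolding m_def by (simp_all add: of_nat_nat)
        have "real n0 \<le> (real n0)\<^sup>2" using n02 by (simp add: power2_eq_square)
        also have "\<dots> \<le> (norm z)\<^sup>2" using False by (intro power_mono) auto
        finally have "n0 \<le> m" using m by linarith
        then have "z \<in> ?A (n0 + (m - n0))" using m by simp
        then have "?F z = ?F z * indicator (?A (n0 + (m - n0))) z" by simp
        also have "\<dots> \<le> (\<Sum>k. ?F z * indicator (?A (n0 + k)) z)"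
          by (rule ennreal_le_suminf)
        finally show ?thesis by (simp add: add_increasing)
      qed simp
    qed
    also have "\<dots> = (\<integral>\<^sup>+ z\<in>ball 0 (real n0). ?F z \<partial>lborel) + (\<Sum>k. X (n0 + k))"
      unfolding X_def by (subst nn_integral_add, measurable, subst nn_integral_suminf, measurable)
    also have "\<dots> \<le> ennreal (W * u) + ennreal ((\<kappa> * W + c * (pi * 3\<^sup>2)) / (1 - \<kappa>) * u)"
      by (intro add_mono disc suminf_le_const summableI SN[unfolded S_def])
    also have "\<dots> = ennreal C * ennreal u"
      using W u(2) \<kappa> c by (simp add: C_def ennreal_mult'[symmetric] ennreal_plus[symmetric] distrib_right del: ennreal_plus)
    finally show ?thesis by (simp add: u)
  qed
  then show ?thesis using that Cpos by blast
qed

section \<open>Affine symbols\<close>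

lemma entire_divided_difference:
  assumes f: "f holomorphic_on UNIV"
  obtains g where "g holomorphic_on UNIV" "\<And>x. f x = f 0 + x * g x"
proof
  show "(\<lambda>z. if z = 0 then deriv f 0 else (f z - f 0) / (z - 0)) holomorphic_on UNIV"
    by (rule pole_lemma_open) (use f in auto)
qed auto

text \<open>On the circle \<open>|x| = r\<close> the function \<open>Re (\<Psi> x * cnj (a2 * x\<^sup>2))\<close>, which is at most
  \<open>(|\<Psi>|\<^sup>2 + |a2|\<^sup>2 r\<^sup>4)/2\<close>, agrees with the real part of an entire function whose value at \<open>0\<close> is
  \<open>|a2|\<^sup>2 r\<^sup>4\<close>. Hence the maximum principle controls the second Taylor coefficient.\<close>

lemma second_coeff_growth_bound:
  fixes a0 a1 :: complex
  assumes H: "H holomorphic_on UNIV" and \<xi>: "\<xi> holomorphic_on UNIV" and r: "r > 0"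
    and bd: "\<And>x. norm x = r \<Longrightarrow> norm (H x) * exp ((norm (a0 + a1 * x + x\<^sup>2 * \<xi> x))\<^sup>2 / 2) \<le> B"
  shows "norm (H 0) * exp ((norm (\<xi> 0))\<^sup>2 * r ^ 4 / 2) \<le> B"
proof -
  define a2 where "a2 = \<xi> 0"
  \<comment> \<open>On |x| = r the product \<open>x * cnj x\<close> is r^2. The terms of the product
    \<Psi> times \<open>cnj (a2 * x^2)\<close> that still contain powers of \<open>cnj x\<close> are
    replaced by their conjugates, which have the same real part and are polynomials in x.\<close>
  define E where "E x = of_real (r ^ 4) * cnj a2 * \<xi> x + cnj a0 * a2 * x\<^sup>2 + of_real (r\<^sup>2) * cnj a1 * a2 * x" for x
  define \<Phi> where "\<Phi> x = H x * exp (E x)" for x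
  have \<Phi>: "\<Phi> holomorphic_on A" for A
    unfolding \<Phi>_def E_def
    by (intro holomorphic_intros holomorphic_on_subset[OF H] holomorphic_on_subset[OF \<xi>]) auto
  have "norm (\<Phi> 0) \<le> B * exp ((norm a2)\<^sup>2 * r ^ 4 / 2)"
  proof (rule maximum_modulus_frontier[of \<Phi> "ball 0 r"])
    fix x assume "x \<in> frontier (ball (0::complex) r)"
    then have x: "norm x = r" using r by auto
    have xx: "x * cnj x = of_real (r\<^sup>2)" using x by (simp flip: complex_norm_square)
    let ?\<Psi> = "a0 + a1 * x + x\<^sup>2 * \<xi> x"
    have "?\<Psi> * cnj (a2 * x\<^sup>2) = cnj (cnj a0 * a2 * x\<^sup>2) + cnj (of_real (r\<^sup>2) * cnj a1 * a2 * x)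
        + of_real (r ^ 4) * cnj a2 * \<xi> x"
    proof -
      have "?\<Psi> * cnj (a2 * x\<^sup>2) = a0 * cnj a2 * (cnj x)\<^sup>2 + (x * cnj x) * a1 * cnj a2 * cnj x
         + (x * cnj x)\<^sup>2 * cnj a2 * \<xi> x"
        by (simp add: power2_eq_square algebra_simps)
      then show ?thesis unfolding xx by (simp add: power2_eq_square power4_eq_xxxx algebra_simps)
    qed
    then have "Re (E x) = Re (?\<Psi> * cnj (a2 * x\<^sup>2))"
      unfolding E_def by (simp only: plus_complex.sel cnj.sel)
    also have "\<dots> \<le> ((norm ?\<Psi>)\<^sup>2 + (norm (a2 * x\<^sup>2))\<^sup>2) / 2"
      unfolding Re_mult_cnj_eq by simp
    also have "(norm (a2 * x\<^sup>2))\<^sup>2 = (norm a2)\<^sup>2 * r ^ 4"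
      by (simp add: norm_mult norm_power x power_mult_distrib flip: power_mult)
    finally have "norm (\<Phi> x) \<le> norm (H x) * exp ((norm ?\<Psi>)\<^sup>2 / 2 + (norm a2)\<^sup>2 * r ^ 4 / 2)"
      by (simp add: \<Phi>_def norm_mult mult_left_mono add_divide_distrib)
    also have "\<dots> = (norm (H x) * exp ((norm ?\<Psi>)\<^sup>2 / 2)) * exp ((norm a2)\<^sup>2 * r ^ 4 / 2)"
      by (simp add: exp_add mult_ac)
    also have "\<dots> \<le> B * exp ((norm a2)\<^sup>2 * r ^ 4 / 2)"
      using bd[OF x] by (intro mult_right_mono) auto
    finally show "norm (\<Phi> x) \<le> B * exp ((norm a2)\<^sup>2 * r ^ 4 / 2)" .
  qed (use r in \<open>auto intro!: \<Phi> holomorphic_on_imp_continuous_on\<close>)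
  \<comment> \<open>The exponent at 0 is |a2|^2 r^4: one half pays for the term |a2|^2 r^4/2 in the
    bound on the circle, the other half survives in the conclusion.\<close>
  moreover have "norm (\<Phi> 0) = norm (H 0) * exp ((norm a2)\<^sup>2 * r ^ 4 / 2) * exp ((norm a2)\<^sup>2 * r ^ 4 / 2)"
  proof -
    have "cnj a2 * a2 = of_real ((norm a2)\<^sup>2)" unfolding complex_norm_square by (rule mult.commute)
    then have "E 0 = of_real ((norm a2)\<^sup>2 * r ^ 4)"
      by (simp add: E_def a2_def[symmetric] mult_ac)
    then have "norm (\<Phi> 0) = norm (H 0) * exp ((norm a2)\<^sup>2 * r ^ 4 / 2 + (norm a2)\<^sup>2 * r ^ 4 / 2)"
      by (simp add: \<Phi>_def norm_mult)
    then show ?thesis unfolding exp_add by simp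
  qed
  ultimately show ?thesis by (simp add: a2_def)
qed

lemma quartic_exp_growth_imp_zero:
  fixes \<alpha> \<eta> A C :: real
  assumes \<eta>: "\<eta> > 0" and C: "C > 0" and A: "A \<ge> 0"
    and bd: "\<And>r. r > 0 \<Longrightarrow> \<eta> * exp (\<alpha>\<^sup>2 * r ^ 4 / 2) \<le> C * (1 + A + r) * exp ((A + r)\<^sup>2 / 2)"
  shows "\<alpha> = 0"
proof (rule ccontr)
  assume a: "\<alpha> \<noteq> 0"
  define D where "D = ln C - ln \<eta>"
  \<comment> \<open>This makes \<alpha>^2 r^2/2 - 4 at least 1 + |D|, where 4 r^2 bounds the linear
    and quadratic terms of the logarithm of the right side.\<close>
  define m where "m = 2 * (5 + \<bar>D\<bar>) / \<alpha>\<^sup>2"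
  define r where "r = max (max 1 A) m"
  have r: "r \<ge> 1" "r \<ge> A" "r \<ge> m" by (auto simp: r_def)
  have r2: "r \<le> r\<^sup>2" using r mult_right_mono[of 1 r r] by (simp add: power2_eq_square)
  have "\<eta> * exp (\<alpha>\<^sup>2 * r ^ 4 / 2) \<le> C * (1 + A + r) * exp ((A + r)\<^sup>2 / 2)"
    using bd[of r] r by simp
  also have "\<dots> \<le> C * exp (A + r) * exp ((A + r)\<^sup>2 / 2)"
    using C exp_ge_add_one_self[of "A + r"] by (intro mult_right_mono mult_left_mono) (auto simp: add.assoc)
  also have "\<dots> = C * exp (A + r + (A + r)\<^sup>2 / 2)" by (simp add: exp_add)
  finally have "ln (\<eta> * exp (\<alpha>\<^sup>2 * r ^ 4 / 2)) \<le> ln (C * exp (A + r + (A + r)\<^sup>2 / 2))"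
    using \<eta> C by (subst ln_le_cancel_iff) auto
  then have 1: "\<alpha>\<^sup>2 * r ^ 4 / 2 \<le> D + (A + r + (A + r)\<^sup>2 / 2)"
    using \<eta> C by (simp add: ln_mult D_def)
  have "(A + r)\<^sup>2 \<le> (2 * r)\<^sup>2" using r A by (intro power_mono) auto
  then have "A + r + (A + r)\<^sup>2 / 2 \<le> 4 * r\<^sup>2"
    using r r2 by (simp add: power_mult_distrib)
  moreover have "r\<^sup>2 * (\<alpha>\<^sup>2 * r\<^sup>2 / 2 - 4) = \<alpha>\<^sup>2 * r ^ 4 / 2 - 4 * r\<^sup>2"
    by (simp add: algebra_simps power4_eq_xxxx power2_eq_square)
  ultimately have 2: "r\<^sup>2 * (\<alpha>\<^sup>2 * r\<^sup>2 / 2 - 4) \<le> D"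
    using 1 by linarith
  have "m \<le> r\<^sup>2" using r r2 by simp
  then have "1 + \<bar>D\<bar> \<le> \<alpha>\<^sup>2 * r\<^sup>2 / 2 - 4"
    using a by (simp add: m_def field_simps)
  then have "1 * (1 + \<bar>D\<bar>) \<le> r\<^sup>2 * (\<alpha>\<^sup>2 * r\<^sup>2 / 2 - 4)"
    using r r2 by (intro mult_mono) auto
  from order_trans[OF this 2] show False using abs_ge_self[of D] by simp
qed

text \<open>The origin is moved to a point \<open>z1\<close> with \<open>h z1\<close> nonzero; the
  growth bound on circles about \<open>z1\<close> makes the second Taylor coefficient of \<psi>
  vanish there. At zeros of h the bound carries no information, and the second derivative vanishes
  by analytic continuation.\<close>

lemma entire_affine_of_growth:
  assumes h: "h holomorphic_on UNIV" and \<psi>: "\<psi> holomorphic_on UNIV" and nz: "\<exists>z. h z \<noteq> 0"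
    and bd: "\<And>z. symbol_weight h \<psi> z \<le> C * (1 + norm z)"
  obtains a b where "\<And>z. \<psi> z = a * z + b"
proof -
  have d\<psi>: "deriv \<psi> holomorphic_on UNIV" "deriv (deriv \<psi>) holomorphic_on UNIV"
    using \<psi> by (auto intro!: holomorphic_deriv)
  have Cpos: "C > 0"
  proof -
    obtain z where "h z \<noteq> 0" using nz by auto
    then have "0 < symbol_weight h \<psi> z" by simp
    also have "\<dots> \<le> C * (1 + norm z)" by (rule bd)
    finally show ?thesis using norm_ge_zero[of z] by (auto simp: zero_less_mult_iff)
  qed
  have key: "deriv (deriv \<psi>) z1 = 0" if z1: "h z1 \<noteq> 0" for z1
  proof -
    define \<Psi> where "\<Psi> x = \<psi> (z1 + x)" for x
    have \<Psi>: "\<Psi> holomorphic_on UNIV" unfolding \<Psi>_def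
      by (rule entire_compose[OF \<psi>]) (auto intro!: holomorphic_intros)
    obtain \<Psi>1 where p1: "\<Psi>1 holomorphic_on UNIV" "\<And>x. \<Psi> x = \<Psi> 0 + x * \<Psi>1 x"
      using entire_divided_difference[OF \<Psi>] by blast
    obtain \<xi> where \<xi>: "\<xi> holomorphic_on UNIV" "\<And>x. \<Psi>1 x = \<Psi>1 0 + x * \<xi> x"
      using entire_divided_difference[OF p1(1)] by blast
    have eq: "\<Psi> x = \<Psi> 0 + \<Psi>1 0 * x + x\<^sup>2 * \<xi> x" for x
      using p1(2)[of x] \<xi>(2)[of x] by (simp add: algebra_simps power2_eq_square)
    have H: "(\<lambda>x. h (z1 + x)) holomorphic_on UNIV"
      by (rule entire_compose[OF h]) (auto intro!: holomorphic_intros)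
    have "norm (\<xi> 0) = 0"
    proof (rule quartic_exp_growth_imp_zero[of "norm (h z1)" C "norm z1"])
      fix r :: real assume r: "r > 0"
      have "norm (h (z1 + 0)) * exp ((norm (\<xi> 0))\<^sup>2 * r ^ 4 / 2) \<le> C * (1 + norm z1 + r) * exp ((norm z1 + r)\<^sup>2 / 2)"
      proof (rule second_coeff_growth_bound[OF H \<xi>(1) r])
        fix x :: complex assume x: "norm x = r"
        have n: "norm (z1 + x) \<le> norm z1 + r" using norm_triangle_ineq[of z1 x] x by simp
        have "norm (h (z1 + x)) * exp ((norm (\<psi> (z1 + x)))\<^sup>2 / 2)
          = (norm (h (z1 + x)) * exp (((norm (\<psi> (z1 + x)))\<^sup>2 - (norm (z1 + x))\<^sup>2) / 2)) * exp ((norm (z1 + x))\<^sup>2 / 2)"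
          by (simp add: mult.assoc mult_exp_exp diff_divide_distrib)
        also have "\<dots> \<le> C * (1 + norm (z1 + x)) * exp ((norm (z1 + x))\<^sup>2 / 2)"
          by (intro mult_right_mono bd) auto
        also have "\<dots> \<le> C * (1 + norm z1 + r) * exp ((norm z1 + r)\<^sup>2 / 2)"
          using n Cpos r by (intro mult_mono) (auto intro!: power_mono)
        finally show "norm (h (z1 + x)) * exp ((norm (\<Psi> 0 + \<Psi>1 0 * x + x\<^sup>2 * \<xi> x))\<^sup>2 / 2)
          \<le> C * (1 + norm z1 + r) * exp ((norm z1 + r)\<^sup>2 / 2)"
          unfolding eq[symmetric] by (simp add: \<Psi>_def)
      qed
      then show "norm (h z1) * exp ((norm (\<xi> 0))\<^sup>2 * r ^ 4 / 2) \<le> C * (1 + norm z1 + r) * exp ((norm z1 + r)\<^sup>2 / 2)"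
        by simp
    qed (use z1 Cpos in auto)
    then have c0: "\<xi> 0 = 0" by simp
    have d\<xi>: "(\<xi> has_field_derivative deriv \<xi> x) (at x)" for x
      using \<xi>(1) by (simp add: holomorphic_derivI)
    have d1: "deriv \<psi> z = \<Psi>1 0 + 2 * (z - z1) * \<xi> (z - z1) + (z - z1)\<^sup>2 * deriv \<xi> (z - z1)" for z
    proof -
      have eq': "\<psi> = (\<lambda>z. \<Psi> 0 + \<Psi>1 0 * (z - z1) + (z - z1)\<^sup>2 * \<xi> (z - z1))"
      proof
        show "\<psi> z = \<Psi> 0 + \<Psi>1 0 * (z - z1) + (z - z1)\<^sup>2 * \<xi> (z - z1)" for z
          unfolding eq[of "z - z1", symmetric] by (simp add: \<Psi>_def)
      qed
      have "((\<lambda>z. \<Psi> 0 + \<Psi>1 0 * (z - z1) + (z - z1)\<^sup>2 * \<xi> (z - z1)) has_field_derivative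
         \<Psi>1 0 + 2 * (z - z1) * \<xi> (z - z1) + (z - z1)\<^sup>2 * deriv \<xi> (z - z1)) (at z)"
        by (auto intro!: derivative_eq_intros DERIV_chain2[OF d\<xi>])
      then show ?thesis by (subst eq') (rule DERIV_imp_deriv)
    qed
    have dd\<xi>: "(deriv \<xi> has_field_derivative deriv (deriv \<xi>) x) (at x)" for x
      by (rule holomorphic_derivI[OF holomorphic_deriv[OF \<xi>(1) open_UNIV] open_UNIV UNIV_I])
    have eq'': "deriv \<psi> = (\<lambda>z. \<Psi>1 0 + 2 * (z - z1) * \<xi> (z - z1) + (z - z1)\<^sup>2 * deriv \<xi> (z - z1))"
      using d1 by auto
    have "((\<lambda>z. \<Psi>1 0 + 2 * (z - z1) * \<xi> (z - z1) + (z - z1)\<^sup>2 * deriv \<xi> (z - z1)) has_field_derivative 0) (at z1)"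
      by (rule derivative_eq_intros DERIV_chain2[OF d\<xi>] DERIV_chain2[OF dd\<xi>] refl | simp add: c0)+
    then show ?thesis by (subst eq'') (rule DERIV_imp_deriv)
  qed
  have dd0: "deriv (deriv \<psi>) z = 0" for z
  proof (rule analytic_continuation_open[of "{z. h z \<noteq> 0}" UNIV "deriv (deriv \<psi>)" "\<lambda>_. 0"])
    have "open (h -` (- {0}))"
      by (rule open_vimage) (use holomorphic_on_imp_continuous_on[OF h] in \<open>auto\<close>)
    then show "open {z. h z \<noteq> 0}" by (simp add: vimage_def)
  qed (use nz key d\<psi> in auto)
  obtain a where a: "\<And>z. deriv \<psi> z = a"
  proof -
    have "\<exists>c. \<forall>x\<in>UNIV. deriv \<psi> x = c"
      by (rule has_field_derivative_zero_constant) (use dd0 d\<psi> holomorphic_derivI[OF d\<psi>(1) open_UNIV] in auto)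
    then show ?thesis using that by auto
  qed
  have "\<exists>c. \<forall>x\<in>UNIV. \<psi> x - a * x = c"
  proof (rule has_field_derivative_zero_constant)
    show "((\<lambda>x. \<psi> x - a * x) has_field_derivative 0) (at x within UNIV)" for x
      using holomorphic_derivI[OF \<psi> open_UNIV, of x] a[of x]
      by (auto intro!: derivative_eq_intros)
  qed auto
  then obtain b where "\<And>x. \<psi> x - a * x = b" by auto
  then have "\<And>x. \<psi> x = a * x + b" by (simp add: algebra_simps)
  then show ?thesis using that by blast
qed

section \<open>Lattices and kernel sums\<close>

text \<open>Centres of the unit squares with integer corners. No centre is 0, which matters because
  the derivative of a kernel centred at c is \<open>cnj c\<close> times the kernel and would vanish
  for c = 0.\<close>

definition lattice_pt :: "int \<times> int \<Rightarrow> complex" where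
  "lattice_pt j = Complex (of_int (fst j) + 1/2) (of_int (snd j) + 1/2)"

text \<open>Floors give half-open squares, so the cells partition the plane exactly.\<close>

definition lattice_cell :: "int \<times> int \<Rightarrow> complex set" where
  "lattice_cell j = {v. \<lfloor>Re v\<rfloor> = fst j \<and> \<lfloor>Im v\<rfloor> = snd j}"

abbreviation lattice_gauss :: "real \<Rightarrow> complex \<Rightarrow> int \<times> int \<Rightarrow> real" where
  "lattice_gauss c w j \<equiv> exp (- c * (norm (w - lattice_pt j))\<^sup>2)"

lemma lattice_cell_measurable [measurable]: "lattice_cell j \<in> sets borel"
  unfolding lattice_cell_def by measurable

lemma norm_lattice_pt_ge: "1/2 \<le> norm (lattice_pt j)"
proof -
  have "1/2 \<le> \<bar>real_of_int (fst j) + 1/2\<bar>"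
  proof (cases "fst j \<ge> 0")
    case False
    then have "real_of_int (fst j) \<le> -1" by linarith
    then show ?thesis by linarith
  qed simp
  also have "\<dots> \<le> norm (lattice_pt j)"
    using abs_Re_le_cmod[of "lattice_pt j"] by (simp add: lattice_pt_def)
  finally show ?thesis .
qed

lemma dist_lattice_pt_le:
  assumes "v \<in> lattice_cell j"
  shows "norm (v - lattice_pt j) \<le> 1"
proof -
  have "\<bar>x - (of_int \<lfloor>x\<rfloor> + 1/2)\<bar> \<le> 1/2" for x :: real
    using floor_correct[of x] by linarith
  from this[of "Re v"] this[of "Im v"] show ?thesis
    using assms cmod_le[of "v - lattice_pt j"] by (simp add: lattice_cell_def lattice_pt_def)
qed

lemma emeasure_lattice_cell: "emeasure lborel (lattice_cell j) = 1"
proof -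
  have "emeasure lborel (lattice_cell j) = (\<integral>\<^sup>+ v. indicator (lattice_cell j) v \<partial>lborel)"
    by simp
  also have "\<dots> = (\<integral>\<^sup>+ x. \<integral>\<^sup>+ y. indicator {of_int (fst j)..<of_int (fst j) + 1} (x::real)
      * indicator {of_int (snd j)..<of_int (snd j) + 1} (y::real) \<partial>lborel \<partial>lborel)"
    by (subst nn_integral_lborel_complex)
      (auto intro!: nn_integral_cong simp: lattice_cell_def indicator_def floor_eq_iff)
  also have "\<dots> = 1"
    by (simp add: nn_integral_cmult)
  finally show ?thesis .
qed

lemma nn_integral_exp_norm_sq_translate:
  fixes a :: complex
  shows "(\<integral>\<^sup>+ v. ennreal (exp (- c * (norm (v - a))\<^sup>2)) \<partial>lborel) = (\<integral>\<^sup>+ v. ennreal (exp (- c * (norm (v::complex))\<^sup>2)) \<partial>lborel)"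
  using nn_integral_lborel_translate[of "\<lambda>v. ennreal (exp (- c * (norm v)\<^sup>2))" "- a"] by simp

text \<open>Each term is at most a constant times the integral, over the unit cell of j, of a wider
  Gaussian centred at w. The cells being disjoint, the whole sum is controlled by one Gaussian
  integral, uniformly in w and A.\<close>

lemma lattice_gauss_sum_le:
  fixes \<kappa> :: real
  assumes \<kappa>: "\<kappa> > 0"
  obtains K where "K > 0"
    "\<And>A w. finite A \<Longrightarrow> (\<Sum>j\<in>A. (lattice_gauss \<kappa> w j)) \<le> K"
proof -
  have "(\<integral>\<^sup>+ v. ennreal (exp (- (\<kappa>/2) * (norm (v::complex))\<^sup>2)) \<partial>lborel) \<noteq> top"
    using nn_integral_exp_norm_sq_finite[of "\<kappa>/2"] \<kappa> by simp
  then obtain G where G: "(\<integral>\<^sup>+ v. ennreal (exp (- (\<kappa>/2) * (norm (v::complex))\<^sup>2)) \<partial>lborel) = ennreal G" "G \<ge> 0"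
    by (rule ennreal_finiteE)
  have "(\<Sum>j\<in>A. (lattice_gauss \<kappa> w j)) \<le> exp \<kappa> * G" if A: "finite A" for A w
  proof -
    let ?e = "\<lambda>j. (lattice_gauss \<kappa> w j)"
    have pw: "ennreal (?e j) * indicator (lattice_cell j) v
       \<le> ennreal (exp \<kappa>) * (ennreal (exp (- (\<kappa>/2) * (norm (v - w))\<^sup>2)) * indicator (lattice_cell j) v)" for j v
    proof (cases "v \<in> lattice_cell j")
      case True
      have "norm (v - w) \<le> norm (v - lattice_pt j) + norm (w - lattice_pt j)"
        using norm_triangle_ineq4[of "v - lattice_pt j" "w - lattice_pt j"] by simp
      then have "norm (v - w) \<le> 1 + norm (w - lattice_pt j)" using dist_lattice_pt_le[OF True] by linarith
      then have "(norm (v - w))\<^sup>2 \<le> (1 + norm (w - lattice_pt j))\<^sup>2" by (intro power_mono) auto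
      also have "\<dots> \<le> 2 + 2 * (norm (w - lattice_pt j))\<^sup>2"
        using zero_le_power2[of "1 - norm (w - lattice_pt j)"]
        unfolding power2_sum power2_diff by simp
      finally have "\<kappa> * (norm (v - w))\<^sup>2 \<le> \<kappa> * (2 + 2 * (norm (w - lattice_pt j))\<^sup>2)"
        using \<kappa> by (intro mult_left_mono) auto
      then have "- \<kappa> * (norm (w - lattice_pt j))\<^sup>2 \<le> \<kappa> + - (\<kappa>/2) * (norm (v - w))\<^sup>2"
        by (simp add: algebra_simps)
      then have "?e j \<le> exp \<kappa> * exp (- (\<kappa>/2) * (norm (v - w))\<^sup>2)"
        unfolding mult_exp_exp exp_le_cancel_iff .
      then show ?thesis using True by (simp add: ennreal_mult'[symmetric])
    qed simp
    have "ennreal (\<Sum>j\<in>A. ?e j) = (\<Sum>j\<in>A. ennreal (?e j))" by (simp add: sum_ennreal)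
    also have "\<dots> = (\<Sum>j\<in>A. (\<integral>\<^sup>+ v. ennreal (?e j) * indicator (lattice_cell j) v \<partial>lborel))"
      by (simp add: nn_integral_cmult_indicator emeasure_lattice_cell)
    also have "\<dots> \<le> (\<Sum>j\<in>A. (\<integral>\<^sup>+ v. ennreal (exp \<kappa>) * (ennreal (exp (- (\<kappa>/2) * (norm (v - w))\<^sup>2)) * indicator (lattice_cell j) v) \<partial>lborel))"
      by (intro sum_mono nn_integral_mono pw)
    also have "\<dots> = ennreal (exp \<kappa>) * (\<integral>\<^sup>+ v. (\<Sum>j\<in>A. ennreal (exp (- (\<kappa>/2) * (norm (v - w))\<^sup>2)) * indicator (lattice_cell j) v) \<partial>lborel)"
      by (subst nn_integral_sum) (auto simp: nn_integral_cmult sum_distrib_left)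
    also have "\<dots> \<le> ennreal (exp \<kappa>) * (\<integral>\<^sup>+ v. ennreal (exp (- (\<kappa>/2) * (norm (v - w))\<^sup>2)) \<partial>lborel)"
      by (intro mult_left_mono nn_integral_mono sum_indicator_disjoint_le A)
         (auto simp: disjoint_family_on_def lattice_cell_def prod_eq_iff)
    also have "\<dots> = ennreal (exp \<kappa> * G)"
      unfolding nn_integral_exp_norm_sq_translate G(1) using G(2) by (simp add: ennreal_mult)
    finally show ?thesis using G(2) by (subst (asm) ennreal_le_iff) auto
  qed
  then have "\<And>A w. finite A \<Longrightarrow> (\<Sum>j\<in>A. (lattice_gauss \<kappa> w j)) \<le> exp \<kappa> * G + 1"
    by (smt (verit))
  moreover have "exp \<kappa> * G + 1 > 0" using G(2) by (simp add: add_nonneg_pos)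
  ultimately show ?thesis using that by blast
qed

text \<open>The reproducing kernel of the Fock space with exponent 2, divided by its norm. Its
  \<open>fock_weight\<close> is a Gaussian centred at c, so its Fock integral is the same for every
  centre.\<close>

definition fock_kernel :: "complex \<Rightarrow> complex \<Rightarrow> complex" where
  "fock_kernel c w = exp (w * cnj c - of_real ((norm c)\<^sup>2 / 2))"

lemma fock_kernel_holomorphic [holomorphic_intros]: "fock_kernel c holomorphic_on A"
  unfolding fock_kernel_def by (intro holomorphic_intros)

lemma deriv_fock_kernel: "(fock_kernel c has_field_derivative cnj c * fock_kernel c w) (at w)"
  unfolding fock_kernel_def by (auto intro!: derivative_eq_intros)

lemma fock_weight_kernel: "fock_weight (fock_kernel c) w = exp (- (norm (w - c))\<^sup>2 / 2)"
proof -
  have "norm (fock_kernel c w) = exp (Re (w * cnj c) - (norm c)\<^sup>2 / 2)"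
    by (simp add: fock_kernel_def)
  moreover have "Re (w * cnj c) - (norm c)\<^sup>2 / 2 + - (norm w)\<^sup>2 / 2 = - (norm (w - c))\<^sup>2 / 2"
    unfolding Re_mult_cnj_eq by (simp add: field_simps)
  ultimately show ?thesis unfolding fock_weight_def by (simp only: mult_exp_exp)
qed

text \<open>The Gaussian of each kernel is split into two equal factors. One is summable over the
  lattice; the other is kept with its coefficient and bounded by the p-th root of the sum of p-th
  powers. The same argument covers p below and above 1.\<close>

lemma fock_integral_kernel_sum_le:
  assumes p: "0 < p"
  obtains C where "C > 0" "\<And>A c. finite A \<Longrightarrow>
    fock_integral p (\<lambda>w. \<Sum>j\<in>A. of_real (c j) * fock_kernel (lattice_pt j) w)
      \<le> ennreal (C * (\<Sum>j\<in>A. \<bar>c j\<bar> powr p))"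
proof -
  obtain K where K: "K > 0" "\<And>A w. finite A \<Longrightarrow> (\<Sum>j\<in>A. (lattice_gauss (1/4) w j)) \<le> K"
    using lattice_gauss_sum_le[of "1/4"] by (metis zero_less_divide_1_iff zero_less_numeral)
  have "(\<integral>\<^sup>+ v. ennreal (exp (- (p/4) * (norm (v::complex))\<^sup>2)) \<partial>lborel) \<noteq> top"
    using nn_integral_exp_norm_sq_finite[of "p/4"] p by simp
  then obtain G where G: "(\<integral>\<^sup>+ v. ennreal (exp (- (p/4) * (norm (v::complex))\<^sup>2)) \<partial>lborel) = ennreal G" "G \<ge> 0"
    by (rule ennreal_finiteE)
  have main: "fock_integral p (\<lambda>w. \<Sum>j\<in>A. of_real (c j) * fock_kernel (lattice_pt j) w)
      \<le> ennreal (K powr p * G * (\<Sum>j\<in>A. \<bar>c j\<bar> powr p))" if A: "finite A" for A c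
  proof -
    let ?f = "\<lambda>w. \<Sum>j\<in>A. of_real (c j) * fock_kernel (lattice_pt j) w"
    let ?g = "\<lambda>t w j. exp (- t * (norm (w - lattice_pt j))\<^sup>2)"
    have pw: "ennreal (fock_weight ?f w powr p)
      \<le> (\<Sum>j\<in>A. ennreal (K powr p * \<bar>c j\<bar> powr p) * ennreal (?g (p/4) w j))" for w
    proof -
      define \<tau> where "\<tau> = (\<Sum>j\<in>A. (\<bar>c j\<bar> * ?g (1/4) w j) powr p)"
      have "fock_weight ?f w \<le> (\<Sum>j\<in>A. norm (of_real (c j) * fock_kernel (lattice_pt j) w)) * exp (- (norm w)\<^sup>2 / 2)"
        unfolding fock_weight_def by (intro mult_right_mono norm_sum) auto
      also have "\<dots> = (\<Sum>j\<in>A. \<bar>c j\<bar> * fock_weight (fock_kernel (lattice_pt j)) w)"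
        by (simp add: sum_distrib_right norm_mult fock_weight_def mult.assoc)
      also have "\<dots> = (\<Sum>j\<in>A. ?g (1/4) w j * (\<bar>c j\<bar> * ?g (1/4) w j))"
        by (intro sum.cong) (auto simp: fock_weight_kernel mult_exp_exp mult.left_commute)
      also have "\<dots> \<le> (\<Sum>j\<in>A. ?g (1/4) w j * \<tau> powr (1 / p))"
      proof (intro sum_mono mult_left_mono)
        fix j assume "j \<in> A"
        then have "(\<bar>c j\<bar> * ?g (1/4) w j) powr p \<le> \<tau>"
          unfolding \<tau>_def using A by (intro member_le_sum) auto
        then show "\<bar>c j\<bar> * ?g (1/4) w j \<le> \<tau> powr (1 / p)"
          using p by (intro powr_le_cancel_base) auto
      qed auto
      also have "\<dots> \<le> K * \<tau> powr (1 / p)"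
        unfolding sum_distrib_right[symmetric] using K(2)[OF A] by (intro mult_right_mono) auto
      finally have "fock_weight ?f w powr p \<le> (K * \<tau> powr (1 / p)) powr p"
        using p by (intro powr_mono2) auto
      also have "\<dots> = K powr p * \<tau>"
      proof -
        have "\<tau> \<ge> 0" unfolding \<tau>_def by (intro sum_nonneg) auto
        then show ?thesis using K(1) p by (simp add: powr_mult powr_powr)
      qed
      also have "\<dots> = (\<Sum>j\<in>A. K powr p * \<bar>c j\<bar> powr p * ?g (p/4) w j)"
        unfolding \<tau>_def sum_distrib_left
        by (intro sum.cong) (auto simp: powr_mult exp_powr_real mult_ac)
      finally have "ennreal (fock_weight ?f w powr p) \<le> ennreal (\<Sum>j\<in>A. K powr p * \<bar>c j\<bar> powr p * ?g (p/4) w j)"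
        by (rule ennreal_leI)
      also have "\<dots> = (\<Sum>j\<in>A. ennreal (K powr p * \<bar>c j\<bar> powr p) * ennreal (?g (p/4) w j))"
        by (subst sum_ennreal[symmetric]) (auto simp: ennreal_mult)
      finally show ?thesis .
    qed
    have "fock_integral p ?f \<le> (\<integral>\<^sup>+ w. (\<Sum>j\<in>A. ennreal (K powr p * \<bar>c j\<bar> powr p) * ennreal (?g (p/4) w j)) \<partial>lborel)"
      unfolding fock_integral_eq_weight by (intro nn_integral_mono pw)
    also have "\<dots> = (\<Sum>j\<in>A. ennreal (K powr p * \<bar>c j\<bar> powr p) * (\<integral>\<^sup>+ w. ennreal (?g (p/4) w j) \<partial>lborel))"
      by (subst nn_integral_sum) (auto simp: nn_integral_cmult)
    also have "\<dots> = (\<Sum>j\<in>A. ennreal (K powr p * \<bar>c j\<bar> powr p * G))"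
      unfolding nn_integral_exp_norm_sq_translate G(1) using G(2)
      by (intro sum.cong) (auto simp: ennreal_mult)
    also have "\<dots> = ennreal (\<Sum>j\<in>A. K powr p * \<bar>c j\<bar> powr p * G)"
      using G(2) by (subst sum_ennreal) auto
    also have "(\<Sum>j\<in>A. K powr p * \<bar>c j\<bar> powr p * G) = K powr p * G * (\<Sum>j\<in>A. \<bar>c j\<bar> powr p)"
      by (simp add: sum_distrib_left mult_ac)
    finally show ?thesis .
  qed
  have "fock_integral p (\<lambda>w. \<Sum>j\<in>A. of_real (c j) * fock_kernel (lattice_pt j) w)
      \<le> ennreal ((K powr p * G + 1) * (\<Sum>j\<in>A. \<bar>c j\<bar> powr p))" if A: "finite A" for A c
    by (rule order_trans[OF main[OF A]]) (intro ennreal_leI mult_right_mono sum_nonneg, auto)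
  moreover have "K powr p * G + 1 > 0" using G(2) K(1) by (simp add: add_nonneg_pos)
  ultimately show ?thesis using that by blast
qed

text \<open>An elementary substitute for Khinchine's inequality, with a single term in place of the
  square function. Each sign pattern is paired with the one that differs only at j; the two sums
  differ by twice \<open>x j\<close> up to sign, so one of them has at least its modulus. The factor
  2 on the right appears because the sum over all patterns meets each pair twice.\<close>

lemma sum_over_signs_ge:
  fixes x :: "'a \<Rightarrow> complex"
  assumes A: "finite A" and j: "j \<in> A" and q: "q > 0"
  shows "2 ^ card A * norm (x j) powr q
    \<le> 2 * (\<Sum>B\<in>Pow A. norm (\<Sum>k\<in>A. (if k \<in> B then 1 else - 1) * x k) powr q)"
proof -
  define S where "S B = (\<Sum>k\<in>A. (if k \<in> B then 1 else - 1) * x k)" for B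
  define flip where "flip B = (if j \<in> B then B - {j} else insert j B)" for B
  have bij: "bij_betw flip (Pow A) (Pow A)"
    by (rule bij_betw_byWitness[where f'=flip]) (use j in \<open>auto simp: flip_def split: if_splits\<close>)
  have split: "S B = (if j \<in> B then 1 else -1) * x j + (\<Sum>k\<in>A - {j}. (if k \<in> B then 1 else - 1) * x k)" for B
    unfolding S_def using A j by (simp add: sum.remove)
  have rest: "(\<Sum>k\<in>A - {j}. (if k \<in> flip B then 1 else - 1) * x k) = (\<Sum>k\<in>A - {j}. (if k \<in> B then 1 else - 1) * x k)" for B
    by (intro sum.cong) (auto simp: flip_def)
  have diff: "S B - S (flip B) = (if j \<in> B then 2 else -2) * x j" for B
    unfolding split[of B] split[of "flip B"] rest by (simp add: flip_def)
  have two: "norm (x j) powr q \<le> norm (S B) powr q + norm (S (flip B)) powr q" for B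
  proof -
    have "2 * norm (x j) = norm (S B - S (flip B))" unfolding diff by (simp add: norm_mult)
    also have "\<dots> \<le> norm (S B) + norm (S (flip B))" by (rule norm_triangle_ineq4)
    finally have "norm (x j) \<le> norm (S B) \<or> norm (x j) \<le> norm (S (flip B))" by linarith
    then show ?thesis
    proof
      assume "norm (x j) \<le> norm (S B)"
      then have "norm (x j) powr q \<le> norm (S B) powr q" using q by (intro powr_mono2) auto
      then show ?thesis by (simp add: add_increasing2)
    next
      assume "norm (x j) \<le> norm (S (flip B))"
      then have "norm (x j) powr q \<le> norm (S (flip B)) powr q" using q by (intro powr_mono2) auto
      then show ?thesis by (simp add: add_increasing)
    qed
  qed
  have "2 ^ card A * norm (x j) powr q = (\<Sum>B\<in>Pow A. norm (x j) powr q)"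
    using A by (simp add: card_Pow)
  also have "\<dots> \<le> (\<Sum>B\<in>Pow A. norm (S B) powr q + norm (S (flip B)) powr q)"
    by (intro sum_mono two)
  also have "\<dots> = 2 * (\<Sum>B\<in>Pow A. norm (S B) powr q)"
    using sum.reindex_bij_betw[OF bij, of "\<lambda>B. norm (S B) powr q"] by (simp add: sum.distrib)
  finally show ?thesis by (simp add: S_def)
qed

section \<open>The Carleson inequality\<close>

text \<open>Common frame for both operators: \<open>T f\<close> is the primitive of \<open>z \<mapsto> L f (\<psi> z) * h z\<close> vanishing at
  \<open>0\<close>. For \<open>V\<close> the operator \<open>L\<close> is the identity, with weight \<open>\<omega> = 1\<close>; for \<open>J\<close> it is differentiation,
  with weight \<open>\<omega> w = 1 + |w|\<close>. The kernels are eigenfunctions of \<open>L\<close> with eigenvalues \<open>ev\<close>.\<close>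

locale volterra_type =
  fixes h \<psi> :: "complex \<Rightarrow> complex"
    and T L :: "(complex \<Rightarrow> complex) \<Rightarrow> complex \<Rightarrow> complex"
    and \<omega> :: "complex \<Rightarrow> real" and ev :: "complex \<Rightarrow> complex" and e1 :: "complex \<Rightarrow> complex"
  assumes h_hol: "h holomorphic_on UNIV" and psi_hol: "\<psi> holomorphic_on UNIV"
    and h_nonzero: "\<exists>z. h z \<noteq> 0" and psi_nonconst: "\<nexists>c. \<forall>z. \<psi> z = c"
    and L_hol: "\<And>f. f holomorphic_on UNIV \<Longrightarrow> L f holomorphic_on UNIV"
    and L_kernel_sum: "\<And>(A :: (int \<times> int) set) c d. finite A \<Longrightarrow>
      L (\<lambda>w. \<Sum>j\<in>A. c j * fock_kernel (d j) w) = (\<lambda>w. \<Sum>j\<in>A. c j * ev (d j) * fock_kernel (d j) w)"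
    and L_diff: "\<And>f g w. f holomorphic_on UNIV \<Longrightarrow> g holomorphic_on UNIV \<Longrightarrow>
      L (\<lambda>z. f z - g z) w = L f w - L g w"
    and L_limit: "\<And>fs f w. (\<And>n::nat. fs n holomorphic_on UNIV) \<Longrightarrow>
      (\<And>K. compact K \<Longrightarrow> uniform_limit K fs f sequentially) \<Longrightarrow> (\<lambda>n. L (fs n) w) \<longlonglongrightarrow> L f w"
    and L_weight_bound: "\<And>p. 0 < p \<Longrightarrow> \<exists>C>0. \<forall>f. f holomorphic_on UNIV \<longrightarrow>
      (Lint p (\<lambda>w. fock_weight (L f) w / \<omega> w)) \<le> ennreal C * fock_integral p f"
    and e1_hol: "e1 holomorphic_on UNIV" and L_e1: "\<And>w. L e1 w = 1"
    and e1_fock: "\<And>p. 0 < p \<Longrightarrow> fock_integral p e1 < \<infinity>"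
    and omega_measurable [measurable]: "\<omega> \<in> borel_measurable borel"
    and omega_ge_1: "\<And>w. 1 \<le> \<omega> w"
    and omega_growth: "\<And>w c. \<omega> w \<le> (1 + norm (w - c)) * \<omega> c"
    and omega_le_ev: "\<And>c. 1/2 \<le> norm c \<Longrightarrow> \<omega> c \<le> 3 * norm (ev c)"
    and T_hol: "\<And>f. f holomorphic_on UNIV \<Longrightarrow> T f holomorphic_on UNIV"
    and T_zero: "\<And>f. f holomorphic_on UNIV \<Longrightarrow> T f 0 = 0"
    and deriv_T: "\<And>f z. f holomorphic_on UNIV \<Longrightarrow> deriv (T f) z = L f (\<psi> z) * h z"
    and T_diff: "\<And>f g w. f holomorphic_on UNIV \<Longrightarrow> g holomorphic_on UNIV \<Longrightarrow>
      T (\<lambda>z. f z - g z) w = T f w - T g w"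
    and T_scale: "\<And>f c w. f holomorphic_on UNIV \<Longrightarrow> T (\<lambda>z. c * f z) w = c * T f w"
begin

lemmas psi_measurable [measurable] = entire_borel_measurable[OF psi_hol]
lemmas h_measurable [measurable] = entire_borel_measurable[OF h_hol]

abbreviation "N \<equiv> volterra_weight h \<psi>"

abbreviation "\<mu> j \<equiv> \<omega> (lattice_pt j)"

lemma fock_weight_L_measurable:
  "f holomorphic_on UNIV \<Longrightarrow> fock_weight (L f) \<in> borel_measurable borel"
  using L_hol[of f] by measurable

text \<open>The exponential in \<open>N\<close> exchanges the Gaussian weight at z for the one at
  \<open>\<psi> z\<close>. Through this identity a norm estimate for \<open>T f\<close> becomes an
  integral estimate for \<open>L f\<close> along \<psi>.\<close>

lemma fock_dweight_T:
  assumes "f holomorphic_on UNIV"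
  shows "fock_dweight (T f) z = fock_weight (L f) (\<psi> z) * N z"
proof -
  have "exp (- (norm (\<psi> z))\<^sup>2 / 2) * exp (((norm (\<psi> z))\<^sup>2 - (norm z)\<^sup>2) / 2) = exp (- (norm z)\<^sup>2 / 2)"
    by (simp add: mult_exp_exp field_simps)
  then show ?thesis
    unfolding fock_dweight_def deriv_T[OF assms] fock_weight_def volterra_weight_def norm_mult
    by (simp add: mult_ac)
qed

text \<open>The estimate of a derivative by its function is applied to \<open>T f\<close>. The
  remaining work converts norms into integrals, which explains the powers of p/(2 pi);
  \<open>D\<close> replaces the operator bound, of unknown sign, by a positive one.\<close>

lemma fock_bounded_op_imp_carleson:
  assumes q: "0 < q" and p: "0 < p" and bd: "fock_bounded_op p q T"
  obtains C where "C > 0" "\<And>f. f \<in> fock_space p \<Longrightarrow>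
    Lint q (\<lambda>z. fock_weight (L f) (\<psi> z) * N z)
      \<le> ennreal (C * enn2real (fock_integral p f) powr (q / p))"
proof -
  obtain C0 where C0: "\<And>f. f \<in> fock_space p \<Longrightarrow> fock_norm q (T f) \<le> C0 * fock_norm p f"
    and TF: "\<And>f. f \<in> fock_space p \<Longrightarrow> T f \<in> fock_space q"
    using bd unfolding fock_bounded_op_def by blast
  obtain C1 where C1: "C1 > 0" "\<And>f. f holomorphic_on UNIV \<Longrightarrow>
    Lint q (fock_dweight f) \<le> ennreal C1 * fock_integral q f"
    using nn_integral_fock_dweight_le[OF q] by blast
  define D where "D = \<bar>C0\<bar> + 1"
  have D: "D > 0" "C0 \<le> D" by (auto simp: D_def)
  define C where "C = C1 * (2 * pi / q * (D powr q * (p / (2 * pi)) powr (q / p)))"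
  have C: "C > 0" using C1 D q p by (simp add: C_def)
  have "Lint q (\<lambda>z. fock_weight (L f) (\<psi> z) * N z)
      \<le> ennreal (C * enn2real (fock_integral p f) powr (q / p))" if f: "f \<in> fock_space p" for f
  proof -
    have fh: "f holomorphic_on UNIV" using f by (simp add: fock_space_def)
    have "fock_integral q (T f) \<noteq> top" using TF[OF f] by (auto simp: fock_space_def)
    then obtain y where y: "fock_integral q (T f) = ennreal y" "y \<ge> 0" by (rule ennreal_finiteE)
    define x where "x = enn2real (fock_integral p f)"
    have x: "x \<ge> 0" by (simp add: x_def)
    have "(q / (2 * pi) * y) powr (1 / q) \<le> C0 * (p / (2 * pi) * x) powr (1 / p)"
      using C0[OF f] y by (simp add: fock_norm_def x_def)
    also have "\<dots> \<le> D * (p / (2 * pi) * x) powr (1 / p)"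
      using D by (intro mult_right_mono) auto
    finally have "((q / (2 * pi) * y) powr (1 / q)) powr q \<le> (D * (p / (2 * pi) * x) powr (1 / p)) powr q"
      using q by (intro powr_mono2) auto
    then have "q / (2 * pi) * y \<le> D powr q * ((p / (2 * pi)) powr (q / p) * x powr (q / p))"
    proof -
      have "((q / (2 * pi) * y) powr (1 / q)) powr q = q / (2 * pi) * y"
        using q y(2) by (simp add: powr_powr)
      moreover have "(D * (p / (2 * pi) * x) powr (1 / p)) powr q
          = D powr q * ((p / (2 * pi)) powr (q / p) * x powr (q / p))"
      proof -
        have "(D * (p / (2 * pi) * x) powr (1 / p)) powr q = D powr q * (p / (2 * pi) * x) powr (q / p)"
          using D by (simp add: powr_mult powr_powr)
        also have "(p / (2 * pi) * x) powr (q / p) = (p / (2 * pi)) powr (q / p) * x powr (q / p)"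
          using p x by (intro powr_mult)
        finally show ?thesis .
      qed
      moreover assume "((q / (2 * pi) * y) powr (1 / q)) powr q \<le> (D * (p / (2 * pi) * x) powr (1 / p)) powr q"
      ultimately show ?thesis by simp
    qed
    then have "y \<le> 2 * pi / q * (D powr q * ((p / (2 * pi)) powr (q / p) * x powr (q / p)))"
      using q by (simp add: field_simps)
    then have "C1 * y \<le> C1 * (2 * pi / q * (D powr q * ((p / (2 * pi)) powr (q / p) * x powr (q / p))))"
      using C1 by (intro mult_left_mono) auto
    also have "\<dots> = C * x powr (q / p)" by (simp add: C_def mult_ac)
    finally have le: "C1 * y \<le> C * x powr (q / p)" .
    have "Lint q (\<lambda>z. fock_weight (L f) (\<psi> z) * N z) \<le> ennreal C1 * ennreal y"
      using C1(2)[OF T_hol[OF fh]] by (simp add: fock_dweight_T[OF fh] y)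
    also have "\<dots> \<le> ennreal (C * x powr (q / p))"
      using le C1 y(2) by (simp add: ennreal_mult[symmetric] ennreal_leI)
    finally show ?thesis by (simp add: x_def)
  qed
  then show ?thesis using that C by blast
qed

lemma weight_bounded_imp_affine:
  assumes "\<And>z. N z \<le> C"
  obtains a b where "a \<noteq> 0" "\<And>z. \<psi> z = a * z + b"
proof -
  have "symbol_weight h \<psi> z \<le> C * (1 + norm z)" for z
    unfolding volterra_weight_mult[symmetric] mult.commute[of C]
    by (intro mult_left_mono assms) auto
  then obtain a b where ab: "\<And>z. \<psi> z = a * z + b"
    using entire_affine_of_growth[OF h_hol psi_hol h_nonzero] by blast
  moreover have "a \<noteq> 0"
  proof
    assume "a = 0"
    then have "\<forall>z. \<psi> z = b" by (simp add: ab)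
    then show False using psi_nonconst by blast
  qed
  ultimately show ?thesis using that by blast
qed

text \<open>The mean value inequality turns integrability of a power of \<open>N\<close> into a
  uniform bound.\<close>

lemma in_Lp_imp_affine:
  assumes s: "0 < s" and fin: "Lint s N < \<infinity>"
  obtains a b where "a \<noteq> 0" "\<And>z. \<psi> z = a * z + b"
proof -
  have "Lint s N \<noteq> top" using fin by simp
  then obtain i where i: "Lint s N = ennreal i" "i \<ge> 0" by (rule ennreal_finiteE)
  obtain K where K: "K > 0" "\<And>h \<psi> z0. h holomorphic_on UNIV \<Longrightarrow> \<psi> holomorphic_on UNIV \<Longrightarrow>
    ennreal (volterra_weight h \<psi> z0 powr s)
    \<le> ennreal K * Lint_ball z0 1 s (volterra_weight h \<psi>)"
    using volterra_weight_submean[OF s] by blast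
  have "N z \<le> (K * i) powr (1 / s)" for z
  proof -
    have "ennreal (N z powr s) \<le> ennreal K * Lint_ball z 1 s N"
      by (rule K(2)[OF h_hol psi_hol])
    also have "\<dots> \<le> ennreal K * ennreal i"
      unfolding i(1)[symmetric] by (intro mult_left_mono nn_integral_mono) (auto simp: indicator_def)
    finally have "N z powr s \<le> K * i" using K(1) i(2) by (simp add: ennreal_mult[symmetric])
    then show ?thesis using s by (intro powr_le_cancel_base) auto
  qed
  then show ?thesis using weight_bounded_imp_affine that by blast
qed

lemma L_kernel: "L (fock_kernel c) w = ev c * fock_kernel c w"
  using L_kernel_sum[of "{(0, 0)}" "\<lambda>_. 1" "\<lambda>_. c"] by (simp add: fun_eq_iff)

text \<open>The measure with density \<open>N powr q\<close>, carried by \<psi> and seen through a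
  Gaussian window at a lattice point. Of the exponent q/2 + 1, the part q/2 is the q-th power of a
  kernel; the part 1 makes the windows summable over the lattice.\<close>

definition local_mass :: "real \<Rightarrow> int \<times> int \<Rightarrow> ennreal" where
  "local_mass q j = (\<integral>\<^sup>+ z. ennreal ((lattice_gauss (q/2 + 1) (\<psi> z) j) * N z powr q) \<partial>lborel)"

section \<open>Consequences of the Carleson inequality\<close>

context
  fixes p q C :: real
  assumes q: "0 < q" and qp: "q < p" and C: "C > 0"
    and carleson: "\<And>f. f \<in> fock_space p \<Longrightarrow>
      Lint q (\<lambda>z. fock_weight (L f) (\<psi> z) * N z)
        \<le> ennreal (C * enn2real (fock_integral p f) powr (q / p))"
begin

lemma p_pos: "0 < p" using q qp by simp

text \<open>The inequality is tested at each point z on the kernel centred at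
  \<open>\<psi> z\<close>, whose Gaussian weight there is 1 and whose norm does not depend on the
  centre. The mean value inequality for the derivative of \<open>T f\<close> makes the result
  pointwise.\<close>

lemma carleson_imp_affine:
  obtains a b where "a \<noteq> 0" "\<And>z. \<psi> z = a * z + b"
proof -
  obtain K where K: "K > 0" "\<And>h \<psi> z0. h holomorphic_on UNIV \<Longrightarrow> \<psi> holomorphic_on UNIV \<Longrightarrow>
    ennreal (volterra_weight h \<psi> z0 powr q)
    \<le> ennreal K * Lint_ball z0 1 q (volterra_weight h \<psi>)"
    using volterra_weight_submean[OF q] by blast
  have test: "fock_weight (L f) (\<psi> z) * N z \<le> (K * (C * enn2real (fock_integral p f) powr (q / p))) powr (1 / q)"
    if f: "f \<in> fock_space p" for f z
  proof -
    have fh: "f holomorphic_on UNIV" using f by (simp add: fock_space_def)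
    have "ennreal (fock_dweight (T f) z powr q)
       \<le> ennreal K * Lint_ball z 1 q (fock_dweight (T f))"
      unfolding fock_dweight_eq
      by (intro K(2) holomorphic_deriv T_hol fh) auto
    also have "\<dots> \<le> ennreal K * Lint q (fock_dweight (T f))"
      by (intro mult_left_mono nn_integral_mono) (auto simp: indicator_def)
    also have "\<dots> \<le> ennreal K * ennreal (C * enn2real (fock_integral p f) powr (q / p))"
      unfolding fock_dweight_T[OF fh] by (intro mult_left_mono carleson f) auto
    finally have "(fock_weight (L f) (\<psi> z) * N z) powr q \<le> K * (C * enn2real (fock_integral p f) powr (q / p))"
      using K(1) C unfolding fock_dweight_T[OF fh] by (simp add: ennreal_mult[symmetric])
    then show ?thesis using q by (intro powr_le_cancel_base) auto
  qed
  have "(\<integral>\<^sup>+ v. ennreal (exp (- (p/2) * (norm (v::complex))\<^sup>2)) \<partial>lborel) < \<infinity>"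
    using p_pos by (intro nn_integral_exp_norm_sq_finite) simp
  moreover have kint: "fock_integral p (fock_kernel c) = (\<integral>\<^sup>+ v. ennreal (exp (- (p/2) * (norm (v::complex))\<^sup>2)) \<partial>lborel)" for c
    unfolding fock_integral_eq_weight nn_integral_exp_norm_sq_translate[of "p/2" c, symmetric]
    by (intro nn_integral_cong) (simp add: fock_weight_kernel exp_powr_real mult.commute)
  ultimately have kmem: "fock_kernel c \<in> fock_space p" for c
    by (simp add: fock_space_def fock_kernel_holomorphic)
  define G where "G = (K * (C * enn2real (\<integral>\<^sup>+ v. ennreal (exp (- (p/2) * (norm (v::complex))\<^sup>2)) \<partial>lborel) powr (q / p))) powr (1 / q)"
  define G' where "G' = (K * (C * enn2real (fock_integral p e1) powr (q / p))) powr (1 / q)"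
  have "N z \<le> max (3 * G) (exp (1/8) * G')" for z
  proof (cases "1/2 \<le> norm (\<psi> z)")
    case True
    have "fock_weight (L (fock_kernel (\<psi> z))) (\<psi> z) = norm (ev (\<psi> z)) * fock_weight (fock_kernel (\<psi> z)) (\<psi> z)"
      by (simp add: fock_weight_def L_kernel norm_mult)
    then have "norm (ev (\<psi> z)) * N z \<le> G"
      using test[OF kmem[of "\<psi> z"], of z] unfolding kint G_def[symmetric] by (simp add: fock_weight_kernel)
    moreover have "1 \<le> 3 * norm (ev (\<psi> z))"
      using omega_le_ev[OF True] omega_ge_1[of "\<psi> z"] by simp
    then have "1 * N z \<le> 3 * norm (ev (\<psi> z)) * N z" by (intro mult_right_mono) auto
    ultimately have "N z \<le> 3 * G" by simp
    then show ?thesis by simp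
  next
    case False
    \<comment> \<open>Near 0 the eigenvalue may vanish, as \<open>cnj c\<close> does at c = 0. The
      function \<open>e1\<close>, with \<open>L e1 = 1\<close>, replaces the kernel at points where
      |\<psi> z| < 1/2.\<close>
    have "e1 \<in> fock_space p" using e1_hol e1_fock[OF p_pos] by (simp add: fock_space_def)
    from test[OF this, of z] have le: "exp (- (norm (\<psi> z))\<^sup>2 / 2) * N z \<le> G'"
      by (simp add: fock_weight_def L_e1 G'_def)
    have "(norm (\<psi> z))\<^sup>2 \<le> (1/2)\<^sup>2" using False by (intro power_mono) auto
    then have "1 \<le> exp (1/8) * exp (- (norm (\<psi> z))\<^sup>2 / 2)"
      unfolding mult_exp_exp by (simp add: power2_eq_square)
    then have "1 * N z \<le> exp (1/8) * exp (- (norm (\<psi> z))\<^sup>2 / 2) * N z"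
      by (intro mult_right_mono) auto
    also have "\<dots> \<le> exp (1/8) * G'" using le by simp
    finally show ?thesis by simp
  qed
  then show ?thesis using weight_bounded_imp_affine that by blast
qed

text \<open>Testing the Carleson inequality on \<open>\<Sum>\<^sub>j \<plusminus>c\<^sub>j k\<^sub>j\<close> and averaging over all signs isolates the single
  kernels.\<close>

lemma carleson_lattice:
  obtains D where "D > 0" "\<And>A c. finite A \<Longrightarrow> (\<And>j. 0 \<le> c j) \<Longrightarrow>
    (\<Sum>j\<in>A. ennreal ((c j * \<mu> j) powr q) * local_mass q j)
      \<le> ennreal (D * (\<Sum>j\<in>A. c j powr p) powr (q / p))"
proof -
  obtain K1 where K1: "K1 > 0" "\<And>A w. finite A \<Longrightarrow> (\<Sum>j\<in>A. (lattice_gauss 1 w j)) \<le> K1"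
    using lattice_gauss_sum_le[OF zero_less_one] by blast
  obtain C2 where C2: "C2 > 0" "\<And>A c. finite A \<Longrightarrow>
    fock_integral p (\<lambda>w. \<Sum>j\<in>A. of_real (c j) * fock_kernel (lattice_pt j) w)
      \<le> ennreal (C2 * (\<Sum>j\<in>A. \<bar>c j\<bar> powr p))"
    using fock_integral_kernel_sum_le[OF p_pos] by blast
  define D where "D = 3 powr q * (2 * K1) * (C * C2 powr (q / p))"
  have D: "D > 0" using K1 C2 C by (simp add: D_def)
  have "(\<Sum>j\<in>A. ennreal ((c j * \<mu> j) powr q) * local_mass q j)
      \<le> ennreal (D * (\<Sum>j\<in>A. c j powr p) powr (q / p))"
    if A: "finite A" and c: "\<And>j. 0 \<le> c j" for A c
  proof -
    define \<epsilon> where "\<epsilon> B k = (if k \<in> B then 1 else - 1 :: real)" for B and k :: "int \<times> int"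
    define F where "F B w = (\<Sum>j\<in>A. of_real (\<epsilon> B j * c j) * fock_kernel (lattice_pt j) w)" for B w
    define \<sigma> where "\<sigma> = (\<Sum>j\<in>A. c j powr p)"
    have \<sigma>: "\<sigma> \<ge> 0" unfolding \<sigma>_def by (intro sum_nonneg) auto
    have Fhol: "F B holomorphic_on UNIV" for B unfolding F_def by (intro holomorphic_intros)
    have Fint: "fock_integral p (F B) \<le> ennreal (C2 * \<sigma>)" for B
    proof -
      have "\<bar>\<epsilon> B j * c j\<bar> = c j" for j using c[of j] by (auto simp: \<epsilon>_def)
      then show ?thesis using C2(2)[OF A, of "\<lambda>j. \<epsilon> B j * c j"] by (simp only: F_def[abs_def] \<sigma>_def)
    qed
    have Fmem: "F B \<in> fock_space p" for B
      using Fhol Fint[of B] by (simp add: fock_space_def le_less_trans)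
    have FC: "Lint q (\<lambda>z. fock_weight (L (F B)) (\<psi> z) * N z)
       \<le> ennreal (C * C2 powr (q / p) * \<sigma> powr (q / p))" for B
    proof -
      have "enn2real (fock_integral p (F B)) \<le> C2 * \<sigma>"
        using Fint[of B] C2(1) \<sigma> by (simp add: enn2real_leI)
      then have "enn2real (fock_integral p (F B)) powr (q / p) \<le> (C2 * \<sigma>) powr (q / p)"
        using q p_pos by (intro powr_mono2) auto
      also have "\<dots> = C2 powr (q / p) * \<sigma> powr (q / p)" using C2(1) \<sigma> by (simp add: powr_mult)
      finally have "C * enn2real (fock_integral p (F B)) powr (q / p) \<le> C * (C2 powr (q / p) * \<sigma> powr (q / p))"
        using C by (intro mult_left_mono) auto
      then show ?thesis using order_trans[OF carleson[OF Fmem[of B]] ennreal_leI] by (simp add: mult.assoc)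
    qed
    let ?S = "\<lambda>w. \<Sum>j\<in>A. (c j * \<mu> j) powr q * lattice_gauss (q/2 + 1) w j"
    have pw: "2 ^ card A * ?S w
       \<le> 3 powr q * (2 * K1) * (\<Sum>B\<in>Pow A. fock_weight (L (F B)) w powr q)" for w
    proof -
      define x where "x j = of_real (c j) * ev (lattice_pt j) * fock_kernel (lattice_pt j) w * of_real (exp (- (norm w)\<^sup>2 / 2))" for j
      have nx: "norm (x j) = c j * norm (ev (lattice_pt j)) * exp (- (norm (w - lattice_pt j))\<^sup>2 / 2)" for j
        using c[of j] unfolding fock_weight_kernel[symmetric] by (simp add: x_def norm_mult fock_weight_def)
      define \<Sigma> where "\<Sigma> = (\<Sum>B\<in>Pow A. fock_weight (L (F B)) w powr q)"
      have fw: "fock_weight (L (F B)) w = norm (\<Sum>k\<in>A. (if k \<in> B then 1 else - 1) * x k)" for B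
      proof -
        have "L (F B) w = (\<Sum>j\<in>A. of_real (\<epsilon> B j * c j) * ev (lattice_pt j) * fock_kernel (lattice_pt j) w)"
          unfolding F_def[abs_def] L_kernel_sum[OF A] ..
        then have "L (F B) w * of_real (exp (- (norm w)\<^sup>2 / 2)) = (\<Sum>k\<in>A. (if k \<in> B then 1 else - 1) * x k)"
          by (simp only: sum_distrib_right) (auto intro!: sum.cong simp: \<epsilon>_def x_def)
        then show ?thesis unfolding fock_weight_def
          by (metis abs_exp_cancel norm_mult norm_of_real)
      qed
      have sg: "2 ^ card A * norm (x j) powr q \<le> 2 * \<Sigma>" if "j \<in> A" for j
        unfolding \<Sigma>_def fw by (rule sum_over_signs_ge[OF A that q])
      have trm: "2 ^ card A * ((c j * \<mu> j) powr q * lattice_gauss (q/2 + 1) w j)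
        \<le> 3 powr q * (2 * \<Sigma>) * lattice_gauss 1 w j" if j: "j \<in> A" for j
      proof -
        let ?E = "lattice_gauss 1 w j"
        let ?g = "exp (- (norm (w - lattice_pt j))\<^sup>2 / 2)"
        have "c j * \<mu> j * ?g \<le> c j * (3 * norm (ev (lattice_pt j))) * ?g"
          using c[of j] omega_le_ev[OF norm_lattice_pt_ge[of j]] by (intro mult_right_mono mult_left_mono) auto
        also have "\<dots> = 3 * norm (x j)" by (simp add: nx)
        finally have "(c j * \<mu> j * ?g) powr q \<le> (3 * norm (x j)) powr q"
          using q c[of j] omega_ge_1[of "lattice_pt j"] by (intro powr_mono2) auto
        then have le: "(c j * \<mu> j * ?g) powr q \<le> 3 powr q * norm (x j) powr q"
          by (simp add: powr_mult)
        \<comment> \<open>Sign averaging bounds the term of every j by the same \<Sigma>; the spare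
          factor \<open>lattice_gauss 1 w j\<close> is what keeps the sum over j bounded uniformly
          in A.\<close>
        have "lattice_gauss (q/2 + 1) w j = ?g powr q * ?E"
          by (simp add: exp_powr_real mult_exp_exp algebra_simps)
        moreover have "(c j * \<mu> j * ?g) powr q = (c j * \<mu> j) powr q * ?g powr q"
          using c[of j] omega_ge_1[of "lattice_pt j"] by (simp add: powr_mult)
        ultimately have "2 ^ card A * ((c j * \<mu> j) powr q * lattice_gauss (q/2 + 1) w j)
          = 2 ^ card A * (c j * \<mu> j * ?g) powr q * ?E" by simp
        also have "\<dots> \<le> 2 ^ card A * (3 powr q * norm (x j) powr q) * ?E"
          using le by (intro mult_right_mono mult_left_mono) auto
        also have "\<dots> = 3 powr q * (2 ^ card A * norm (x j) powr q) * ?E" by simp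
        also have "\<dots> \<le> 3 powr q * (2 * \<Sigma>) * ?E"
          using sg[OF j] by (intro mult_right_mono mult_left_mono) auto
        finally show ?thesis .
      qed
      have \<Sigma>0: "\<Sigma> \<ge> 0" unfolding \<Sigma>_def by (intro sum_nonneg) auto
      have "2 ^ card A * ?S w
        \<le> (\<Sum>j\<in>A. 3 powr q * (2 * \<Sigma>) * lattice_gauss 1 w j)"
        unfolding sum_distrib_left by (intro sum_mono trm)
      also have "\<dots> = 3 powr q * (2 * \<Sigma>) * (\<Sum>j\<in>A. (lattice_gauss 1 w j))"
        by (simp add: sum_distrib_left)
      also have "\<dots> \<le> 3 powr q * (2 * \<Sigma>) * K1"
        using \<Sigma>0 by (intro mult_left_mono K1(2) A) auto
      finally show ?thesis by (simp add: \<Sigma>_def mult_ac)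
    qed
    \<comment> \<open>The number of sign patterns multiplies both sides, in place of taking an
      average, and is cancelled in the last step.\<close>
    let ?P = "ennreal (2 ^ card A)"
    have "?P * (\<Sum>j\<in>A. ennreal ((c j * \<mu> j) powr q) * local_mass q j)
      = (\<integral>\<^sup>+ z. ennreal (2 ^ card A * ?S (\<psi> z) * N z powr q) \<partial>lborel)"
    proof -
      have "?P * (\<Sum>j\<in>A. ennreal ((c j * \<mu> j) powr q) * local_mass q j)
        = (\<integral>\<^sup>+ z. ?P * (\<Sum>j\<in>A. ennreal ((c j * \<mu> j) powr q) *
            ennreal ((lattice_gauss (q/2 + 1) (\<psi> z) j) * N z powr q)) \<partial>lborel)"
        unfolding local_mass_def
        by (subst nn_integral_cmult, measurable, subst nn_integral_sum, measurable, subst nn_integral_cmult, measurable)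
      also have "\<dots> = (\<integral>\<^sup>+ z. ennreal (2 ^ card A * ?S (\<psi> z) * N z powr q) \<partial>lborel)"
      proof (intro nn_integral_cong)
        fix z
        have "?P * (\<Sum>j\<in>A. ennreal ((c j * \<mu> j) powr q) *
            ennreal ((lattice_gauss (q/2 + 1) (\<psi> z) j) * N z powr q))
          = ?P * (\<Sum>j\<in>A. ennreal ((c j * \<mu> j) powr q *
            ((lattice_gauss (q/2 + 1) (\<psi> z) j) * N z powr q)))"
          by (simp add: ennreal_mult)
        also have "\<dots> = ennreal (2 ^ card A * (\<Sum>j\<in>A. (c j * \<mu> j) powr q *
            ((lattice_gauss (q/2 + 1) (\<psi> z) j) * N z powr q)))"
          by (subst sum_ennreal) (auto simp: ennreal_mult sum_nonneg)
        finally show "?P * (\<Sum>j\<in>A. ennreal ((c j * \<mu> j) powr q) *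
            ennreal ((lattice_gauss (q/2 + 1) (\<psi> z) j) * N z powr q))
          = ennreal (2 ^ card A * ?S (\<psi> z) * N z powr q)"
          by (simp add: sum_distrib_right mult.assoc)
      qed
      finally show ?thesis .
    qed
    also have "\<dots> \<le> (\<integral>\<^sup>+ z. (\<Sum>B\<in>Pow A. ennreal (3 powr q * (2 * K1)) * ennreal ((fock_weight (L (F B)) (\<psi> z) * N z) powr q)) \<partial>lborel)"
    proof (intro nn_integral_mono)
      fix z
      have "2 ^ card A * ?S (\<psi> z) * N z powr q
        \<le> 3 powr q * (2 * K1) * (\<Sum>B\<in>Pow A. fock_weight (L (F B)) (\<psi> z) powr q) * N z powr q"
        by (intro mult_right_mono pw) auto
      also have "\<dots> = (\<Sum>B\<in>Pow A. 3 powr q * (2 * K1) * (fock_weight (L (F B)) (\<psi> z) * N z) powr q)"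
        unfolding sum_distrib_left sum_distrib_right by (intro sum.cong) (auto simp: powr_mult)
      finally have "ennreal (2 ^ card A * ?S (\<psi> z) * N z powr q)
        \<le> ennreal (\<Sum>B\<in>Pow A. 3 powr q * (2 * K1) * (fock_weight (L (F B)) (\<psi> z) * N z) powr q)"
        by (rule ennreal_leI)
      also have "\<dots> = (\<Sum>B\<in>Pow A. ennreal (3 powr q * (2 * K1)) * ennreal ((fock_weight (L (F B)) (\<psi> z) * N z) powr q))"
        using K1(1) by (subst sum_ennreal[symmetric]) (auto simp: ennreal_mult)
      finally show "ennreal (2 ^ card A * ?S (\<psi> z) * N z powr q)
        \<le> (\<Sum>B\<in>Pow A. ennreal (3 powr q * (2 * K1)) * ennreal ((fock_weight (L (F B)) (\<psi> z) * N z) powr q))" .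
    qed
    also have "\<dots> = (\<Sum>B\<in>Pow A. ennreal (3 powr q * (2 * K1)) * Lint q (\<lambda>z. fock_weight (L (F B)) (\<psi> z) * N z))"
    proof -
      have [measurable]: "fock_weight (L (F B)) \<in> borel_measurable borel" for B
        by (intro fock_weight_L_measurable Fhol)
      show ?thesis by (subst nn_integral_sum) (auto simp: nn_integral_cmult)
    qed
    also have "\<dots> \<le> (\<Sum>B\<in>Pow A. ennreal (3 powr q * (2 * K1)) * ennreal (C * C2 powr (q / p) * \<sigma> powr (q / p)))"
      by (intro sum_mono mult_left_mono FC) auto
    also have "\<dots> = ?P * ennreal (D * \<sigma> powr (q / p))"
    proof -
      have "ennreal (3 powr q * (2 * K1)) * ennreal (C * C2 powr (q / p) * \<sigma> powr (q / p)) = ennreal (D * \<sigma> powr (q / p))"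
        using K1(1) by (subst ennreal_mult'[symmetric]) (auto simp: D_def mult.assoc)
      then show ?thesis using A by (simp add: card_Pow ennreal_of_nat_eq_real_of_nat)
    qed
    finally have "?P * (\<Sum>j\<in>A. ennreal ((c j * \<mu> j) powr q) * local_mass q j) \<le> ?P * ennreal (D * \<sigma> powr (q / p))" .
    then show ?thesis unfolding \<sigma>_def by (subst (asm) ennreal_mult_le_mult_iff) auto
  qed
  then show ?thesis using that D by blast
qed
end
text \<open>That \<psi> is affine and nonconstant enters twice: unit balls have images of bounded
  diameter, so a local mass dominates \<open>N\<close> on the preimage of its cell, and each such
  preimage has area 1/|a|^2.\<close>

lemma carleson_imp_weight_Lp:
  fixes p q C :: real
  assumes q: "0 < q" and qp: "q < p" and C: "C > 0"
    and carleson: "\<And>f. f \<in> fock_space p \<Longrightarrow>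
      Lint q (\<lambda>z. fock_weight (L f) (\<psi> z) * N z)
        \<le> ennreal (C * enn2real (fock_integral p f) powr (q / p))"
  shows "Lint (p * q / (p - q)) (\<lambda>z. N z * \<omega> (\<psi> z)) < \<infinity>"
proof -
  have p: "p > 0" using q qp by simp
  obtain a b where a: "a \<noteq> 0" and ab: "\<And>z. \<psi> z = a * z + b"
    using carleson_imp_affine[OF q qp C carleson] by blast
  obtain D where D: "D > 0" "\<And>A c. finite A \<Longrightarrow> (\<And>j. 0 \<le> c j) \<Longrightarrow>
    (\<Sum>j\<in>A. ennreal ((c j * \<mu> j) powr q) * local_mass q j)
      \<le> ennreal (D * (\<Sum>j\<in>A. c j powr p) powr (q / p))"
    using carleson_lattice[OF q qp C carleson] by blast
  obtain K where K: "K > 0" "\<And>h \<psi> z0. h holomorphic_on UNIV \<Longrightarrow> \<psi> holomorphic_on UNIV \<Longrightarrow>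
    ennreal (volterra_weight h \<psi> z0 powr q)
    \<le> ennreal K * Lint_ball z0 1 q (volterra_weight h \<psi>)"
    using volterra_weight_submean[OF q] by blast
  \<comment> \<open>The exponent conjugate to p/q; q times \<theta> is the exponent of the
    claim.\<close>
  define \<theta> where "\<theta> = p / (p - q)"
  have \<theta>: "\<theta> > 0" using p qp by (simp add: \<theta>_def)
  define \<beta> where "\<beta> j = enn2real (ennreal (\<mu> j powr q) * local_mass q j)" for j
  have \<beta>0: "\<beta> j \<ge> 0" for j by (simp add: \<beta>_def)
  \<comment> \<open>Testing on a single kernel shows finiteness, so \<open>enn2real\<close> loses
    nothing in the definition of \<beta>.\<close>
  have \<beta>: "ennreal (\<mu> j powr q) * local_mass q j = ennreal (\<beta> j)" for j
  proof -
    have "ennreal (\<mu> j powr q) * local_mass q j \<le> ennreal D"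
      using D(2)[of "{j}" "\<lambda>_. 1"] by simp
    then show ?thesis unfolding \<beta>_def by (simp add: ennreal_enn2real le_less_trans)
  qed
  have sum_\<beta>: "(\<Sum>j\<in>A. \<beta> j powr \<theta>) \<le> D powr \<theta>" if A: "finite A" for A
  proof -
    \<comment> \<open>The extremal sequence for the duality of l^(p/q) and l^\<theta>: both
      \<open>c j powr p\<close> and \<open>c j powr q * \<beta> j\<close> equal
      \<open>\<beta> j powr \<theta>\<close>. The inequality becomes \<sigma> \<le> D
      \<sigma>^(q/p), which bounds the finite sum \<sigma> independently of A.\<close>
    define c where "c j = \<beta> j powr (1 / (p - q))" for j
    define \<sigma> where "\<sigma> = (\<Sum>j\<in>A. \<beta> j powr \<theta>)"
    have \<sigma>: "\<sigma> \<ge> 0" unfolding \<sigma>_def by (intro sum_nonneg) auto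
    have cp: "c j powr p = \<beta> j powr \<theta>" for j
      by (simp add: c_def powr_powr \<theta>_def)
    have cq: "c j powr q * \<beta> j = \<beta> j powr \<theta>" for j
    proof -
      have "c j powr q * \<beta> j = \<beta> j powr (q / (p - q)) * \<beta> j powr 1"
        using \<beta>0[of j] by (simp add: c_def powr_powr)
      also have "\<dots> = \<beta> j powr (q / (p - q) + 1)" by (rule powr_add[symmetric])
      also have "q / (p - q) + 1 = \<theta>" unfolding \<theta>_def using qp by (simp add: field_simps)
      finally show ?thesis .
    qed
    have "ennreal \<sigma> = (\<Sum>j\<in>A. ennreal (c j powr q * \<beta> j))"
      unfolding \<sigma>_def cq by (subst sum_ennreal) auto
    also have "\<dots> = (\<Sum>j\<in>A. ennreal ((c j * \<mu> j) powr q) * local_mass q j)"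
    proof (intro sum.cong refl)
      fix j
      have "ennreal (c j powr q * \<beta> j) = ennreal (c j powr q) * (ennreal (\<mu> j powr q) * local_mass q j)"
        unfolding \<beta> using \<beta>0 by (simp add: ennreal_mult)
      also have "\<dots> = ennreal ((c j * \<mu> j) powr q) * local_mass q j"
        using omega_ge_1[of "lattice_pt j"] by (simp add: c_def powr_mult ennreal_mult mult.assoc)
      finally show "ennreal (c j powr q * \<beta> j) = ennreal ((c j * \<mu> j) powr q) * local_mass q j" .
    qed
    also have "\<dots> \<le> ennreal (D * \<sigma> powr (q / p))"
      using D(2)[OF A, of c] unfolding cp \<sigma>_def by (simp add: c_def)
    finally have "\<sigma> \<le> D * \<sigma> powr (q / p)" using D(1) by (simp add: \<sigma>)
    show ?thesis
    proof (cases "\<sigma> = 0")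
      case True
      then show ?thesis by (simp add: \<sigma>_def)
    next
      case False
      then have pos: "\<sigma> > 0" using \<sigma> by simp
      have "\<sigma> powr (q / p) * \<sigma> powr (1 / \<theta>) = \<sigma>"
      proof -
        have "q / p + 1 / \<theta> = 1" unfolding \<theta>_def using p qp by (simp add: field_simps)
        then show ?thesis using pos by (simp flip: powr_add)
      qed
      with \<open>\<sigma> \<le> D * \<sigma> powr (q / p)\<close> have "\<sigma> powr (q / p) * \<sigma> powr (1 / \<theta>) \<le> \<sigma> powr (q / p) * D"
        by (simp add: mult.commute)
      then have "\<sigma> powr (1 / \<theta>) \<le> D" using pos by (subst (asm) mult_le_cancel_left_pos) auto
      then have "\<sigma> \<le> D powr (1 / (1 / \<theta>))" using \<theta> \<sigma> by (intro powr_le_cancel_base) auto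
      then show ?thesis by (simp add: \<sigma>_def)
    qed
  qed
  \<comment> \<open>The reciprocal of the Gaussian window at distance |a| + 1 from the lattice
    point: \<open>\<psi> z\<close> lies within 1 of it, and \<psi> maps the unit ball about z to
    within |a| of \<open>\<psi> z\<close>.\<close>
  define \<gamma> where "\<gamma> = exp ((q/2 + 1) * (norm a + 1)\<^sup>2)"
  define C3 where "C3 = 2 powr q * (K * \<gamma>)"
  have C3: "C3 > 0" using K(1) by (simp add: C3_def \<gamma>_def)
  have cell: "(N z * \<omega> (\<psi> z)) powr q \<le> C3 * \<beta> j" if z: "\<psi> z \<in> lattice_cell j" for z j
  proof -
    have d1: "norm (\<psi> z - lattice_pt j) \<le> 1" by (rule dist_lattice_pt_le[OF z])
    have "ennreal (N z powr q) \<le> ennreal K * Lint_ball z 1 q N"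
      by (rule K(2)[OF h_hol psi_hol])
    also have "\<dots> \<le> ennreal K * (\<integral>\<^sup>+ w. ennreal \<gamma> * ennreal ((lattice_gauss (q/2 + 1) (\<psi> w) j) * N w powr q) \<partial>lborel)"
    proof (intro mult_left_mono nn_integral_mono)
      fix w
      show "ennreal (N w powr q) * indicator (ball z 1) w
         \<le> ennreal \<gamma> * ennreal ((lattice_gauss (q/2 + 1) (\<psi> w) j) * N w powr q)"
      proof (cases "w \<in> ball z 1")
        case True
        have "norm (\<psi> w - lattice_pt j) \<le> norm (\<psi> w - \<psi> z) + norm (\<psi> z - lattice_pt j)"
          using norm_triangle_ineq[of "\<psi> w - \<psi> z" "\<psi> z - lattice_pt j"] by simp
        also have "norm (\<psi> w - \<psi> z) = norm a * norm (w - z)"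
          by (simp add: ab norm_mult[symmetric] right_diff_distrib)
        also have "\<dots> \<le> norm a * 1"
          using True by (intro mult_left_mono) (auto simp: dist_norm norm_minus_commute)
        finally have "(norm (\<psi> w - lattice_pt j))\<^sup>2 \<le> (norm a + 1)\<^sup>2"
          using d1 by (intro power_mono) auto
        then have "(q/2 + 1) * (norm (\<psi> w - lattice_pt j))\<^sup>2 \<le> (q/2 + 1) * (norm a + 1)\<^sup>2"
          using q by (intro mult_left_mono) auto
        then have "1 \<le> \<gamma> * lattice_gauss (q/2 + 1) (\<psi> w) j"
          unfolding \<gamma>_def mult_exp_exp one_le_exp_iff mult_minus_left by linarith
        then have "1 * N w powr q \<le> \<gamma> * lattice_gauss (q/2 + 1) (\<psi> w) j * N w powr q"
          by (intro mult_right_mono) auto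
        then show ?thesis using True by (simp add: ennreal_mult'[symmetric] \<gamma>_def mult.assoc)
      qed simp
    qed simp
    also have "\<dots> = ennreal K * (ennreal \<gamma> * local_mass q j)"
      unfolding local_mass_def by (subst nn_integral_cmult) auto
    finally have Nle: "ennreal (N z powr q) \<le> ennreal K * (ennreal \<gamma> * local_mass q j)" .
    have "\<omega> (\<psi> z) \<le> (1 + norm (\<psi> z - lattice_pt j)) * \<mu> j" by (rule omega_growth)
    also have "\<dots> \<le> 2 * \<mu> j"
      using d1 omega_ge_1[of "lattice_pt j"] by (intro mult_right_mono) auto
    finally have "(N z * \<omega> (\<psi> z)) powr q \<le> (N z * (2 * \<mu> j)) powr q"
      using q omega_ge_1[of "\<psi> z"] by (intro powr_mono2 mult_left_mono) auto
    also have "\<dots> = 2 powr q * \<mu> j powr q * N z powr q"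
      using omega_ge_1[of "lattice_pt j"] by (simp add: powr_mult)
    finally have "ennreal ((N z * \<omega> (\<psi> z)) powr q) \<le> ennreal (2 powr q * \<mu> j powr q) * ennreal (N z powr q)"
      by (simp add: ennreal_mult'[symmetric])
    also have "\<dots> \<le> ennreal (2 powr q * \<mu> j powr q) * (ennreal K * (ennreal \<gamma> * local_mass q j))"
      by (intro mult_left_mono Nle) auto
    also have "\<dots> = ennreal C3 * (ennreal (\<mu> j powr q) * local_mass q j)"
      using K(1) by (simp add: C3_def \<gamma>_def ennreal_mult mult_ac)
    also have "\<dots> = ennreal (C3 * \<beta> j)"
      unfolding \<beta> using C3 \<beta>0 by (simp add: ennreal_mult)
    finally show ?thesis using C3 \<beta>0[of j] by simp
  qed
  let ?M = "\<lambda>z. ennreal ((N z * \<omega> (\<psi> z)) powr (p * q / (p - q)))"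
  let ?P = "\<lambda>j. \<psi> -` lattice_cell j"
  have cellint: "(\<integral>\<^sup>+ z\<in>?P j. ?M z \<partial>lborel) \<le> ennreal (C3 powr \<theta> / (norm a)\<^sup>2 * \<beta> j powr \<theta>)" for j
  proof -
    have "(\<integral>\<^sup>+ z\<in>?P j. ?M z \<partial>lborel) \<le> (\<integral>\<^sup>+ z. ennreal (C3 powr \<theta> * \<beta> j powr \<theta>) * indicator (lattice_cell j) (a * z + b) \<partial>lborel)"
    proof (intro nn_integral_mono)
      fix z
      show "?M z * indicator (?P j) z \<le> ennreal (C3 powr \<theta> * \<beta> j powr \<theta>) * indicator (lattice_cell j) (a * z + b)"
      proof (cases "\<psi> z \<in> lattice_cell j")
        case True
        have "(N z * \<omega> (\<psi> z)) powr (p * q / (p - q)) = ((N z * \<omega> (\<psi> z)) powr q) powr \<theta>"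
          by (simp add: powr_powr \<theta>_def mult.commute)
        also have "\<dots> \<le> (C3 * \<beta> j) powr \<theta>"
          using cell[OF True] \<theta> by (intro powr_mono2) auto
        also have "\<dots> = C3 powr \<theta> * \<beta> j powr \<theta>" using C3 \<beta>0 by (simp add: powr_mult)
        finally show ?thesis using True by (simp add: ab ennreal_leI)
      qed simp
    qed
    also have "\<dots> = ennreal (C3 powr \<theta> * \<beta> j powr \<theta>) * (\<integral>\<^sup>+ z. indicator (lattice_cell j) (a * z + b) \<partial>lborel)"
      by (rule nn_integral_cmult) measurable
    also have "(\<integral>\<^sup>+ z. indicator (lattice_cell j) (a * z + b) \<partial>lborel) = ennreal (1 / (norm a)\<^sup>2)"
      using nn_integral_lborel_complex_affine[OF a, of "indicator (lattice_cell j)" b]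
      by (simp add: emeasure_lattice_cell)
    finally show ?thesis by (simp add: ennreal_mult'[symmetric])
  qed
  define e where "e = from_nat_into (UNIV :: (int \<times> int) set)"
  have inf: "infinite (UNIV :: (int \<times> int) set)" by (simp add: finite_prod infinite_UNIV_int)
  have e: "bij e" unfolding e_def by (rule bij_betw_from_nat_into[OF _ inf]) auto
  have [measurable]: "?P j \<in> sets borel" for j
    using measurable_sets[OF psi_measurable lattice_cell_measurable[of j]] by simp
  have "(\<integral>\<^sup>+ z. ?M z \<partial>lborel) \<le> (\<integral>\<^sup>+ z. (\<Sum>k. ?M z * indicator (?P (e k)) z) \<partial>lborel)"
  proof (intro nn_integral_mono)
    fix z
    obtain k where k: "e k = (\<lfloor>Re (\<psi> z)\<rfloor>, \<lfloor>Im (\<psi> z)\<rfloor>)" using e by (metis bij_pointE)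
    have "?M z = ?M z * indicator (?P (e k)) z" by (simp add: k lattice_cell_def)
    also have "\<dots> \<le> (\<Sum>k. ?M z * indicator (?P (e k)) z)" by (rule ennreal_le_suminf)
    finally show "?M z \<le> (\<Sum>k. ?M z * indicator (?P (e k)) z)" .
  qed
  also have "\<dots> = (\<Sum>k. (\<integral>\<^sup>+ z\<in>?P (e k). ?M z \<partial>lborel))"
    by (rule nn_integral_suminf) measurable
  also have "\<dots> \<le> ennreal (C3 powr \<theta> / (norm a)\<^sup>2 * D powr \<theta>)"
  proof (rule suminf_le_const[OF summableI])
    fix n
    have "(\<Sum>k<n. (\<integral>\<^sup>+ z\<in>?P (e k). ?M z \<partial>lborel)) \<le> (\<Sum>k<n. ennreal (C3 powr \<theta> / (norm a)\<^sup>2 * \<beta> (e k) powr \<theta>))"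
      by (intro sum_mono cellint)
    also have "\<dots> = ennreal (C3 powr \<theta> / (norm a)\<^sup>2 * (\<Sum>k<n. \<beta> (e k) powr \<theta>))"
      by (subst sum_ennreal) (auto simp: sum_distrib_left)
    also have "(\<Sum>k<n. \<beta> (e k) powr \<theta>) = (\<Sum>j\<in>e ` {..<n}. \<beta> j powr \<theta>)"
      using e by (subst sum.reindex) (auto simp: bij_def intro: inj_on_subset)
    also have "ennreal (C3 powr \<theta> / (norm a)\<^sup>2 * \<dots>) \<le> ennreal (C3 powr \<theta> / (norm a)\<^sup>2 * D powr \<theta>)"
      by (intro ennreal_leI mult_left_mono sum_\<beta>) auto
    finally show "(\<Sum>k<n. (\<integral>\<^sup>+ z\<in>?P (e k). ?M z \<partial>lborel)) \<le> ennreal (C3 powr \<theta> / (norm a)\<^sup>2 * D powr \<theta>)" .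
  qed
  also have "\<dots> < \<infinity>" by simp
  finally show ?thesis .
qed

end

section \<open>Sufficiency and compactness\<close>

text \<open>Young's inequality without sharp constants, from comparing y with x^((p-q)/q). The
  scaling by t makes the coefficient of x^p as small as desired at the expense of the other, which
  is what compactness needs.\<close>

lemma powr_mult_le_add:
  fixes x y p q t :: real
  assumes q: "0 < q" and qp: "q < p" and xy: "0 \<le> x" "0 \<le> y" and t: "t > 0"
  shows "(x * y) powr q \<le> t powr p * x powr p + t powr (- (p * q / (p - q))) * y powr (p * q / (p - q))"
proof -
  let ?s = "p * q / (p - q)"
  have s: "?s > 0" using q qp by simp
  have base: "(x * y) powr q \<le> x powr p + y powr ?s" if xy: "0 \<le> x" "0 \<le> y" for x y :: real
  proof (cases "y \<le> x powr ((p - q) / q)")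
    case True
    then have "y powr q \<le> (x powr ((p - q) / q)) powr q" using q xy by (intro powr_mono2) auto
    also have "\<dots> = x powr (p - q)" using q by (simp add: powr_powr)
    finally have "x powr q * y powr q \<le> x powr q * x powr (p - q)" by (intro mult_left_mono) auto
    also have "\<dots> = x powr p" by (simp flip: powr_add)
    finally show ?thesis using xy by (simp add: powr_mult add_increasing2)
  next
    case False
    then have "x powr ((p - q) / q) \<le> y" by simp
    then have "x \<le> y powr (1 / ((p - q) / q))" using q qp xy by (intro powr_le_cancel_base) auto
    then have "x powr q \<le> (y powr (1 / ((p - q) / q))) powr q" using q xy by (intro powr_mono2) auto
    also have "\<dots> = y powr (q / (p - q) * q)" by (simp add: powr_powr)
    finally have "x powr q * y powr q \<le> y powr (q / (p - q) * q) * y powr q" by (intro mult_right_mono) auto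
    also have "\<dots> = y powr (q / (p - q) * q + q)" by (rule powr_add[symmetric])
    also have "q / (p - q) * q + q = ?s" using qp by (simp add: field_simps)
    finally show ?thesis using xy by (simp add: powr_mult add_increasing)
  qed
  have "(x * y) powr q = ((t * x) * (y / t)) powr q" using t by simp
  also have "\<dots> \<le> (t * x) powr p + (y / t) powr ?s" using xy t by (intro base) auto
  also have "\<dots> = t powr p * x powr p + t powr (- ?s) * y powr ?s"
    using xy t by (simp add: powr_mult powr_divide powr_minus field_simps)
  finally show ?thesis .
qed

lemma powr_add_le_two:
  fixes a b s :: real
  assumes "0 < s" "0 \<le> a" "0 \<le> b"
  shows "(a + b) powr s \<le> 2 powr s * a powr s + 2 powr s * b powr s"
proof -
  have "(a + b) powr s \<le> (2 * max a b) powr s" using assms by (intro powr_mono2) auto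
  also have "\<dots> = 2 powr s * max a b powr s" using assms by (simp add: powr_mult)
  also have "\<dots> \<le> 2 powr s * a powr s + 2 powr s * b powr s" by (simp add: max_def)
  finally show ?thesis .
qed

section \<open>Quasi-norm estimates for Fock integrals\<close>

lemma fock_integral_add_le:
  assumes s: "0 < s" and f[measurable]: "f \<in> borel_measurable borel" and g[measurable]: "g \<in> borel_measurable borel"
  shows "fock_integral s (\<lambda>z. f z + g z) \<le> ennreal (2 powr s) * (fock_integral s f + fock_integral s g)"
proof -
  have "fock_integral s (\<lambda>z. f z + g z) \<le>
    (\<integral>\<^sup>+ z. ennreal (2 powr s) * (ennreal (fock_weight f z powr s) + ennreal (fock_weight g z powr s)) \<partial>lborel)"
    unfolding fock_integral_eq_weight
  proof (intro nn_integral_mono)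
    fix z
    have "fock_weight (\<lambda>z. f z + g z) z \<le> fock_weight f z + fock_weight g z"
      unfolding fock_weight_def distrib_right[symmetric] by (intro mult_right_mono norm_triangle_ineq) auto
    then have "fock_weight (\<lambda>z. f z + g z) z powr s \<le> (fock_weight f z + fock_weight g z) powr s"
      using s by (intro powr_mono2) auto
    also have "\<dots> \<le> 2 powr s * fock_weight f z powr s + 2 powr s * fock_weight g z powr s"
      using s by (intro powr_add_le_two) auto
    finally have "ennreal (fock_weight (\<lambda>z. f z + g z) z powr s) \<le> ennreal (2 powr s * (fock_weight f z powr s + fock_weight g z powr s))"
      unfolding distrib_left by (rule ennreal_leI)
    then show "ennreal (fock_weight (\<lambda>z. f z + g z) z powr s) \<le> ennreal (2 powr s) * (ennreal (fock_weight f z powr s) + ennreal (fock_weight g z powr s))"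
      by (simp add: ennreal_mult)
  qed
  also have "\<dots> = ennreal (2 powr s) * (fock_integral s f + fock_integral s g)"
    unfolding fock_integral_eq_weight by (simp add: nn_integral_cmult nn_integral_add)
  finally show ?thesis .
qed

lemma fock_integral_cmult: "fock_integral s (\<lambda>z. c * f z) = ennreal (norm c powr s) * fock_integral s f"
  if [measurable]: "f \<in> borel_measurable borel"
proof -
  have "fock_weight (\<lambda>z. c * f z) z powr s = norm c powr s * fock_weight f z powr s" for z
    by (simp add: fock_weight_def norm_mult powr_mult)
  then show ?thesis unfolding fock_integral_eq_weight by (simp add: ennreal_mult nn_integral_cmult)
qed

lemma fock_norm_cmult:
  assumes "0 < s" "f \<in> borel_measurable borel"
  shows "fock_norm s (\<lambda>z. c * f z) = norm c * fock_norm s f"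
proof -
  have "fock_norm s (\<lambda>z. c * f z) = (norm c powr s * (s / (2 * pi) * enn2real (fock_integral s f))) powr (1 / s)"
    unfolding fock_norm_def fock_integral_cmult[OF assms(2)] by (simp add: enn2real_mult mult_ac)
  also have "\<dots> = (norm c powr s) powr (1 / s) * fock_norm s f"
    unfolding fock_norm_def using assms(1) by (subst powr_mult) auto
  also have "(norm c powr s) powr (1 / s) = norm c" using assms(1) by (simp add: powr_powr)
  finally show ?thesis .
qed

text \<open>\<open>fock_norm\<close> passes through \<open>enn2real\<close>, which sends infinity to
  0; a bound on the norm is therefore informative only together with finiteness of the
  integral.\<close>

lemma fock_integral_le_of_norm_le:
  assumes s: "0 < s" and fin: "fock_integral s f < \<infinity>" and B: "fock_norm s f \<le> B" "0 \<le> B"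
  shows "fock_integral s f \<le> ennreal (2 * pi / s * B powr s)"
proof -
  have "fock_integral s f \<noteq> top" using fin by simp
  then obtain i where i: "fock_integral s f = ennreal i" "i \<ge> 0" by (rule ennreal_finiteE)
  have "((s / (2 * pi) * i) powr (1 / s)) powr s \<le> B powr s"
    using B s i by (intro powr_mono2) (auto simp: fock_norm_def)
  moreover have "((s / (2 * pi) * i) powr (1 / s)) powr s = s / (2 * pi) * i"
    using s i(2) by (simp add: powr_powr)
  ultimately have "s / (2 * pi) * i \<le> B powr s" by simp
  then have "i \<le> 2 * pi / s * B powr s"
    using s by (simp add: field_simps)
  then show ?thesis by (simp add: i ennreal_leI)
qed

text \<open>Boundedness of point evaluations: it gives the locally uniform bounds for Montel's
  theorem and shows that the quasi-norm separates functions.\<close>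

lemma fock_weight_le_integral:
  assumes s: "0 < s"
  obtains K where "K > 0" "\<And>f z. f holomorphic_on UNIV \<Longrightarrow> ennreal (fock_weight f z powr s) \<le> ennreal K * fock_integral s f"
proof -
  obtain K where K: "K > 0" "\<And>f z. f holomorphic_on UNIV \<Longrightarrow>
    ennreal (fock_weight f z powr s) \<le> ennreal K * Lint_ball z 1 s (fock_weight f)"
    using fock_weight_submean[OF s] by blast
  have "ennreal (fock_weight f z powr s) \<le> ennreal K * fock_integral s f" if "f holomorphic_on UNIV" for f z
    by (rule order_trans[OF K(2)[OF that]], unfold fock_integral_eq_weight)
      (intro mult_left_mono nn_integral_mono, auto simp: indicator_def)
  then show ?thesis using that K(1) by blast
qed

lemma fock_norm_eq_0_imp:
  assumes s: "0 < s" and f: "f \<in> fock_space s" and z: "fock_norm s f = 0"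
  shows "f z = 0"
proof -
  have fh: "f holomorphic_on UNIV" and fin: "fock_integral s f < \<infinity>" using f by (auto simp: fock_space_def)
  obtain K where K: "K > 0" "\<And>f z. f holomorphic_on UNIV \<Longrightarrow> ennreal (fock_weight f z powr s) \<le> ennreal K * fock_integral s f"
    using fock_weight_le_integral[OF s] by blast
  have "fock_integral s f \<le> ennreal (2 * pi / s * 0 powr s)"
    by (rule fock_integral_le_of_norm_le[OF s fin]) (use z in auto)
  then have "fock_integral s f = 0" by simp
  then have "fock_weight f z powr s \<le> 0" using K(2)[OF fh, of z] by simp
  then have "fock_weight f z powr s = 0" by (simp add: antisym)
  then show ?thesis by (simp add: fock_weight_def)
qed

section \<open>Compactness of the operators\<close>

context volterra_type begin

text \<open>If no bound exists, there are functions \<open>G n\<close> of norm 1 whose images have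
  norm above n. A convergent subsequence of the images is eventually bounded by the quasi-triangle
  inequality, while strict monotonicity of the indices gives r m \<ge> m.\<close>

lemma fock_compact_op_imp_bounded:
  assumes q: "0 < q" and p: "0 < p" and comp: "fock_compact_op p q T"
  shows "fock_bounded_op p q T"
proof -
  have TF: "\<And>f. f \<in> fock_space p \<Longrightarrow> T f \<in> fock_space q"
    using comp by (auto simp: fock_compact_op_def)
  have hol: "\<And>f p. f \<in> fock_space p \<Longrightarrow> f holomorphic_on UNIV" by (simp add: fock_space_def)
  have "\<exists>C. \<forall>f\<in>fock_space p. fock_norm q (T f) \<le> C * fock_norm p f"
  proof (rule ccontr)
    assume "\<not> ?thesis"
    then have "\<forall>n::nat. \<exists>f\<in>fock_space p. \<not> fock_norm q (T f) \<le> real n * fock_norm p f" by blast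
    then obtain F where F: "\<And>n. F n \<in> fock_space p" "\<And>n. \<not> fock_norm q (T (F n)) \<le> real n * fock_norm p (F n)"
      by metis
    \<comment> \<open>A vanishing norm forces F n = 0 and, by homogeneity, T (F n) = 0, against the
      choice of F n.\<close>
    have pos: "fock_norm p (F n) > 0" for n
    proof (rule ccontr)
      assume "\<not> ?thesis"
      then have "fock_norm p (F n) = 0" using powr_ge_zero unfolding fock_norm_def by (metis antisym not_less)
      then have z: "F n z = 0" for z using fock_norm_eq_0_imp[OF p F(1)] by blast
      then have eq: "F n = (\<lambda>z. 0 * F n z)" by auto
      have "T (F n) w = 0" for w
        by (subst eq, subst T_scale[OF hol[OF F(1)]]) simp
      then have "T (F n) = (\<lambda>w. 0)" by auto
      then have "fock_norm q (T (F n)) = 0" using q by (simp add: fock_norm_def fock_integral_def)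
      then show False using F(2)[of n] \<open>fock_norm p (F n) = 0\<close> by simp
    qed
    define G where "G n z = of_real (1 / fock_norm p (F n)) * F n z" for n z
    have nG: "fock_norm p (G n) = 1" for n
      unfolding G_def using pos[of n] fock_norm_cmult[OF p entire_borel_measurable[OF hol[OF F(1)[of n]]], of "of_real (1 / fock_norm p (F n))"]
      by (simp add: norm_divide)
    have Ghol: "G n holomorphic_on UNIV" for n unfolding G_def
      by (intro holomorphic_intros hol[OF F(1)])
    have Gmem: "G n \<in> fock_space p" for n
    proof -
      have "fock_integral p (G n) = ennreal (norm (complex_of_real (1 / fock_norm p (F n))) powr p) * fock_integral p (F n)"
        unfolding G_def by (rule fock_integral_cmult[OF entire_borel_measurable[OF hol[OF F(1)]]])
      also have "\<dots> < \<infinity>" using F(1)[of n] by (simp add: fock_space_def ennreal_mult_less_top)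
      finally show ?thesis using Ghol by (simp add: fock_space_def)
    qed
    have TG: "T (G n) = (\<lambda>w. of_real (1 / fock_norm p (F n)) * T (F n) w)" for n
      unfolding G_def using T_scale[OF hol[OF F(1)]] by blast
    have big: "fock_norm q (T (G n)) > real n" for n
    proof -
      have "fock_norm q (T (G n)) = fock_norm q (T (F n)) / fock_norm p (F n)"
        unfolding TG using pos[of n] fock_norm_cmult[OF q entire_borel_measurable[OF T_hol[OF hol[OF F(1)[of n]]]], of "of_real (1 / fock_norm p (F n))"]
        by (simp add: norm_divide)
      moreover have "real n * fock_norm p (F n) < fock_norm q (T (F n))" using F(2)[of n] by simp
      ultimately show ?thesis using pos[of n] by (simp add: pos_less_divide_eq)
    qed
    obtain r h0 where r: "strict_mono r" and h0: "h0 \<in> fock_space q"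
      and lim: "(\<lambda>n. fock_norm q (\<lambda>z. T (G (r n)) z - h0 z)) \<longlonglongrightarrow> 0"
    proof -
      have "\<exists>B. \<forall>n. fock_norm p (G n) \<le> B" using nG by (metis order_refl)
      with comp[unfolded fock_compact_op_def, THEN conjunct2, THEN spec[of _ G]] Gmem
      show thesis using that by blast
    qed
    let ?d = "\<lambda>n z. T (G (r n)) z - h0 z"
    have "eventually (\<lambda>n. fock_norm q (?d n) < 1) sequentially"
      using lim by (rule order_tendstoD) simp
    then obtain n0 where n0: "\<And>n. n \<ge> n0 \<Longrightarrow> fock_norm q (?d n) < 1"
      by (auto simp: eventually_sequentially)
    define Q where "Q = ennreal (2 powr q) * (ennreal (2 * pi / q) + fock_integral q h0)"
    have "Q < \<infinity>" using h0 by (simp add: Q_def fock_space_def ennreal_mult_less_top)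
    then have "Q \<noteq> top" by simp
    then obtain x where x: "Q = ennreal x" "x \<ge> 0" by (rule ennreal_finiteE)
    have Tm: "T (G n) \<in> borel_measurable borel" for n using T_hol[OF Ghol] by (rule entire_borel_measurable)
    have hm: "h0 \<in> borel_measurable borel" using hol[OF h0] by (rule entire_borel_measurable)
    have bdd: "fock_norm q (T (G (r n))) \<le> (q / (2 * pi) * x) powr (1 / q)" if n: "n \<ge> n0" for n
    proof -
      have dm: "?d n \<in> borel_measurable borel" using Tm hm by measurable
      \<comment> \<open>The integral of the difference must be known to be finite before its small
        norm can be used, because of the value of \<open>enn2real\<close> at infinity.\<close>
      have "fock_integral q (\<lambda>z. T (G (r n)) z + (- 1) * h0 z) \<le> ennreal (2 powr q) * (fock_integral q (T (G (r n))) + fock_integral q (\<lambda>z. (- 1) * h0 z))"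
        using Tm hm by (intro fock_integral_add_le[OF q]) auto
      also have "\<dots> < \<infinity>"
        using TF[OF Gmem[of "r n"]] h0 unfolding fock_integral_cmult[OF hm]
        by (simp add: fock_space_def ennreal_mult_less_top)
      finally have fin: "fock_integral q (?d n) < \<infinity>" by simp
      have le1: "fock_integral q (?d n) \<le> ennreal (2 * pi / q)"
        using fock_integral_le_of_norm_le[OF q fin, of 1] n0[OF n] by simp
      have "fock_integral q (\<lambda>z. (T (G (r n)) z - h0 z) + h0 z) \<le> ennreal (2 powr q) * (fock_integral q (?d n) + fock_integral q h0)"
        by (rule fock_integral_add_le[OF q dm hm])
      also have "\<dots> \<le> Q" unfolding Q_def by (intro mult_left_mono add_right_mono le1) auto
      finally have "enn2real (fock_integral q (T (G (r n)))) \<le> x"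
        unfolding x(1) using x(2) by (simp add: enn2real_leI)
      then show ?thesis unfolding fock_norm_def using q by (intro powr_mono2 mult_left_mono) auto
    qed
    define m where "m = max n0 (nat \<lceil>(q / (2 * pi) * x) powr (1 / q)\<rceil>)"
    have "(q / (2 * pi) * x) powr (1 / q) \<le> real m" unfolding m_def by linarith
    also have "\<dots> \<le> real (r m)" using seq_suble[OF r, of m] by simp
    also have "\<dots> < fock_norm q (T (G (r m)))" by (rule big)
    finally show False using bdd[of m] by (simp add: m_def)
  qed
  then show ?thesis using TF by (simp add: fock_bounded_op_def)
qed

text \<open>After division by \<omega>, the function \<open>L u\<close> at \<psi> is controlled in
  L^p by the affine change of variables, and Young's inequality pairs it with \<open>M\<close>.
  Along a subsequence this factor tends to 0 pointwise while staying bounded in L^p, but no common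
  integrable majorant is known for it; all domination has to come from \<open>M\<close>.\<close>

lemma weight_Lp_imp_compact:
  fixes p q :: real
  assumes q: "0 < q" and qp: "q < p"
    and fin: "Lint (p * q / (p - q)) (\<lambda>z. N z * \<omega> (\<psi> z)) < \<infinity>"
  shows "fock_compact_op p q T"
proof -
  have p: "p > 0" using q qp by simp
  let ?s = "p * q / (p - q)"
  have s: "?s > 0" using q p qp by simp
  define M where "M z = N z * \<omega> (\<psi> z)" for z
  have M0: "M z \<ge> 0" for z unfolding M_def using omega_ge_1[of "\<psi> z"] by simp
  have [measurable]: "M \<in> borel_measurable borel" unfolding M_def by measurable
  \<comment> \<open>Since \<omega> \<ge> 1, \<open>N\<close> is at most \<open>M\<close>, so
    integrability of a power of \<open>M\<close> already forces \<psi> to be affine.\<close>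
  have "(\<integral>\<^sup>+ z. ennreal (N z powr ?s) \<partial>lborel) \<le> (\<integral>\<^sup>+ z. ennreal (M z powr ?s) \<partial>lborel)"
  proof (intro nn_integral_mono ennreal_leI)
    fix z
    have "N z * 1 \<le> M z" unfolding M_def using omega_ge_1[of "\<psi> z"] by (intro mult_left_mono) auto
    then show "N z powr ?s \<le> M z powr ?s" using s by (intro powr_mono2) auto
  qed
  also have "\<dots> < \<infinity>" using fin by (simp add: M_def)
  finally obtain a b where a: "a \<noteq> 0" and ab: "\<And>z. \<psi> z = a * z + b"
    using in_Lp_imp_affine[OF s] by blast
  obtain CL where CL: "CL > 0" "\<And>f. f holomorphic_on UNIV \<Longrightarrow>
      Lint p (\<lambda>w. fock_weight (L f) w / \<omega> w) \<le> ennreal CL * fock_integral p f"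
    using L_weight_bound[OF p] by blast
  obtain CP where CP: "CP > 0" "\<And>f. f holomorphic_on UNIV \<Longrightarrow> f 0 = 0 \<Longrightarrow>
    fock_integral q f \<le> ennreal CP * Lint q (fock_dweight f)"
    using fock_integral_le_deriv_weight[OF q] by blast
  define X where "X u z = fock_weight (L u) (\<psi> z) / \<omega> (\<psi> z)" for u z
  have X0: "X u z \<ge> 0" for u z unfolding X_def using omega_ge_1[of "\<psi> z"] by simp
  have Xm: "X u \<in> borel_measurable borel" if "u holomorphic_on UNIV" for u
    using fock_weight_L_measurable[OF that] unfolding X_def by measurable
  have XM: "fock_dweight (T u) z = X u z * M z" if "u holomorphic_on UNIV" for u z
    using omega_ge_1[of "\<psi> z"] by (simp add: fock_dweight_T[OF that] X_def M_def)
  have Xp: "Lint p (X u) \<le> ennreal (CL / (norm a)\<^sup>2) * fock_integral p u"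
    if u: "u holomorphic_on UNIV" for u
  proof -
    note [measurable] = fock_weight_L_measurable[OF u]
    have "Lint p (X u)
       = ennreal (1 / (norm a)\<^sup>2) * Lint p (\<lambda>w. fock_weight (L u) w / \<omega> w)"
      unfolding X_def ab
      by (rule nn_integral_lborel_complex_affine[OF a, where f="\<lambda>w. ennreal ((fock_weight (L u) w / \<omega> w) powr p)"]) measurable
    also have "\<dots> \<le> ennreal (1 / (norm a)\<^sup>2) * (ennreal CL * fock_integral p u)"
      by (intro mult_left_mono CL u) auto
    also have "\<dots> = ennreal (CL / (norm a)\<^sup>2) * fock_integral p u"
      using CL(1) by (simp add: mult.assoc[symmetric] ennreal_mult'[symmetric])
    finally show ?thesis .
  qed
  have maps: "T f \<in> fock_space q" if f: "f \<in> fock_space p" for f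
  proof -
    have fh: "f holomorphic_on UNIV" using f by (simp add: fock_space_def)
    note [measurable] = Xm[OF fh]
    have "Lint q (fock_dweight (T f))
       \<le> (\<integral>\<^sup>+ z. ennreal (X f z powr p) + ennreal (M z powr ?s) \<partial>lborel)"
      unfolding XM[OF fh]
    proof (intro nn_integral_mono)
      fix z
      show "ennreal ((X f z * M z) powr q) \<le> ennreal (X f z powr p) + ennreal (M z powr ?s)"
        using powr_mult_le_add[OF q qp X0 M0 zero_less_one, of f z z] by (simp add: ennreal_plus[symmetric] ennreal_leI del: ennreal_plus)
    qed
    also have "\<dots> = Lint p (X f) + (\<integral>\<^sup>+ z. ennreal (M z powr ?s) \<partial>lborel)"
      by (rule nn_integral_add) measurable
    also have "\<dots> < \<infinity>"
    proof -
      have "Lint p (X f) < \<infinity>"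
        using f by (intro le_less_trans[OF Xp[OF fh]]) (simp add: fock_space_def ennreal_mult_less_top)
      then show ?thesis using fin by (simp add: M_def)
    qed
    finally have "ennreal CP * Lint q (fock_dweight (T f)) < \<infinity>"
      by (simp add: ennreal_mult_less_top)
    then have "fock_integral q (T f) < \<infinity>"
      by (rule le_less_trans[OF CP(2)[OF T_hol[OF fh] T_zero[OF fh]]])
    then show ?thesis using T_hol[OF fh] by (simp add: fock_space_def)
  qed
  have "\<exists>r h0. strict_mono r \<and> h0 \<in> fock_space q \<and> (\<lambda>n. fock_norm q (\<lambda>z. T (fs (r n)) z - h0 z)) \<longlonglongrightarrow> 0"
    if mem: "\<And>n. fs n \<in> fock_space p" and B: "\<And>n. fock_norm p (fs n) \<le> B" for fs :: "nat \<Rightarrow> complex \<Rightarrow> complex" and B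
  proof -
    have fsh: "fs n holomorphic_on UNIV" for n using mem[of n] by (simp add: fock_space_def)
    define B1 where "B1 = 2 * pi / p * (max B 0) powr p"
    have B1: "B1 \<ge> 0" using p by (simp add: B1_def)
    have int: "fock_integral p (fs n) \<le> ennreal B1" for n
      unfolding B1_def using mem[of n] B[of n] by (intro fock_integral_le_of_norm_le p) (auto simp: fock_space_def)
    obtain K where K: "K > 0" "\<And>f z. f holomorphic_on UNIV \<Longrightarrow> ennreal (fock_weight f z powr p) \<le> ennreal K * fock_integral p f"
      using fock_weight_le_integral[OF p] by blast
    have ptw: "norm (fs n z) \<le> (K * B1) powr (1 / p) * exp ((norm z)\<^sup>2 / 2)" for n z
    proof -
      have "ennreal (fock_weight (fs n) z powr p) \<le> ennreal K * ennreal B1"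
        by (rule order_trans[OF K(2)[OF fsh] mult_left_mono[OF int]]) simp
      then have "fock_weight (fs n) z powr p \<le> K * B1" using K(1) B1 by (simp add: ennreal_mult[symmetric])
      then have "fock_weight (fs n) z \<le> (K * B1) powr (1 / p)" using p by (intro powr_le_cancel_base) auto
      then show ?thesis unfolding fock_weight_def by (simp add: exp_minus field_simps)
    qed
    obtain g r where g: "g holomorphic_on UNIV" and r: "strict_mono (r :: nat \<Rightarrow> nat)"
      and lim: "\<And>x. (\<lambda>n. fs (r n) x) \<longlonglongrightarrow> g x"
      and ulim: "\<And>K. compact K \<Longrightarrow> uniform_limit K (fs \<circ> r) g sequentially"
    proof (rule Montel[of UNIV "range fs" fs])
      show "\<exists>B. \<forall>h\<in>range fs. \<forall>z\<in>Q. norm (h z) \<le> B" if cQ: "compact Q" for Q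
      proof -
        obtain R where R: "\<And>z. z \<in> Q \<Longrightarrow> norm z \<le> R"
          using compact_imp_bounded[OF cQ] by (auto simp: bounded_iff)
        have "norm (fs n z) \<le> (K * B1) powr (1 / p) * exp (R\<^sup>2 / 2)" if "z \<in> Q" for n z
          using ptw[of n z] R[OF that]
          by (elim order_trans) (intro mult_left_mono, auto intro!: power_mono)
        then show ?thesis by blast
      qed
    qed (use fsh in auto)
    note [measurable] = entire_borel_measurable[OF fsh] entire_borel_measurable[OF g]
    \<comment> \<open>By Fatou's lemma the locally uniform limit inherits the integral bound of the
      sequence.\<close>
    have gint: "fock_integral p g \<le> ennreal B1"
    proof -
      have "fock_integral p g = (\<integral>\<^sup>+ z. liminf (\<lambda>n. ennreal (fock_weight (fs (r n)) z powr p)) \<partial>lborel)"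
        unfolding fock_integral_eq_weight
      proof (intro nn_integral_cong)
        fix z
        have "(\<lambda>n. ennreal (fock_weight (fs (r n)) z powr p)) \<longlonglongrightarrow> ennreal (fock_weight g z powr p)"
          unfolding fock_weight_def using p
          by (intro tendsto_ennrealI tendsto_powr' tendsto_intros lim) auto
        then show "ennreal (fock_weight g z powr p) = liminf (\<lambda>n. ennreal (fock_weight (fs (r n)) z powr p))"
          by (intro lim_imp_Liminf[symmetric]) auto
      qed
      also have "\<dots> \<le> liminf (\<lambda>n. fock_integral p (fs (r n)))"
        unfolding fock_integral_eq_weight by (rule nn_integral_liminf) measurable
      also have "\<dots> \<le> ennreal B1"
        using int by (intro order_trans[OF Liminf_mono Liminf_const[THEN eq_refl]]) auto
      finally show ?thesis .
    qed
    then have gmem: "g \<in> fock_space p" using g by (simp add: fock_space_def le_less_trans)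
    define u where "u n z = fs (r n) z - g z" for n z
    have uh: "u n holomorphic_on UNIV" for n unfolding u_def by (intro holomorphic_intros fsh g)
    note [measurable] = Xm[OF uh]
    define B2 where "B2 = 2 powr p * (2 * B1)"
    have B2: "B2 \<ge> 0" using B1 by (simp add: B2_def)
    have uint: "fock_integral p (u n) \<le> ennreal B2" for n
    proof -
      have "u n = (\<lambda>z. fs (r n) z + (- 1) * g z)" by (auto simp: u_def)
      then have "fock_integral p (u n) \<le> ennreal (2 powr p) * (fock_integral p (fs (r n)) + fock_integral p (\<lambda>z. (- 1) * g z))"
        using fock_integral_add_le[OF p, of "fs (r n)" "\<lambda>z. (- 1) * g z"] by simp
      also have "fock_integral p (\<lambda>z. (- 1) * g z) = fock_integral p g"
        by (subst fock_integral_cmult) auto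
      also have "ennreal (2 powr p) * (fock_integral p (fs (r n)) + fock_integral p g) \<le> ennreal (2 powr p) * (ennreal B1 + ennreal B1)"
        by (intro mult_left_mono add_mono int gint) auto
      also have "\<dots> = ennreal B2" using B1 by (simp add: B2_def ennreal_plus[symmetric] ennreal_mult'[symmetric] del: ennreal_plus)
      finally show ?thesis .
    qed
    define B3 where "B3 = CL / (norm a)\<^sup>2 * B2"
    have B3: "B3 \<ge> 0" using CL(1) B2 by (simp add: B3_def)
    have Xint: "Lint p (X (u n)) \<le> ennreal B3" for n
    proof -
      have "Lint p (X (u n)) \<le> ennreal (CL / (norm a)\<^sup>2) * ennreal B2"
        by (rule order_trans[OF Xp[OF uh] mult_left_mono[OF uint]]) simp
      then show ?thesis using CL(1) B2 by (simp add: B3_def ennreal_mult'[symmetric])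
    qed
    have Xlim: "(\<lambda>n. X (u n) z) \<longlonglongrightarrow> 0" for z
    proof -
      have "(\<lambda>n. L ((fs \<circ> r) n) (\<psi> z)) \<longlonglongrightarrow> L g (\<psi> z)"
        by (rule L_limit[OF _ ulim]) (simp_all add: fsh)
      then have "(\<lambda>n. L ((fs \<circ> r) n) (\<psi> z) - L g (\<psi> z)) \<longlonglongrightarrow> 0" by (simp add: LIM_zero)
      moreover have "L (u n) (\<psi> z) = L ((fs \<circ> r) n) (\<psi> z) - L g (\<psi> z)" for n
        unfolding u_def[abs_def] using L_diff[OF fsh g] by simp
      ultimately have "(\<lambda>n. L (u n) (\<psi> z)) \<longlonglongrightarrow> 0" by simp
      then have "(\<lambda>n. norm (L (u n) (\<psi> z)) * exp (- (norm (\<psi> z))\<^sup>2 / 2) / \<omega> (\<psi> z)) \<longlonglongrightarrow> norm (0::complex) * exp (- (norm (\<psi> z))\<^sup>2 / 2) / \<omega> (\<psi> z)"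
        using omega_ge_1[of "\<psi> z"] by (intro tendsto_intros) auto
      then show ?thesis by (simp add: X_def fock_weight_def)
    qed
    define I where "I n = Lint q (\<lambda>z. X (u n) z * M z)" for n
    have Ismall: "eventually (\<lambda>n. I n \<le> ennreal \<epsilon>) sequentially" if \<epsilon>: "\<epsilon> > 0" for \<epsilon>
    proof -
      \<comment> \<open>Chosen so that t^p times the uniform bound \<open>B3\<close> on the
        integrals of X^p is at most \<epsilon>/2; B3 + 1 avoids division by 0.\<close>
      define t where "t = (\<epsilon> / (2 * (B3 + 1))) powr (1 / p)"
      have t: "t > 0" unfolding t_def using \<epsilon> B3 by simp
      have tp: "t powr p * B3 \<le> \<epsilon> / 2"
      proof -
        have "t powr p = \<epsilon> / (2 * (B3 + 1))" unfolding t_def using p \<epsilon> B3 by (simp add: powr_powr)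
        then have "t powr p * B3 = \<epsilon> / 2 * (B3 / (B3 + 1))" by simp
        also have "\<dots> \<le> \<epsilon> / 2 * 1" using \<epsilon> B3 by (intro mult_left_mono) auto
        finally show ?thesis by simp
      qed
      \<comment> \<open>The excess over the small multiple of X^p is dominated by a fixed multiple
        of the integrable power of \<open>M\<close>, uniformly in n, and tends to 0 pointwise.
        Dominated convergence applies to this excess.\<close>
      define Y where "Y n z = max 0 ((X (u n) z * M z) powr q - t powr p * X (u n) z powr p)" for n z
      have Yle: "Y n z \<le> t powr (- ?s) * M z powr ?s" for n z
        unfolding Y_def using powr_mult_le_add[OF q qp X0[of "u n" z] M0[of z] t] by simp
      have "(\<lambda>n. \<integral>\<^sup>+ z. ennreal (Y n z) \<partial>lborel) \<longlonglongrightarrow> (\<integral>\<^sup>+ z. 0 \<partial>(lborel :: complex measure))"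
      proof (rule nn_integral_dominated_convergence[where w="\<lambda>z. ennreal (t powr (- ?s)) * ennreal (M z powr ?s)"])
        show "(\<integral>\<^sup>+ z. ennreal (t powr (- ?s)) * ennreal (M z powr ?s) \<partial>lborel) < \<infinity>"
          using fin by (subst nn_integral_cmult) (auto simp: M_def ennreal_mult_less_top)
        show "AE z in lborel. ennreal (Y n z) \<le> ennreal (t powr (- ?s)) * ennreal (M z powr ?s)" for n
          using Yle by (auto simp: ennreal_mult'[symmetric] intro!: ennreal_leI)
        show "AE z in lborel. (\<lambda>n. ennreal (Y n z)) \<longlonglongrightarrow> 0"
        proof (rule AE_I2)
          fix z
          have "(\<lambda>n. X (u n) z * M z) \<longlonglongrightarrow> 0 * M z" by (intro tendsto_intros Xlim)
          then have "(\<lambda>n. (X (u n) z * M z) powr q) \<longlonglongrightarrow> 0"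
            using q X0 M0 by (intro tendsto_zero_powrI[where b=q]) auto
          moreover have "(\<lambda>n. t powr p * X (u n) z powr p) \<longlonglongrightarrow> t powr p * 0"
            using p X0 by (intro tendsto_intros tendsto_zero_powrI[where b=p] Xlim) auto
          ultimately have "(\<lambda>n. Y n z) \<longlonglongrightarrow> max 0 (0 - t powr p * 0)"
            unfolding Y_def by (intro tendsto_max tendsto_const tendsto_diff)
          then show "(\<lambda>n. ennreal (Y n z)) \<longlonglongrightarrow> 0"
            using tendsto_ennrealI by fastforce
        qed
        show "(\<lambda>z. ennreal (Y n z)) \<in> borel_measurable lborel" for n unfolding Y_def by measurable
      qed auto
      then have "(\<lambda>n. \<integral>\<^sup>+ z. ennreal (Y n z) \<partial>lborel) \<longlonglongrightarrow> 0" by simp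
      then have "eventually (\<lambda>n. (\<integral>\<^sup>+ z. ennreal (Y n z) \<partial>lborel) < ennreal (\<epsilon> / 2)) sequentially"
        using \<epsilon> by (intro order_tendstoD(2)) auto
      then show ?thesis
      proof eventually_elim
        case (elim n)
        have "I n \<le> (\<integral>\<^sup>+ z. ennreal (t powr p) * ennreal (X (u n) z powr p) + ennreal (Y n z) \<partial>lborel)"
          unfolding I_def
        proof (intro nn_integral_mono)
          fix z
          have "(X (u n) z * M z) powr q \<le> t powr p * X (u n) z powr p + Y n z" unfolding Y_def by simp
          then have "ennreal ((X (u n) z * M z) powr q) \<le> ennreal (t powr p * X (u n) z powr p + Y n z)" by (rule ennreal_leI)
          also have "\<dots> = ennreal (t powr p) * ennreal (X (u n) z powr p) + ennreal (Y n z)"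
            by (subst ennreal_plus) (auto simp: ennreal_mult Y_def)
          finally show "ennreal ((X (u n) z * M z) powr q) \<le> ennreal (t powr p) * ennreal (X (u n) z powr p) + ennreal (Y n z)" .
        qed
        also have "\<dots> = ennreal (t powr p) * Lint p (X (u n)) + (\<integral>\<^sup>+ z. ennreal (Y n z) \<partial>lborel)"
          unfolding Y_def by (subst nn_integral_add) (auto simp: nn_integral_cmult)
        also have "\<dots> \<le> ennreal (t powr p) * ennreal B3 + ennreal (\<epsilon> / 2)"
          using elim by (intro add_mono mult_left_mono Xint) auto
        also have "\<dots> = ennreal (t powr p * B3 + \<epsilon> / 2)"
          using B3 \<epsilon> by (simp add: ennreal_mult'[symmetric])
        also have "\<dots> \<le> ennreal \<epsilon>" using tp by (intro ennreal_leI) simp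
        finally show ?case .
      qed
    qed
    define v where "v n z = T (fs (r n)) z - T g z" for n z
    have vT: "v n = T (u n)" for n
      unfolding v_def u_def[abs_def] using T_diff[OF fsh g] by (auto simp: fun_eq_iff)
    have vint: "fock_integral q (v n) \<le> ennreal CP * I n" for n
      unfolding vT I_def XM[OF uh, symmetric] by (intro CP T_hol T_zero uh)
    have "(\<lambda>n. enn2real (fock_integral q (v n))) \<longlonglongrightarrow> 0"
    proof (rule order_tendstoI)
      fix e :: real assume e: "0 < e"
      have "eventually (\<lambda>n. I n \<le> ennreal (e / (2 * CP))) sequentially" using e CP(1) by (intro Ismall) simp
      then show "eventually (\<lambda>n. enn2real (fock_integral q (v n)) < e) sequentially"
      proof eventually_elim
        case (elim n)
        have "fock_integral q (v n) \<le> ennreal CP * ennreal (e / (2 * CP))"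
          by (rule order_trans[OF vint mult_left_mono[OF elim]]) simp
        also have "\<dots> = ennreal (e / 2)" using CP(1) e by (simp add: ennreal_mult'[symmetric])
        finally have "enn2real (fock_integral q (v n)) \<le> e / 2" using e by (intro enn2real_leI) auto
        then show ?case using e by simp
      qed
    next
      fix e :: real assume "e < 0"
      then show "eventually (\<lambda>n. e < enn2real (fock_integral q (v n))) sequentially"
        by (intro always_eventually allI less_le_trans[OF _ enn2real_nonneg])
    qed
    then have "(\<lambda>n. q / (2 * pi) * enn2real (fock_integral q (v n))) \<longlonglongrightarrow> q / (2 * pi) * 0"
      by (rule tendsto_mult_left)
    then have "(\<lambda>n. fock_norm q (v n)) \<longlonglongrightarrow> 0"
      unfolding fock_norm_def using q by (intro tendsto_zero_powrI[where b="1 / q"]) auto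
    then have "(\<lambda>n. fock_norm q (\<lambda>z. T (fs (r n)) z - T g z)) \<longlonglongrightarrow> 0" by (simp add: v_def[abs_def])
    then show ?thesis using r maps[OF gmem] by blast
  qed
  then show ?thesis unfolding fock_compact_op_def using maps by blast
qed

lemma bounded_iff_compact_iff_Lp:
  assumes q: "0 < q" and qp: "q < p"
  shows "fock_bounded_op p q T \<longleftrightarrow> fock_compact_op p q T"
    and "fock_compact_op p q T \<longleftrightarrow> in_Lp (p * q / (p - q)) (\<lambda>z. N z * \<omega> (\<psi> z))"
proof -
  have p: "p > 0" using q qp by simp
  have abs: "\<bar>N z * \<omega> (\<psi> z)\<bar> = N z * \<omega> (\<psi> z)" for z using omega_ge_1[of "\<psi> z"] by simp
  have Lp: "in_Lp (p * q / (p - q)) (\<lambda>z. N z * \<omega> (\<psi> z)) \<longleftrightarrow>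
    (Lint (p * q / (p - q)) (\<lambda>z. N z * \<omega> (\<psi> z))) < \<infinity>"
    unfolding in_Lp_def abs by auto
  have 1: "in_Lp (p * q / (p - q)) (\<lambda>z. N z * \<omega> (\<psi> z))" if "fock_bounded_op p q T"
    unfolding Lp using fock_bounded_op_imp_carleson[OF q p that] carleson_imp_weight_Lp[OF q qp] by metis
  have 2: "fock_compact_op p q T" if "in_Lp (p * q / (p - q)) (\<lambda>z. N z * \<omega> (\<psi> z))"
    using that weight_Lp_imp_compact[OF q qp] unfolding Lp by simp
  show "fock_bounded_op p q T \<longleftrightarrow> fock_compact_op p q T"
    "fock_compact_op p q T \<longleftrightarrow> in_Lp (p * q / (p - q)) (\<lambda>z. N z * \<omega> (\<psi> z))"
    using 1 2 fock_compact_op_imp_bounded[OF q p] by blast+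
qed

end

section \<open>The operators V and J\<close>

lemma contour_integral_linepath_primitive:
  assumes k: "k holomorphic_on UNIV"
  shows "((\<lambda>z. contour_integral (linepath 0 z) k) has_field_derivative k z) (at z)"
proof -
  obtain P where P: "\<And>x. x \<in> UNIV \<Longrightarrow> (P has_field_derivative k x) (at x within UNIV)"
    using holomorphic_convex_primitive'[OF convex_UNIV open_UNIV k] by blast
  have eq: "contour_integral (linepath 0 z) k = P z - P 0" for z
    using contour_integral_primitive[OF P valid_path_linepath subset_UNIV, of 0 z]
    by (simp add: contour_integral_unique)
  have "((\<lambda>z. P z - P 0) has_field_derivative k z - 0) (at z)"
    using P[of z] by (intro derivative_intros) auto
  then show ?thesis unfolding eq by simp
qed

lemma entire_contour_integrable_linepath:
  "k holomorphic_on UNIV \<Longrightarrow> k contour_integrable_on linepath a b"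
  by (intro contour_integrable_continuous_linepath holomorphic_on_imp_continuous_on)
    (auto intro: holomorphic_on_subset)

lemma deriv_limit_of_uniform_limit:
  fixes fs :: "nat \<Rightarrow> complex \<Rightarrow> complex"
  assumes "\<And>n. fs n holomorphic_on UNIV"
    and "\<And>K. compact K \<Longrightarrow> uniform_limit K fs f sequentially"
  shows "(\<lambda>n. deriv (fs n) w) \<longlonglongrightarrow> deriv f w"
proof -
  have "\<exists>g'. \<forall>x\<in>UNIV. (f has_field_derivative g' x) (at x) \<and> (\<lambda>n. deriv (fs n) x) \<longlonglongrightarrow> g' x"
  proof (rule has_complex_derivative_uniform_sequence)
    show "(fs n has_field_derivative deriv (fs n) x) (at x)" for n x
      by (rule holomorphic_derivI[OF assms(1) open_UNIV UNIV_I])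
    show "\<exists>d>0. cball x d \<subseteq> UNIV \<and> uniform_limit (cball x d) fs f sequentially" for x
      using assms(2)[of "cball x 1"] by (intro exI[of _ 1]) auto
  qed auto
  then show ?thesis by (metis DERIV_imp_deriv UNIV_I)
qed

text \<open>The identity, whose derivative is 1, serves as \<open>e1\<close> for J; half of the
  Gaussian exponent absorbs its linear growth.\<close>

lemma fock_integral_ident_finite:
  assumes p: "0 < p"
  shows "fock_integral p (\<lambda>w. w) < \<infinity>"
proof -
  have "fock_integral p (\<lambda>w. w) \<le> (\<integral>\<^sup>+ z. ennreal (2 powr p) * ennreal (exp (- (p/4) * (norm (z::complex))\<^sup>2)) \<partial>lborel)"
    unfolding fock_integral_eq_weight
  proof (intro nn_integral_mono)
    fix z :: complex
    have "norm z \<le> 1 + (norm z)\<^sup>2 / 4"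
      using zero_le_power2[of "norm z / 2 - 1"] by (simp add: power2_diff power_divide)
    also have "\<dots> \<le> exp ((norm z)\<^sup>2 / 4)" by (rule exp_ge_add_one_self)
    finally have "norm z * exp (- (norm z)\<^sup>2 / 2) \<le> exp ((norm z)\<^sup>2 / 4) * exp (- (norm z)\<^sup>2 / 2)"
      by (intro mult_right_mono) auto
    also have "\<dots> = exp (- (norm z)\<^sup>2 / 4)" by (simp add: mult_exp_exp)
    also have "\<dots> \<le> 2 * exp (- (norm z)\<^sup>2 / 4)" by simp
    finally have "fock_weight (\<lambda>w. w) z powr p \<le> (2 * exp (- (norm z)\<^sup>2 / 4)) powr p"
      unfolding fock_weight_def using p by (intro powr_mono2) auto
    also have "\<dots> = 2 powr p * exp (- (p/4) * (norm z)\<^sup>2)"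
      by (simp add: powr_mult exp_powr_real mult.commute)
    finally show "ennreal (fock_weight (\<lambda>w. w) z powr p) \<le> ennreal (2 powr p) * ennreal (exp (- (p/4) * (norm z)\<^sup>2))"
      by (simp add: ennreal_mult'[symmetric])
  qed
  also have "\<dots> < \<infinity>"
    using nn_integral_exp_norm_sq_finite[of "p/4"] p by (simp add: nn_integral_cmult ennreal_mult_less_top)
  finally show ?thesis .
qed

lemma V_op_volterra_type:
  assumes g: "g holomorphic_on UNIV" and \<psi>: "\<psi> holomorphic_on UNIV"
    and "\<not> (\<exists>c. \<forall>z. g z = c)" "\<not> (\<exists>c. \<forall>z. \<psi> z = c)"
  shows "volterra_type (deriv g) \<psi> (V_op g \<psi>) (\<lambda>f. f) (\<lambda>_. 1) (\<lambda>_. 1) (\<lambda>_. 1)"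
proof -
  have dg: "deriv g holomorphic_on UNIV" using g by (intro holomorphic_deriv) auto
  have k: "(\<lambda>w. f (\<psi> w) * deriv g w) holomorphic_on UNIV" if "f holomorphic_on UNIV" for f
    by (intro holomorphic_on_mult entire_compose[OF that \<psi>] dg)
  have dV: "(V_op g \<psi> f has_field_derivative f (\<psi> z) * deriv g z) (at z)" if "f holomorphic_on UNIV" for f z
    using contour_integral_linepath_primitive[OF k[OF that]] by (simp add: V_op_def[abs_def])
  show ?thesis
  proof
    show "\<exists>z. deriv g z \<noteq> 0"
    proof (rule ccontr)
      assume "\<not> ?thesis"
      then have "\<exists>c. \<forall>x\<in>UNIV. g x = c"
        using holomorphic_derivI[OF g open_UNIV]
        by (intro has_field_derivative_zero_constant) auto
      then show False using assms(3) by auto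
    qed
    show "V_op g \<psi> f holomorphic_on UNIV" if "f holomorphic_on UNIV" for f
      using dV[OF that] by (auto simp: holomorphic_on_open)
    show "V_op g \<psi> f 0 = 0" for f by (simp add: V_op_def)
    show "deriv (V_op g \<psi> f) z = f (\<psi> z) * deriv g z" if "f holomorphic_on UNIV" for f z
      using dV[OF that] by (rule DERIV_imp_deriv)
    show "V_op g \<psi> (\<lambda>z. f z - f' z) w = V_op g \<psi> f w - V_op g \<psi> f' w"
      if "f holomorphic_on UNIV" "f' holomorphic_on UNIV" for f f' w
      using contour_integral_diff[OF k[OF that(1), THEN entire_contour_integrable_linepath]
          k[OF that(2), THEN entire_contour_integrable_linepath], of 0 w]
      by (simp add: V_op_def left_diff_distrib)
    show "V_op g \<psi> (\<lambda>z. c * f z) w = c * V_op g \<psi> f w" if "f holomorphic_on UNIV" for f c w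
      using contour_integral_lmul[OF k[OF that, THEN entire_contour_integrable_linepath], of 0 w c]
      by (simp add: V_op_def mult.assoc)
    show "\<exists>C>0. \<forall>f. f holomorphic_on UNIV \<longrightarrow>
      (Lint p (\<lambda>w. fock_weight f w / 1)) \<le> ennreal C * fock_integral p f" for p
      by (intro exI[of _ 1]) (simp add: fock_integral_eq_weight)
    show "fock_integral p (\<lambda>_. 1) < \<infinity>" if "0 < p" for p
      using nn_integral_exp_norm_sq_finite[of "p / 2"] that by (simp add: fock_integral_def)
    show "(\<lambda>n. fs n w) \<longlonglongrightarrow> f w" if "\<And>K. compact K \<Longrightarrow> uniform_limit K fs f sequentially"
      for fs :: "nat \<Rightarrow> complex \<Rightarrow> complex" and f w
      using tendsto_uniform_limitI[OF that[of "{w}"]] by simp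
  qed (use \<psi> dg assms(4) in \<open>auto simp: algebra_simps\<close>)
qed

text \<open>The constants in \<open>omega_le_ev\<close> fit this case: 1 + |c| \<le> 3 |c| holds
  exactly when |c| \<ge> 1/2, as it is for all lattice points. The weight 1 + |w| is the loss by
  differentiation that \<open>fock_dweight\<close> measures.\<close>

lemma J_op_volterra_type:
  assumes g: "g holomorphic_on UNIV" and \<psi>: "\<psi> holomorphic_on UNIV"
    and "\<not> (\<exists>c. \<forall>z. g z = c)" "\<not> (\<exists>c. \<forall>z. \<psi> z = c)"
  shows "volterra_type g \<psi> (J_op g \<psi>) deriv (\<lambda>w. 1 + norm w) cnj (\<lambda>w. w)"
proof -
  have df: "deriv f holomorphic_on UNIV" if "f holomorphic_on UNIV" for f :: "complex \<Rightarrow> complex"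
    using that by (intro holomorphic_deriv) auto
  have fd: "(f has_field_derivative deriv f z) (at z)" if "f holomorphic_on UNIV" for f :: "complex \<Rightarrow> complex" and z
    using that by (simp add: holomorphic_derivI)
  have k: "(\<lambda>w. deriv f (\<psi> w) * g w) holomorphic_on UNIV" if "f holomorphic_on UNIV" for f
    by (intro holomorphic_on_mult entire_compose[OF df[OF that] \<psi>] g)
  have dJ: "(J_op g \<psi> f has_field_derivative deriv f (\<psi> z) * g z) (at z)" if "f holomorphic_on UNIV" for f z
    using contour_integral_linepath_primitive[OF k[OF that]] by (simp add: J_op_def[abs_def])
  have deriv_diff: "deriv (\<lambda>z. f z - f' z) w = deriv f w - deriv f' w"
    if "f holomorphic_on UNIV" "f' holomorphic_on UNIV" for f f' :: "complex \<Rightarrow> complex" and w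
    using DERIV_diff[OF fd[OF that(1)] fd[OF that(2)]] by (rule DERIV_imp_deriv)
  have deriv_cmult: "deriv (\<lambda>z. c * f z) w = c * deriv f w"
    if "f holomorphic_on UNIV" for f :: "complex \<Rightarrow> complex" and c w
    using DERIV_cmult[OF fd[OF that]] by (rule DERIV_imp_deriv)
  show ?thesis
  proof
    show "\<exists>z. g z \<noteq> 0" using assms(3) by metis
    show "J_op g \<psi> f holomorphic_on UNIV" if "f holomorphic_on UNIV" for f
      using dJ[OF that] by (auto simp: holomorphic_on_open)
    show "J_op g \<psi> f 0 = 0" for f by (simp add: J_op_def)
    show "deriv (J_op g \<psi> f) z = deriv f (\<psi> z) * g z" if "f holomorphic_on UNIV" for f z
      using dJ[OF that] by (rule DERIV_imp_deriv)
    show "J_op g \<psi> (\<lambda>z. f z - f' z) w = J_op g \<psi> f w - J_op g \<psi> f' w"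
      if "f holomorphic_on UNIV" "f' holomorphic_on UNIV" for f f' w
      using contour_integral_diff[OF k[OF that(1), THEN entire_contour_integrable_linepath]
          k[OF that(2), THEN entire_contour_integrable_linepath], of 0 w]
      by (simp add: J_op_def deriv_diff[OF that] left_diff_distrib)
    show "J_op g \<psi> (\<lambda>z. c * f z) w = c * J_op g \<psi> f w" if "f holomorphic_on UNIV" for f c w
      using contour_integral_lmul[OF k[OF that, THEN entire_contour_integrable_linepath], of 0 w c]
      by (simp add: J_op_def deriv_cmult[OF that] mult.assoc)
    show "deriv (\<lambda>w. \<Sum>j\<in>A. c j * fock_kernel (d j) w) = (\<lambda>w. \<Sum>j\<in>A. c j * cnj (d j) * fock_kernel (d j) w)"
      for A :: "(int \<times> int) set" and c d
    proof
      fix w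
      have "((\<lambda>w. \<Sum>j\<in>A. c j * fock_kernel (d j) w) has_field_derivative
          (\<Sum>j\<in>A. c j * (cnj (d j) * fock_kernel (d j) w))) (at w)"
        by (intro DERIV_sum DERIV_cmult deriv_fock_kernel)
      then show "deriv (\<lambda>w. \<Sum>j\<in>A. c j * fock_kernel (d j) w) w = (\<Sum>j\<in>A. c j * cnj (d j) * fock_kernel (d j) w)"
        by (simp add: DERIV_imp_deriv mult.assoc)
    qed
    show "\<exists>C>0. \<forall>f. f holomorphic_on UNIV \<longrightarrow>
      (Lint p (\<lambda>w. fock_weight (deriv f) w / (1 + norm w))) \<le> ennreal C * fock_integral p f"
      if p: "0 < p" for p
    proof -
      have eq: "fock_weight (deriv f) w / (1 + norm w) = fock_dweight f w" for f w
        by (simp add: fock_weight_def fock_dweight_def)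
      show ?thesis unfolding eq using nn_integral_fock_dweight_le[OF p] by blast
    qed
    show "fock_integral p (\<lambda>w. w) < \<infinity>" if "0 < p" for p
      by (rule fock_integral_ident_finite[OF that])
    show "1 + norm w \<le> (1 + norm (w - c)) * (1 + norm c)" for w c :: complex
    proof -
      have "norm w \<le> norm (w - c) + norm c" using norm_triangle_ineq[of "w - c" c] by simp
      moreover have "0 \<le> norm (w - c) * norm c" by simp
      ultimately show ?thesis unfolding distrib_left distrib_right by linarith
    qed
  qed (use \<psi> g assms(4) df in \<open>auto simp: deriv_diff intro: deriv_limit_of_uniform_limit\<close>)
qed

theorem theorem2:
  fixes p q :: real and g \<psi> :: "complex \<Rightarrow> complex"
  assumes "0 < q" "q < p"
    and "g holomorphic_on UNIV" "\<psi> holomorphic_on UNIV"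
    and "\<not> (\<exists>c. \<forall>z. g z = c)" "\<not> (\<exists>c. \<forall>z. \<psi> z = c)"
  shows "((fock_bounded_op p q (V_op g \<psi>) \<longleftrightarrow> fock_compact_op p q (V_op g \<psi>)) \<and>
          (fock_compact_op p q (V_op g \<psi>) \<longleftrightarrow> in_Lp (p * q / (p - q)) (M_fun g \<psi>))) \<and>
         ((fock_bounded_op p q (J_op g \<psi>) \<longleftrightarrow> fock_compact_op p q (J_op g \<psi>)) \<and>
         (fock_compact_op p q (J_op g \<psi>) \<longleftrightarrow> in_Lp (p * q / (p - q)) (M_tilde g \<psi>)))"
proof -
  \<comment> \<open>In both instances the function of the claim is \<open>N\<close> times \<omega>
    evaluated at \<open>\<psi> z\<close>.\<close>
  have M: "(\<lambda>z. volterra_weight (deriv g) \<psi> z * 1) = M_fun g \<psi>"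
    by (auto simp: volterra_weight_def M_fun_def)
  have M': "(\<lambda>z. volterra_weight g \<psi> z * (1 + norm (\<psi> z))) = M_tilde g \<psi>"
    by (auto simp: volterra_weight_def M_tilde_def)
  show ?thesis
    using volterra_type.bounded_iff_compact_iff_Lp[OF V_op_volterra_type[OF assms(3-6)] assms(1,2)]
      volterra_type.bounded_iff_compact_iff_Lp[OF J_op_volterra_type[OF assms(3-6)] assms(1,2)]
    unfolding M M' by blast
qed

end
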